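(* Let $K$ be a field of characteristic $0$, $E/K$ an elliptic curve defined over $K$, and $\ell$ a prime. For a positive integer $m$, if $\ell^{m}\ge 3$ and $E(K)\supseteq(\mathbb{Z}/\ell^{m}\mathbb{Z})^{2}$, then for every integer $k\ge 0$ we have $$E\left(K(\mathscr{T}_{k})\right)[\ell^{\infty}]=\mathscr{T}_{k},$$ where $\mathscr{T}_{k}=\{P\in E(\overline{K})[\ell^{\infty}]:\ell^{k}P\in E(K)\}$.
   Context: $\overline{K}$ is a fixed algebraic closure of $K$. For a field $K\subseteq F\subseteq\overline{K}$, $E(F)[\ell^{\infty}]$ is the subgroup of points of $E(F)$ whose order is a power of $\ell$. The notation $E(K)\supseteq(\mathbb{Z}/\ell^{m}\mathbb{Z})^{2}$ means that $E(K)$ contains a subgroup isomorphic to $(\mathbb{Z}/\ell^{m}\mathbb{Z})^{2}$ (equivalently, $E(\overline{K})[\ell^m]\subseteq E(K)$). $K(\mathscr{T}_{k})$ is the field generated over $K$ by the coordinates of the points of $\mathscr{T}_k$. *)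

theory Defs
  imports
    "HOL-Algebra.Algebraic_Closure_Type"
    "HOL-Algebra.Generated_Fields"
    "HOL-Algebra.Elementary_Groups"
begin

text \<open>
  An elliptic curve over \<open>K\<close> is given by a general Weierstrass equation
  \<open>y\<^sup>2 + a1 x y + a3 y = x\<^sup>3 + a2 x\<^sup>2 + a4 x + a6\<close> with coefficients in \<open>K\<close> and nonzero discriminant.
\<close>

datatype 'a weierstrass_curve =
  Weierstrass (wa1: 'a) (wa2: 'a) (wa3: 'a) (wa4: 'a) (wa6: 'a)
  for map: map_curve

definition discriminant :: "'a::field weierstrass_curve \<Rightarrow> 'a" where
  "discriminant E =
    (let b2 = (wa1 E)\<^sup>2 + 4 * wa2 E;
         b4 = 2 * wa4 E + wa1 E * wa3 E;
         b6 = (wa3 E)\<^sup>2 + 4 * wa6 E;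
         b8 = (wa1 E)\<^sup>2 * wa6 E + 4 * wa2 E * wa6 E - wa1 E * wa3 E * wa4 E
                + wa2 E * (wa3 E)\<^sup>2 - (wa4 E)\<^sup>2
     in - (b2\<^sup>2 * b8) - 8 * b4 ^ 3 - 27 * b6\<^sup>2 + 9 * b2 * b4 * b6)"

definition elliptic_curve :: "'a::field weierstrass_curve \<Rightarrow> bool" where
  "elliptic_curve E \<longleftrightarrow> discriminant E \<noteq> 0"

text \<open>
  The set function \<open>coords\<close> generated by the datatype package returns the set of affine coordinates
  of a point; it is empty for the point at infinity.
\<close>

datatype (coords: 'a) ec_point = Infinity | Affine 'a 'a

fun on_curve :: "'a::field weierstrass_curve \<Rightarrow> 'a ec_point \<Rightarrow> bool" where
  "on_curve E Infinity \<longleftrightarrow> True"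
| "on_curve E (Affine x y) \<longleftrightarrow>
     y\<^sup>2 + wa1 E * x * y + wa3 E * y = x ^ 3 + wa2 E * x\<^sup>2 + wa4 E * x + wa6 E"

text \<open>
  Chord-tangent addition. The negative of \<open>(x, y)\<close> is \<open>(x, - y - a1 x - a3)\<close>, so the first test asks
  whether the two points are opposite; \<open>m\<close> is the slope of the chord or tangent, and the sum is the
  negative of its third intersection point with the curve.
\<close>

fun ec_add :: "'a::field weierstrass_curve \<Rightarrow> 'a ec_point \<Rightarrow> 'a ec_point \<Rightarrow> 'a ec_point" where
  "ec_add E Infinity Q = Q"
| "ec_add E P Infinity = P"
| "ec_add E (Affine x1 y1) (Affine x2 y2) =
    (if x1 = x2 \<and> y1 + y2 + wa1 E * x1 + wa3 E = 0 then Infinity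
     else
       let m = (if x1 = x2
                then (3 * x1\<^sup>2 + 2 * wa2 E * x1 + wa4 E - wa1 E * y1) / (2 * y1 + wa1 E * x1 + wa3 E)
                else (y2 - y1) / (x2 - x1));
           x3 = m\<^sup>2 + wa1 E * m - wa2 E - x1 - x2
       in Affine x3 (- (y1 + m * (x3 - x1)) - wa1 E * x3 - wa3 E))"

text \<open>
  All fields between \<open>K\<close> and its algebraic closure are regarded as subsets of \<^typ>\<open>'k alg_closure\<close>;
  \<open>K\<close> itself is \<open>base_field\<close>, and the whole closure is \<^term>\<open>UNIV\<close>.
\<close>

abbreviation base_field :: "'k::field alg_closure set" where
  "base_field \<equiv> range to_ac"

definition ec_group ::
  "'k::field weierstrass_curve \<Rightarrow> 'k alg_closure set \<Rightarrow> 'k alg_closure ec_point monoid" where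
  "ec_group E F =
    \<lparr>carrier = {P. on_curve (map_curve to_ac E) P \<and> coords P \<subseteq> F},
     monoid.mult = ec_add (map_curve to_ac E),
     one = Infinity\<rparr>"

definition primary_torsion ::
  "'k::field weierstrass_curve \<Rightarrow> 'k alg_closure set \<Rightarrow> nat \<Rightarrow> 'k alg_closure ec_point set" where
  "primary_torsion E F l = {P \<in> carrier (ec_group E F). \<exists>n. group.ord (ec_group E F) P = l ^ n}"

definition division_torsion ::
  "'k::field weierstrass_curve \<Rightarrow> nat \<Rightarrow> nat \<Rightarrow> 'k alg_closure ec_point set" where
  "division_torsion E l k =
    {P \<in> primary_torsion E UNIV l.
       P [^]\<^bsub>ec_group E UNIV\<^esub> (l ^ k) \<in> carrier (ec_group E base_field)}"

definition coordinate_field ::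
  "'k::field alg_closure ec_point set \<Rightarrow> 'k alg_closure set" where
  "coordinate_field T = generate_field ring_of_type_algebra (base_field \<union> (\<Union>P\<in>T. coords P))"

definition contains_copy :: "('a, 'c) monoid_scheme \<Rightarrow> ('b, 'd) monoid_scheme \<Rightarrow> bool" where
  "contains_copy G A \<longleftrightarrow> (\<exists>H. subgroup H G \<and> G\<lparr>carrier := H\<rparr> \<cong> A)"

end

theory Submission
  imports Defs
begin

text \<open>
  Let \<open>\<sigma>\<close> be a \<open>K\<close>-endomorphism of the algebraic closure and \<open>\<delta> = \<sigma> - 1\<close> its displacement on
  the points of the curve, and write \<open>\<T>\<^sub>k\<close> for \<open>division_torsion E l k\<close>. The idea is that, for \<open>x\<close> of
  \<open>l\<close>-power order, \<open>\<sigma>\<close> fixes \<open>l\<^sup>k x\<close> if and only if the iterate \<open>\<sigma> ^^ (l ^ k)\<close> fixes \<open>x\<close>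
  (\<open>iterate_fixes_iff\<close>). From this the theorem follows formally. By the definition of \<open>\<T>\<^sub>k\<close> and one
  direction of the equivalence, \<open>\<sigma> ^^ (l ^ k)\<close> fixes every point of \<open>\<T>\<^sub>k\<close>, hence the field generated by their
  coordinates, hence every point \<open>P\<close> over that field; by the other direction \<open>\<sigma>\<close> fixes \<open>l\<^sup>k P\<close> if \<open>P\<close> has
  \<open>l\<close>-power order. As \<open>\<sigma>\<close> is arbitrary and only elements of \<open>K\<close> are fixed by all endomorphisms
  (\<open>base_endomorphism_moves\<close>), \<open>l\<^sup>k P\<close> is rational over \<open>K\<close>, so \<open>P\<close> lies in \<open>\<T>\<^sub>k\<close>.

  The equivalence is a binomial expansion. All \<open>l\<^sup>m\<close>-torsion is rational, so \<open>\<delta>\<close> kills it and therefore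
  lowers \<open>l\<close>-power orders by a factor \<open>l\<^sup>m\<close>, or down to one. In
  \<open>\<sigma>\<^sup>l - 1 = l \<delta> + (l choose 2) \<delta>\<^sup>2 + \<dots>\<close> the terms after the first then have order at most that of
  \<open>l\<^sup>2 \<delta>\<close>; this is where \<open>l\<^sup>m \<ge> 3\<close> enters, since for \<open>m = 1\<close> it
  needs \<open>l\<close> to divide \<open>l choose 2\<close>. So \<open>(\<sigma>\<^sup>l - 1) x\<close> and \<open>l \<delta> x\<close> have
  the same order, and induction on \<open>k\<close> finishes the argument.

  Two facts about elliptic curves are needed. The first is the group law, whose associativity is
  \<open>ec_add_assoc\<close>: a point is sent to the class of its maximal ideal in the coordinate ring, chord-tangent
  addition becomes multiplication of ideals up to principal factors, and the degree of the norm to the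
  polynomial ring shows that the class determines the point. The second is that there are at most
  \<open>n\<^sup>2\<close> points killed by \<open>n\<close> (\<open>card_torsion_le\<close>), so that a copy of \<open>(\<int>/l\<^sup>m)\<^sup>2\<close> over \<open>K\<close> exhausts the
  \<open>l\<^sup>m\<close>-torsion. For this, the abscissa of \<open>n P\<close> is written as a rational function of that of \<open>P\<close>; the
  classical formulas for the sum and product of the abscissas of \<open>P + Q\<close> and \<open>P - Q\<close> bound the second
  difference of the degrees of these functions by \<open>2\<close>, so their degrees are at most \<open>n\<^sup>2\<close>, and counting a
  generic fibre of multiplication by \<open>n\<close> bounds its kernel.
\<close>


section \<open>The chord-tangent construction\<close>

definition ec_neg :: "'a::field weierstrass_curve \<Rightarrow> 'a ec_point \<Rightarrow> 'a ec_point" where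
  "ec_neg E P = (case P of Infinity \<Rightarrow> Infinity
     | Affine x y \<Rightarrow> Affine x (- y - wa1 E * x - wa3 E))"

lemma ec_neg_simps [simp]:
  "ec_neg E Infinity = Infinity"
  "ec_neg E (Affine x y) = Affine x (- y - wa1 E * x - wa3 E)"
  by (simp_all add: ec_neg_def)

definition ec_slope :: "'a::field weierstrass_curve \<Rightarrow> 'a \<Rightarrow> 'a \<Rightarrow> 'a \<Rightarrow> 'a \<Rightarrow> 'a" where
  "ec_slope E x1 y1 x2 y2 =
     (if x1 = x2 then (3 * x1\<^sup>2 + 2 * wa2 E * x1 + wa4 E - wa1 E * y1) / (2 * y1 + wa1 E * x1 + wa3 E)
      else (y2 - y1) / (x2 - x1))"

lemma ec_add_Affine:
  assumes "\<not> (x1 = x2 \<and> y1 + y2 + wa1 E * x1 + wa3 E = 0)"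
  defines "m \<equiv> ec_slope E x1 y1 x2 y2"
  defines "x3 \<equiv> m\<^sup>2 + wa1 E * m - wa2 E - x1 - x2"
  shows "ec_add E (Affine x1 y1) (Affine x2 y2) = ec_neg E (Affine x3 (y1 + m * (x3 - x1)))"
  using assms(1) by (simp add: Let_def m_def x3_def ec_slope_def)

lemma ec_add_Infinity_right [simp]: "ec_add E P Infinity = P"
  by (cases P) auto

text \<open>
  The equation of the curve is quadratic in the ordinate, so a point and its negative are the only
  points with a given abscissa.
\<close>

lemma same_x_on_curve:
  fixes E :: "'a::field weierstrass_curve"
  assumes "on_curve E (Affine x y1)" "on_curve E (Affine x y2)"
  shows "y2 = y1 \<or> y1 + y2 + wa1 E * x + wa3 E = 0"
proof -
  have "(y2 - y1) * (y1 + y2 + wa1 E * x + wa3 E) = 0"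
    using assms by simp Groebner_Basis.algebra
  then show ?thesis by auto
qed

text \<open>
  The line through the two points (the tangent, if they coincide) has the equation \<open>y = m x + c\<close>, and
  substituting it into the equation of the curve gives a cubic in \<open>x\<close> with the roots \<open>x1\<close>, \<open>x2\<close>, \<open>x3\<close>. The
  last two claims compare its lower coefficients with those of \<open>(x - x1) (x - x2) (x - x3)\<close>; the
  coefficient of \<open>x\<^sup>2\<close> is what defines \<open>x3\<close>. The difference of the two cubics is thus linear in \<open>x\<close>. It has
  the two zeros \<open>x1\<close> and \<open>x2\<close> in the case of a chord, and a double zero at \<open>x1\<close> in the case of a tangent.
\<close>

lemma line_meets_curve:
  fixes E :: "'a::field weierstrass_curve"
  assumes P: "on_curve E (Affine x1 y1)" and Q: "on_curve E (Affine x2 y2)"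
    and nopp: "\<not> (x1 = x2 \<and> y1 + y2 + wa1 E * x1 + wa3 E = 0)"
  defines "m \<equiv> ec_slope E x1 y1 x2 y2"
  defines "c \<equiv> y1 - m * x1"
  defines "x3 \<equiv> m\<^sup>2 + wa1 E * m - wa2 E - x1 - x2"
  shows "y2 = m * x2 + c"
    and "2 * m * c + wa1 E * c + wa3 E * m - wa4 E = - (x1 * x2 + x1 * x3 + x2 * x3)"
    and "c\<^sup>2 + wa3 E * c - wa6 E = x1 * x2 * x3"
proof -
  have "y2 = m * x2 + c
    \<and> 2 * m * c + wa1 E * c + wa3 E * m - wa4 E = - (x1 * x2 + x1 * x3 + x2 * x3)
    \<and> c\<^sup>2 + wa3 E * c - wa6 E = x1 * x2 * x3"
  proof (cases "x1 = x2")
    case False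
    then have nz: "x2 - x1 \<noteq> 0" by simp
    have slope: "m * (x2 - x1) = y2 - y1" using False by (simp add: m_def ec_slope_def)
    have on_line: "y2 = m * x2 + c" using slope by (simp add: c_def algebra_simps)
    have "(x2 - x1) * (2 * m * c + wa1 E * c + wa3 E * m - wa4 E + (x1 * x2 + x1 * x3 + x2 * x3)) = 0"
      using P Q on_line unfolding c_def x3_def on_curve.simps by Groebner_Basis.algebra
    with nz have lin: "2 * m * c + wa1 E * c + wa3 E * m - wa4 E = - (x1 * x2 + x1 * x3 + x2 * x3)"
      by (metis add_eq_0_iff2 mult_eq_0_iff)
    have "c\<^sup>2 + wa3 E * c - wa6 E = x1 * x2 * x3"
      using P lin unfolding c_def x3_def on_curve.simps by Groebner_Basis.algebra
    with lin on_line show ?thesis by blast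
  next
    case True
    with nopp same_x_on_curve[of E x1 y1 y2] P Q have y: "y2 = y1" by auto
    have nz: "2 * y1 + wa1 E * x1 + wa3 E \<noteq> 0" using nopp True y by (simp add: algebra_simps)
    then have slope: "m * (2 * y1 + wa1 E * x1 + wa3 E) = 3 * x1\<^sup>2 + 2 * wa2 E * x1 + wa4 E - wa1 E * y1"
      using True by (simp add: m_def ec_slope_def)
    have lin: "2 * m * c + wa1 E * c + wa3 E * m - wa4 E = - (x1 * x2 + x1 * x3 + x2 * x3)"
      using slope unfolding c_def x3_def True[symmetric] by Groebner_Basis.algebra
    have "c\<^sup>2 + wa3 E * c - wa6 E = x1 * x2 * x3"
      using P lin unfolding c_def x3_def True[symmetric] on_curve.simps by Groebner_Basis.algebra
    with lin y True show ?thesis by (simp add: c_def)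
  qed
  then show "y2 = m * x2 + c"
    and "2 * m * c + wa1 E * c + wa3 E * m - wa4 E = - (x1 * x2 + x1 * x3 + x2 * x3)"
    and "c\<^sup>2 + wa3 E * c - wa6 E = x1 * x2 * x3" by auto
qed

lemma on_curve_ec_neg: "on_curve E P \<Longrightarrow> on_curve E (ec_neg E P)"
proof (cases P)
  case (Affine x y)
  assume "on_curve E P"
  then show ?thesis unfolding Affine ec_neg_simps on_curve.simps by Groebner_Basis.algebra
qed simp

lemma on_curve_ec_add:
  fixes E :: "'a::field weierstrass_curve"
  assumes "on_curve E P" "on_curve E Q"
  shows "on_curve E (ec_add E P Q)"
proof (cases "\<exists>x1 y1 x2 y2. P = Affine x1 y1 \<and> Q = Affine x2 y2 \<and>
    \<not> (x1 = x2 \<and> y1 + y2 + wa1 E * x1 + wa3 E = 0)")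
  case False
  then show ?thesis using assms by (cases P; cases Q) auto
next
  case True
  then obtain x1 y1 x2 y2 where PQ: "P = Affine x1 y1" "Q = Affine x2 y2"
    and nopp: "\<not> (x1 = x2 \<and> y1 + y2 + wa1 E * x1 + wa3 E = 0)" by blast
  define m where "m = ec_slope E x1 y1 x2 y2"
  define x3 where "x3 = m\<^sup>2 + wa1 E * m - wa2 E - x1 - x2"
  define c where "c = y1 - m * x1"
  note l = line_meets_curve[OF assms[unfolded PQ] nopp, folded m_def, folded x3_def c_def]
  have "on_curve E (Affine x3 (y1 + m * (x3 - x1)))"
    using l(2,3) x3_def c_def unfolding on_curve.simps by Groebner_Basis.algebra
  then show ?thesis
    unfolding PQ ec_add_Affine[OF nopp] m_def[symmetric] x3_def[symmetric] by (rule on_curve_ec_neg)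
qed

lemma ec_add_commute:
  fixes E :: "'a::field weierstrass_curve"
  assumes "on_curve E P" "on_curve E Q"
  shows "ec_add E P Q = ec_add E Q P"
proof (cases "\<exists>x1 y1 x2 y2. P = Affine x1 y1 \<and> Q = Affine x2 y2 \<and>
    \<not> (x1 = x2 \<and> y1 + y2 + wa1 E * x1 + wa3 E = 0)")
  case False
  then show ?thesis using assms by (cases P; cases Q) (auto simp: algebra_simps)
next
  case True
  then obtain x1 y1 x2 y2 where PQ: "P = Affine x1 y1" "Q = Affine x2 y2"
    and nopp: "\<not> (x1 = x2 \<and> y1 + y2 + wa1 E * x1 + wa3 E = 0)" by blast
  then have nopp': "\<not> (x2 = x1 \<and> y2 + y1 + wa1 E * x2 + wa3 E = 0)" by (auto simp: algebra_simps)
  have m: "ec_slope E x1 y1 x2 y2 = ec_slope E x2 y2 x1 y1"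
  proof (cases "x1 = x2")
    case True
    with nopp same_x_on_curve[of E x1 y1 y2] assms PQ show ?thesis by auto
  next
    case False
    then show ?thesis by (simp add: ec_slope_def divide_simps) (simp add: algebra_simps)
  qed
  have "y2 = ec_slope E x1 y1 x2 y2 * x2 + (y1 - ec_slope E x1 y1 x2 y2 * x1)"
    by (rule line_meets_curve[OF assms[unfolded PQ] nopp])
  then show ?thesis
    unfolding PQ ec_add_Affine[OF nopp] ec_add_Affine[OF nopp'] m[symmetric]
    by (simp add: algebra_simps)
qed

text \<open>
  The two hypotheses on derivatives would make \<open>(x, y)\<close> a singular point. Moving it to the origin then
  gives a curve with vanishing \<open>a3\<close>, \<open>a4\<close> and \<open>a6\<close>, whose discriminant is zero. In terms of the original
  curve: \<open>b4\<close>, \<open>b6\<close> and \<open>b8\<close> are polynomials in \<open>b2\<close> and \<open>x\<close> for which the discriminant vanishes identically.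
\<close>

lemma nonsingular_point:
  fixes E :: "'a::field weierstrass_curve"
  assumes "elliptic_curve E" "on_curve E (Affine x y)"
    and "2 * y + wa1 E * x + wa3 E = 0"
  shows "3 * x\<^sup>2 + 2 * wa2 E * x + wa4 E - wa1 E * y \<noteq> 0"
proof
  assume *: "3 * x\<^sup>2 + 2 * wa2 E * x + wa4 E - wa1 E * y = 0"
  define b2 where "b2 = (wa1 E)\<^sup>2 + 4 * wa2 E"
  have b4: "2 * wa4 E + wa1 E * wa3 E = - (6 * x\<^sup>2) - b2 * x"
    using assms(3) * unfolding b2_def by Groebner_Basis.algebra
  have b6: "(wa3 E)\<^sup>2 + 4 * wa6 E = 8 * x ^ 3 + b2 * x\<^sup>2"
    using assms(2,3) * unfolding b2_def on_curve.simps by Groebner_Basis.algebra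
  have b8: "(wa1 E)\<^sup>2 * wa6 E + 4 * wa2 E * wa6 E - wa1 E * wa3 E * wa4 E
      + wa2 E * (wa3 E)\<^sup>2 - (wa4 E)\<^sup>2 = - (9 * x ^ 4) - b2 * x ^ 3"
  proof -
    have a3: "wa3 E = - (2 * y) - wa1 E * x"
      using assms(3) by Groebner_Basis.algebra
    have a4: "wa4 E = wa1 E * y - 3 * x\<^sup>2 - 2 * wa2 E * x"
      using * by Groebner_Basis.algebra
    have a6: "wa6 E = - y\<^sup>2 + 2 * x ^ 3 + wa2 E * x\<^sup>2 - wa1 E * x * y"
      using assms(2) a3 a4 unfolding on_curve.simps by Groebner_Basis.algebra
    show ?thesis unfolding a3 a4 a6 b2_def by Groebner_Basis.algebra
  qed
  have "discriminant E = 0"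
    unfolding discriminant_def Let_def b4 b6 b8 b2_def[symmetric] by Groebner_Basis.algebra
  with assms(1) show False by (simp add: elliptic_curve_def)
qed


section \<open>Products of fractional ideals\<close>

text \<open>
  The product of two ideals as the additive span of the pairwise products. Since it is formed inside a
  field, multiples \<open>c I\<close> by arbitrary field elements are available as images under \<open>(*) c\<close>, and two ideals
  are in the same class if one is such a multiple of the other.
\<close>

inductive_set ideal_prod :: "'l::field set \<Rightarrow> 'l set \<Rightarrow> 'l set" for I J where
  zero: "0 \<in> ideal_prod I J"
| add: "i \<in> I \<Longrightarrow> j \<in> J \<Longrightarrow> z \<in> ideal_prod I J \<Longrightarrow> i * j + z \<in> ideal_prod I J"

lemma ideal_prod_mult: "i \<in> I \<Longrightarrow> j \<in> J \<Longrightarrow> i * j \<in> ideal_prod I J"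
  using ideal_prod.add[OF _ _ ideal_prod.zero] by fastforce

lemma ideal_prod_plus: "x \<in> ideal_prod I J \<Longrightarrow> y \<in> ideal_prod I J \<Longrightarrow> x + y \<in> ideal_prod I J"
  by (induction rule: ideal_prod.induct) (auto simp: add.assoc intro: ideal_prod.intros)

lemma ideal_prod_subsetI:
  assumes "0 \<in> K" "\<And>x y. x \<in> K \<Longrightarrow> y \<in> K \<Longrightarrow> x + y \<in> K"
    and "\<And>i j. i \<in> I \<Longrightarrow> j \<in> J \<Longrightarrow> i * j \<in> K"
  shows "ideal_prod I J \<subseteq> K"
proof
  fix z assume "z \<in> ideal_prod I J"
  then show "z \<in> K" by (induction rule: ideal_prod.induct) (auto intro: assms)
qed

lemma ideal_prod_commute: "ideal_prod I J = ideal_prod J I"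
proof -
  have "ideal_prod I J \<subseteq> ideal_prod J I" for I J :: "'a set"
  proof (rule ideal_prod_subsetI)
    show "i * j \<in> ideal_prod J I" if "i \<in> I" "j \<in> J" for i j
      using ideal_prod_mult[OF that(2,1)] by (simp add: mult.commute)
  qed (auto intro: ideal_prod.zero ideal_prod_plus)
  then show ?thesis by blast
qed

lemma ideal_prod_assoc: "ideal_prod (ideal_prod I J) K = ideal_prod I (ideal_prod J K)"
proof -
  have *: "ideal_prod (ideal_prod I J) K \<subseteq> ideal_prod I (ideal_prod J K)" for I J K :: "'a set"
  proof (rule ideal_prod_subsetI)
    fix z k assume "z \<in> ideal_prod I J" and k: "k \<in> K"
    then show "z * k \<in> ideal_prod I (ideal_prod J K)"
    proof (induction rule: ideal_prod.induct)
      case (add i j z)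
      have "i * (j * k) + z * k \<in> ideal_prod I (ideal_prod J K)"
        using add k by (auto intro!: ideal_prod_plus intro: ideal_prod_mult)
      then show ?case by (simp add: algebra_simps)
    qed (simp add: ideal_prod.zero)
  qed (auto intro: ideal_prod.zero ideal_prod_plus)
  have "ideal_prod I (ideal_prod J K) = ideal_prod (ideal_prod K J) I"
    by (simp add: ideal_prod_commute)
  also have "\<dots> \<subseteq> ideal_prod K (ideal_prod J I)" by (rule *)
  also have "\<dots> = ideal_prod (ideal_prod I J) K" by (simp add: ideal_prod_commute)
  finally show ?thesis using *[of I J K] by blast
qed

lemma ideal_prod_scale: "ideal_prod ((*) c ` I) J = (*) c ` ideal_prod I J"
proof
  show "ideal_prod ((*) c ` I) J \<subseteq> (*) c ` ideal_prod I J"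
  proof (rule ideal_prod_subsetI)
    show "0 \<in> (*) c ` ideal_prod I J" by (rule image_eqI[of _ _ 0]) (auto intro: ideal_prod.zero)
    show "x + y \<in> (*) c ` ideal_prod I J" if "x \<in> (*) c ` ideal_prod I J" "y \<in> (*) c ` ideal_prod I J" for x y
      using that by (auto simp: distrib_left[symmetric] intro: ideal_prod_plus)
  qed (auto simp: mult.assoc intro: ideal_prod_mult)
  show "(*) c ` ideal_prod I J \<subseteq> ideal_prod ((*) c ` I) J"
  proof safe
    fix z assume "z \<in> ideal_prod I J"
    then show "c * z \<in> ideal_prod ((*) c ` I) J"
    proof (induction rule: ideal_prod.induct)
      case (add i j z)
      then have "(c * i) * j + c * z \<in> ideal_prod ((*) c ` I) J" by (intro ideal_prod.add) auto
      then show ?case by (simp add: algebra_simps)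
    qed (simp add: ideal_prod.zero)
  qed
qed

lemma scale_scale: "(*) c ` (*) d ` I = (*) (c * d :: 'a::field) ` I"
  by (simp add: image_image mult.assoc)

lemma scale_cancel: "(c::'a::field) \<noteq> 0 \<Longrightarrow> (*) c ` I = (*) c ` J \<Longrightarrow> I = J"
  by (simp add: inj_image_eq_iff inj_on_def)

lemma scale_divide: "(c::'a::field) \<noteq> 0 \<Longrightarrow> (*) c ` I = (*) d ` J \<Longrightarrow> I = (*) (d / c) ` J"
  by (rule scale_cancel[of c]) (simp_all only: scale_scale nonzero_mult_div_cancel_left times_divide_eq_right not_False_eq_True)

section \<open>The coordinate ring and its norm\<close>

text \<open>
  The coordinate ring of the affine curve, realised inside a field: \<open>emb\<close> embeds the polynomials in the
  abscissa, and \<open>Y\<close> is a root of the Weierstrass equation over them. The ring is \<open>R\<close> below, with the basis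
  \<open>1\<close>, \<open>Y\<close> over the polynomial ring.
\<close>

locale coordinate_ring =
  fixes E :: "'a::field weierstrass_curve" and emb :: "'a poly \<Rightarrow> 'l::field" and Y :: 'l
  assumes emb_add [simp]: "emb (p + q) = emb p + emb q"
    and emb_mult [simp]: "emb (p * q) = emb p * emb q"
    and emb_1 [simp]: "emb 1 = 1"
    and emb_eq_0D: "emb p = 0 \<Longrightarrow> p = 0"
    and Y_root: "Y\<^sup>2 + emb [:wa3 E, wa1 E:] * Y = emb [:wa6 E, wa4 E, wa2 E, 1:]"
    and elliptic: "elliptic_curve E"
begin

lemma emb_0 [simp]: "emb 0 = 0"
  using emb_add[of 0 0] by (metis add_cancel_right_right add_0)

lemma emb_uminus [simp]: "emb (- p) = - emb p"
  using emb_add[of p "- p"] by (simp add: eq_neg_iff_add_eq_0 add.commute)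

lemma emb_diff [simp]: "emb (p - q) = emb p - emb q"
  using emb_add[of p "- q"] by simp

lemma emb_power [simp]: "emb (p ^ n) = emb p ^ n"
  by (induction n) auto

lemma emb_eq_iff [simp]: "emb p = emb q \<longleftrightarrow> p = q"
  using emb_eq_0D[of "p - q"] by auto

lemma emb_eq_0_iff [simp]: "emb p = 0 \<longleftrightarrow> p = 0"
  using emb_eq_0D by auto

abbreviation lin_coeff where "lin_coeff \<equiv> [:wa3 E, wa1 E:]"
abbreviation cubic where "cubic \<equiv> [:wa6 E, wa4 E, wa2 E, 1:]"

definition elem :: "'a poly \<Rightarrow> 'a poly \<Rightarrow> 'l" where
  "elem f g = emb f + emb g * Y"

definition R :: "'l set" where
  "R = {elem f g | f g. True}"

lemma elem_in_R [simp]: "elem f g \<in> R"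
  by (auto simp: R_def)

lemma elem_add: "elem f g + elem f' g' = elem (f + f') (g + g')"
  by (simp add: elem_def algebra_simps)

lemma elem_uminus: "- elem f g = elem (- f) (- g)"
  by (simp add: elem_def algebra_simps)

lemma elem_mult:
  "elem f g * elem f' g' = elem (f * f' + g * g' * cubic) (f * g' + g * f' - g * g' * lin_coeff)"
proof -
  have "elem f g * elem f' g' = emb f * emb f' + (emb f * emb g' + emb g * emb f') * Y + emb g * emb g' * Y\<^sup>2"
    by (simp add: elem_def algebra_simps power2_eq_square)
  also have "Y\<^sup>2 = emb cubic - emb lin_coeff * Y"
    using Y_root by (simp add: algebra_simps)
  finally show ?thesis by (simp only: elem_def emb_add emb_mult emb_diff) (simp only: algebra_simps)
qed

lemma R_add [intro]: "r \<in> R \<Longrightarrow> s \<in> R \<Longrightarrow> r + s \<in> R"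
  by (auto simp: R_def elem_add; blast)
lemma R_uminus [intro]: "r \<in> R \<Longrightarrow> - r \<in> R"
  by (auto simp: R_def elem_uminus; blast)
lemma R_diff [intro]: "r \<in> R \<Longrightarrow> s \<in> R \<Longrightarrow> r - s \<in> R"
  using R_add[of r "- s"] R_uminus by auto
lemma R_mult [intro]: "r \<in> R \<Longrightarrow> s \<in> R \<Longrightarrow> r * s \<in> R"
  by (auto simp: R_def elem_mult; blast)
lemma emb_in_R [intro, simp]: "emb p \<in> R"
  using elem_in_R[of p 0] by (simp add: elem_def)
lemma Y_in_R [intro, simp]: "Y \<in> R"
  using elem_in_R[of 0 1] by (simp add: elem_def)
lemma one_in_R [intro, simp]: "1 \<in> R"
  using emb_in_R[of 1] by simp
lemma zero_in_R [intro, simp]: "0 \<in> R"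
  using emb_in_R[of 0] by simp

text \<open>
  The product of \<open>f + g Y\<close> with its conjugate, the conjugate of \<open>Y\<close> being \<open>- Y - a1 x - a3\<close>.
\<close>

definition field_norm :: "'a poly \<Rightarrow> 'a poly \<Rightarrow> 'a poly" where
  "field_norm f g = f\<^sup>2 - f * g * lin_coeff - g\<^sup>2 * cubic"

text \<open>
  The arguments on the left are the coordinates of a product, as computed in \<open>elem_mult\<close>.
\<close>

lemma field_norm_mult:
  "field_norm (f * f' + g * g' * cubic) (f * g' + g * f' - g * g' * lin_coeff)
     = field_norm f g * field_norm f' g'"
  unfolding field_norm_def by Groebner_Basis.algebra

text \<open>
  The first and last terms of the norm have the degrees \<open>2 deg f\<close> and \<open>2 deg g + 3\<close>. These differ in
  parity, so they cannot cancel, and the middle term is too small to interfere.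
\<close>

lemma degree_field_norm:
  assumes "g \<noteq> 0"
  shows "Polynomial.degree (field_norm f g) = max (2 * Polynomial.degree f) (2 * Polynomial.degree g + 3)"
proof -
  let ?d = "Polynomial.degree"
  have c: "?d (g\<^sup>2 * cubic) = 2 * ?d g + 3"
    using assms by (subst degree_mult_eq) (simp_all add: degree_power_eq del: mult_pCons_right)
  have f2: "?d (f\<^sup>2) = 2 * ?d f"
    by (cases "f = 0") (simp_all add: degree_power_eq)
  have "?d (f * g * lin_coeff) \<le> ?d (f * g) + ?d lin_coeff" by (rule degree_mult_le)
  also have "?d lin_coeff \<le> 1" by simp
  also have "?d (f * g) \<le> ?d f + ?d g" by (rule degree_mult_le)
  finally have fg: "?d (f * g * lin_coeff) \<le> ?d f + ?d g + 1" by simp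
  show ?thesis
  proof (cases "2 * ?d f < 2 * ?d g + 3")
    case True
    have "?d (f\<^sup>2 - f * g * lin_coeff) < 2 * ?d g + 3"
      using True fg f2 by (intro degree_diff_less) auto
    then have "?d (field_norm f g) = ?d (- (g\<^sup>2 * cubic))"
      unfolding field_norm_def diff_conv_add_uminus[of _ "g\<^sup>2 * cubic"]
      by (intro degree_add_eq_right) (simp only: c degree_minus)
    then have "?d (field_norm f g) = 2 * ?d g + 3" by (simp only: degree_minus c)
    with True show ?thesis by linarith
  next
    case False
    then have "?d f + ?d g + 1 < 2 * ?d f" "2 * ?d g + 3 < 2 * ?d f" by presburger+
    then have lt: "?d (f * g * lin_coeff + g\<^sup>2 * cubic) < ?d (f\<^sup>2)"
      using fg unfolding f2 by (intro degree_add_less) (linarith, simp only: c)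
    have "field_norm f g = f\<^sup>2 + - (f * g * lin_coeff + g\<^sup>2 * cubic)"
      by (simp add: field_norm_def)
    with lt have "?d (field_norm f g) = ?d (f\<^sup>2)"
      by (metis degree_add_eq_left degree_minus)
    with f2 False show ?thesis by simp
  qed
qed

text \<open>
  An element that vanishes has norm zero, which the degree formula excludes unless \<open>g = 0\<close>. Hence \<open>1\<close> and
  \<open>Y\<close> are linearly independent over the polynomials.
\<close>

lemma elem_eq_0D:
  assumes "elem f g = 0" shows "f = 0 \<and> g = 0"
proof -
  have "emb (field_norm f g) = elem f g * (emb f - emb g * Y - emb g * emb lin_coeff)"
    unfolding field_norm_def elem_def emb_diff emb_mult emb_power Y_root[symmetric]
    by Groebner_Basis.algebra
  with assms have "field_norm f g = 0" by simp
  with degree_field_norm[of g f] have "g = 0" by (cases "g = 0") auto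
  with assms show ?thesis by (simp add: elem_def)
qed

lemma elem_eqD:
  assumes "elem f g = elem f' g'" shows "f = f' \<and> g = g'"
proof -
  have "elem (f - f') (g - g') = 0"
    using assms by (simp add: elem_def algebra_simps)
  from elem_eq_0D[OF this] show ?thesis by simp
qed

section \<open>Ideal classes of points and associativity\<close>

definition is_module :: "'l set \<Rightarrow> bool" where
  "is_module I \<longleftrightarrow> 0 \<in> I \<and> (\<forall>x\<in>I. \<forall>y\<in>I. x + y \<in> I) \<and> (\<forall>r\<in>R. \<forall>x\<in>I. r * x \<in> I)"

definition ideal2 :: "'l \<Rightarrow> 'l \<Rightarrow> 'l set" where
  "ideal2 a b = {r * a + s * b | r s. r \<in> R \<and> s \<in> R}"

lemma ideal2_I: "r \<in> R \<Longrightarrow> s \<in> R \<Longrightarrow> z = r * a + s * b \<Longrightarrow> z \<in> ideal2 a b"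
  by (auto simp: ideal2_def)

lemma is_module_R: "is_module R"
  by (auto simp: is_module_def)

lemma is_module_ideal2: "is_module (ideal2 a b)"
  unfolding is_module_def
proof (intro conjI ballI)
  show "0 \<in> ideal2 a b" by (rule ideal2_I[of 0 0]) auto
next
  fix x y assume "x \<in> ideal2 a b" "y \<in> ideal2 a b"
  then obtain r s r' s' where "r \<in> R" "s \<in> R" "r' \<in> R" "s' \<in> R"
    "x = r * a + s * b" "y = r' * a + s' * b" by (auto simp: ideal2_def)
  then show "x + y \<in> ideal2 a b" by (intro ideal2_I[of "r + r'" "s + s'"]) (auto simp: algebra_simps)
next
  fix t x assume "t \<in> R" "x \<in> ideal2 a b"
  then obtain r s where "r \<in> R" "s \<in> R" "x = r * a + s * b" by (auto simp: ideal2_def)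
  with \<open>t \<in> R\<close> show "t * x \<in> ideal2 a b"
    by (intro ideal2_I[of "t * r" "t * s"]) (auto simp: algebra_simps)
qed

lemma is_module_scale: "is_module I \<Longrightarrow> is_module ((*) c ` I)"
  unfolding is_module_def
  by (auto simp: distrib_left[symmetric] mult.left_commute[of _ c] intro: image_eqI[of _ _ 0])

lemma is_module_ideal_prod:
  assumes "is_module I" shows "is_module (ideal_prod I J)"
proof -
  have "r * z \<in> ideal_prod I J" if "r \<in> R" "z \<in> ideal_prod I J" for r z
    using that(2)
  proof (induction rule: ideal_prod.induct)
    case (add i j z)
    then have "(r * i) * j + r * z \<in> ideal_prod I J"
      using assms that(1) by (intro ideal_prod.add) (auto simp: is_module_def)
    then show ?case by (simp add: algebra_simps)
  qed (simp add: ideal_prod.zero)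
  then show ?thesis by (auto simp: is_module_def intro: ideal_prod.zero ideal_prod_plus)
qed

lemma ideal_prod_subset_module:
  "is_module K \<Longrightarrow> (\<And>i j. i \<in> I \<Longrightarrow> j \<in> J \<Longrightarrow> i * j \<in> K) \<Longrightarrow> ideal_prod I J \<subseteq> K"
  by (rule ideal_prod_subsetI) (auto simp: is_module_def)

lemma ideal_prod_R: "is_module I \<Longrightarrow> ideal_prod R I = I"
proof
  assume I: "is_module I"
  show "ideal_prod R I \<subseteq> I" using I by (rule ideal_prod_subset_module) (use I in \<open>auto simp: is_module_def\<close>)
  show "I \<subseteq> ideal_prod R I"
    using ideal_prod_mult[of 1 R _ I] by auto
qed

lemma ideal2_shift: 
  assumes "t \<in> R" shows "ideal2 a (b + t * a) = ideal2 a b"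
proof
  show "ideal2 a (b + t * a) \<subseteq> ideal2 a b"
  proof
    fix z assume "z \<in> ideal2 a (b + t * a)"
    then obtain r s where "r \<in> R" "s \<in> R" "z = r * a + s * (b + t * a)" by (auto simp: ideal2_def)
    with assms show "z \<in> ideal2 a b"
      by (intro ideal2_I[of "r + s * t" s]) (auto simp: algebra_simps)
  qed
  show "ideal2 a b \<subseteq> ideal2 a (b + t * a)"
  proof
    fix z assume "z \<in> ideal2 a b"
    then obtain r s where "r \<in> R" "s \<in> R" "z = r * a + s * b" by (auto simp: ideal2_def)
    with assms show "z \<in> ideal2 a (b + t * a)"
      by (intro ideal2_I[of "r - s * t" s]) (auto simp: algebra_simps)
  qed
qed

lemma ideal2_uminus: "ideal2 a (- b) = ideal2 a b"
proof -
  have "ideal2 a (- b) \<subseteq> ideal2 a b" for b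
  proof
    fix z assume "z \<in> ideal2 a (- b)"
    then obtain r s where "r \<in> R" "s \<in> R" "z = r * a + s * (- b)" by (auto simp: ideal2_def)
    then show "z \<in> ideal2 a b" by (intro ideal2_I[of r "- s"]) auto
  qed
  from this[of b] this[of "- b"] show ?thesis by auto
qed

abbreviation lin :: "'a \<Rightarrow> 'l" where "lin x \<equiv> emb [:- x, 1:]"
abbreviation cst :: "'a \<Rightarrow> 'l" where "cst c \<equiv> emb [:c:]"

lemma cst_1 [simp]: "cst 1 = 1"
  by (metis emb_1 one_pCons)

definition point_ideal :: "'a ec_point \<Rightarrow> 'l set" where
  "point_ideal P = (case P of Infinity \<Rightarrow> R | Affine x y \<Rightarrow> ideal2 (lin x) (Y - cst y))"

lemma point_ideal_simps [simp]:
  "point_ideal Infinity = R" "point_ideal (Affine x y) = ideal2 (lin x) (Y - cst y)"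
  by (simp_all add: point_ideal_def)

lemma is_module_point_ideal: "is_module (point_ideal P)"
  by (cases P) (simp_all add: is_module_R is_module_ideal2)

text \<open>
  The second generator may be any line through the point, because it differs from the horizontal one by
  a multiple of the first generator.
\<close>

lemma point_ideal_line:
  "point_ideal (Affine x (poly p x)) = ideal2 (lin x) (Y - emb p)"
proof -
  define q where "q = synthetic_div p x"
  have "p = [:- x, 1:] * q + [:poly p x:]"
    by (metis q_def synthetic_div_correct')
  then have "emb p = lin x * emb q + cst (poly p x)"
    by (metis emb_add emb_mult)
  then have "Y - cst (poly p x) = (Y - emb p) + emb q * lin x" by simp
  then show ?thesis by (simp only: point_ideal_simps ideal2_shift[OF emb_in_R])
qed

text \<open>
  Write \<open>a\<close> for the vertical line and \<open>b\<close>, \<open>b'\<close> for the horizontal lines through the point and its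
  negative. By the equation of the curve, \<open>b b' = a g\<close> for an explicit \<open>g\<close>, so the product of the two
  ideals is \<open>a\<close> times the ideal generated by \<open>a\<close>, \<open>b\<close>, \<open>b'\<close> and \<open>g\<close>. That ideal contains a unit: the
  constant \<open>b' - b\<close> unless the point is its own negative, and otherwise the value of \<open>g\<close> at the point, which
  is the partial derivative with respect to \<open>x\<close> and does not vanish by nonsingularity.
\<close>

lemma ideal_prod_neg:
  assumes P: "on_curve E (Affine x y)"
  shows "ideal_prod (point_ideal (Affine x y)) (point_ideal (ec_neg E (Affine x y))) = (*) (lin x) ` R"
proof -
  define y' where "y' = - y - wa1 E * x - wa3 E"
  define a b b' where "a = lin x" and "b = Y - cst y" and "b' = Y - cst y'"
  have abR: "a \<in> R" "b \<in> R" "b' \<in> R" by (auto simp: a_def b_def b'_def)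
  define h where "h = [:x\<^sup>2 + wa2 E * x + wa4 E, x + wa2 E, 1:]"
  define g where "g = emb h - cst (wa1 E) * Y"
  have gR: "g \<in> R" by (auto simp: g_def)
  have h: "cubic - [:poly cubic x:] = [:- x, 1:] * h"
    by (simp add: h_def algebra_simps power2_eq_square)
  have bb: "b * b' = a * g"
  proof -
    \<comment> \<open>Everything is expanded around \<open>x\<close>, that is, in powers of \<open>a\<close>.\<close>
    have hC: "emb cubic = a * emb h + cst (poly cubic x)"
      using h by (metis a_def diff_add_cancel emb_add emb_mult)
    have sum: "cst y + cst y' = - cst (wa1 E * x + wa3 E)"
      by (simp flip: emb_add emb_uminus) (simp add: y'_def)
    have prod: "cst y * cst y' = - cst (poly cubic x)"
    proof -
      have "y * y' = - poly cubic x" using P by (simp add: y'_def) Groebner_Basis.algebra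
      then have "[:y:] * [:y':] = - [:poly cubic x:]"
        by (simp add: mult.commute del: poly_pCons)
      then show ?thesis by (metis emb_mult emb_uminus)
    qed
    have lc: "emb lin_coeff = cst (wa1 E) * a + cst (wa1 E * x + wa3 E)"
      unfolding a_def by (simp flip: emb_mult emb_add add: mult.commute)
    show ?thesis
      using Y_root sum prod unfolding b_def b'_def g_def hC lc by Groebner_Basis.algebra
  qed
  let ?J = "ideal_prod (ideal2 a b) (ideal2 a b')"
  have mJ: "is_module ?J" by (rule is_module_ideal_prod[OF is_module_ideal2])
  have in2: "u \<in> ideal2 u v" "v \<in> ideal2 u v" for u v
    by (auto intro: ideal2_I[of 1 0] ideal2_I[of 0 1])
  have "?J \<subseteq> (*) a ` R"
  proof (rule ideal_prod_subset_module[OF is_module_scale[OF is_module_R]])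
    fix i j assume "i \<in> ideal2 a b" "j \<in> ideal2 a b'"
    then obtain r s r' s' where *: "r \<in> R" "s \<in> R" "r' \<in> R" "s' \<in> R"
      and i: "i = r * a + s * b" and j: "j = r' * a + s' * b'" by (auto simp: ideal2_def)
    have "i * j = a * (r * r' * a + r * s' * b' + s * r' * b + s * s' * g)"
      unfolding i j using bb by Groebner_Basis.algebra
    moreover have "r * r' * a + r * s' * b' + s * r' * b + s * s' * g \<in> R"
      using * abR gR by (intro R_add R_mult)
    ultimately show "i * j \<in> (*) a ` R" by blast
  qed
  moreover have "(*) a ` R \<subseteq> ?J"
  proof -
    have J: "r * (u * v) \<in> ?J" if "r \<in> R" "u \<in> ideal2 a b" "v \<in> ideal2 a b'" for r u v
      using mJ that ideal_prod_mult unfolding is_module_def by blast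
    have Jadd: "u + v \<in> ?J" if "u \<in> ?J" "v \<in> ?J" for u v
      using that by (rule ideal_prod_plus)
    have "a \<in> ?J"
    proof (cases "2 * y + wa1 E * x + wa3 E = 0")
      case False
      define t where "t = 2 * y + wa1 E * x + wa3 E"
      define k where "k = cst (inverse t)"
      have "b' - b = cst t" unfolding b_def b'_def y'_def t_def
        by (simp flip: emb_diff)
      moreover have "k * cst t = 1"
        using False by (simp flip: emb_mult add: t_def k_def)
      ultimately have "k * (b' - b) = 1" by simp
      then have "a = k * (a * b') + (- k) * (b * a)"
        by Groebner_Basis.algebra
      also have "\<dots> \<in> ?J" by (intro Jadd J in2) (auto simp: k_def)
      finally show ?thesis .
    next
      case True
      define t where "t = 3 * x\<^sup>2 + 2 * wa2 E * x + wa4 E - wa1 E * y"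
      have tnz: "t \<noteq> 0" unfolding t_def by (rule nonsingular_point[OF elliptic P True])
      define q where "q = [:2 * x + wa2 E, 1:]"
      have hq: "h = [:- x, 1:] * q + [:3 * x\<^sup>2 + 2 * wa2 E * x + wa4 E:]"
        by (simp add: h_def q_def algebra_simps power2_eq_square)
      have "[:3 * x\<^sup>2 + 2 * wa2 E * x + wa4 E:] = [:t:] + [:wa1 E:] * [:y:]"
        by (simp add: t_def)
      from arg_cong[OF this, of emb] have "emb h = a * emb q + cst t + cst (wa1 E) * cst y"
        unfolding hq emb_add emb_mult a_def by (simp only: add.assoc)
      then have g: "g = cst t + a * emb q - cst (wa1 E) * b"
        by (simp add: g_def b_def algebra_simps)
      have "cst (inverse t) * cst t = 1"
        using tnz by (simp flip: emb_mult )
      then have "a = cst (inverse t) * (b * b') + (- cst (inverse t) * emb q) * (a * a)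
          + cst (inverse t) * cst (wa1 E) * (b * a)"
        using g bb by Groebner_Basis.algebra
      also have "\<dots> \<in> ?J" by (intro Jadd J in2) (auto simp flip: emb_mult emb_uminus)
      finally show ?thesis .
    qed
    then show ?thesis using mJ by (auto simp: is_module_def mult.commute[of a])
  qed
  ultimately show ?thesis by (simp add: a_def b_def b'_def y'_def)
qed

text \<open>
  Let \<open>u\<close> be the equation of the line through the two points and \<open>v\<close> its conjugate. By \<open>line_meets_curve\<close>,
  \<open>u v = - (x - x1) (x - x2) (x - x3)\<close>. Taking \<open>u\<close> as the second generator of both point ideals, every
  generator of their product times \<open>x - x3\<close> is a multiple of \<open>u\<close>, and the quotients generate
  the ideal of \<open>x - x3\<close> and \<open>v\<close>, which belongs to the sum of the points. The multiplier is therefore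
  \<open>u / (x - x3)\<close>. What has to be checked is that \<open>u\<close> itself lies in the product of the point ideals.
\<close>

lemma ideal_prod_chord:
  assumes P: "on_curve E (Affine x1 y1)" and Q: "on_curve E (Affine x2 y2)"
    and nopp: "\<not> (x1 = x2 \<and> y1 + y2 + wa1 E * x1 + wa3 E = 0)"
  defines "S \<equiv> ec_add E (Affine x1 y1) (Affine x2 y2)"
  shows "\<exists>c. c \<noteq> 0 \<and> ideal_prod (point_ideal (Affine x1 y1)) (point_ideal (Affine x2 y2)) = (*) c ` point_ideal S"
proof -
  define m where "m = ec_slope E x1 y1 x2 y2"
  define x3 where "x3 = m\<^sup>2 + wa1 E * m - wa2 E - x1 - x2"
  define c where "c = y1 - m * x1"
  note l = line_meets_curve[OF P Q nopp, folded m_def, folded x3_def c_def]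
  define p where "p = [:c, m:]"
  have y1: "y1 = poly p x1" by (simp add: p_def c_def)
  have y2: "y2 = poly p x2" using l(1) by (simp add: p_def)
  define a1 a2 a3 u v where "a1 = lin x1" and "a2 = lin x2" and "a3 = lin x3"
    and "u = Y - emb p" and "v = - Y - emb lin_coeff - emb p"
  have inR: "a1 \<in> R" "a2 \<in> R" "a3 \<in> R" "u \<in> R" "v \<in> R"
    by (auto simp: a1_def a2_def a3_def u_def v_def)
  have unz: "u \<noteq> 0"
    using elem_eq_0D[of "- p" 1] by (auto simp: u_def elem_def)
  have I1: "point_ideal (Affine x1 y1) = ideal2 a1 u" 
    unfolding y1 point_ideal_line by (simp add: a1_def u_def)
  have I2: "point_ideal (Affine x2 y2) = ideal2 a2 u" 
    unfolding y2 point_ideal_line by (simp add: a2_def u_def)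
  have S: "S = Affine x3 (poly (- p - lin_coeff) x3)"
    unfolding S_def ec_add_Affine[OF nopp] m_def[symmetric] x3_def[symmetric]
    by (simp add: p_def c_def algebra_simps)
  have "point_ideal S = ideal2 (lin x3) (Y - emb (- p - lin_coeff))"
    unfolding S by (rule point_ideal_line)
  also have "Y - emb (- p - lin_coeff) = - v" by (simp only: v_def emb_diff emb_uminus) simp
  finally have I3: "point_ideal S = ideal2 a3 v" by (simp add: a3_def ideal2_uminus)
  have uv: "u * v = - (a1 * a2 * a3)"
  proof -
    have "p\<^sup>2 + lin_coeff * p - cubic = - ([:- x1, 1:] * [:- x2, 1:] * [:- x3, 1:])"
      using l(2,3) by (simp add: p_def power2_eq_square x3_def algebra_simps)
    then have "emb (p\<^sup>2 + lin_coeff * p - cubic) = - (a1 * a2 * a3)"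
      unfolding a1_def a2_def a3_def by (metis emb_mult emb_uminus)
    then have "(emb p)\<^sup>2 + emb lin_coeff * emb p - emb cubic = - (a1 * a2 * a3)"
      by (simp only: emb_diff emb_add emb_mult emb_power)
    then show ?thesis using Y_root unfolding u_def v_def by Groebner_Basis.algebra
  qed
  let ?J = "ideal_prod (ideal2 a1 u) (ideal2 a2 u)"
  have mJ: "is_module ?J" by (rule is_module_ideal_prod[OF is_module_ideal2])
  have in2: "w \<in> ideal2 w z" "z \<in> ideal2 w z" for w z
    by (auto intro: ideal2_I[of 1 0] ideal2_I[of 0 1])
  have J: "r * (w * z) \<in> ?J" if "r \<in> R" "w \<in> ideal2 a1 u" "z \<in> ideal2 a2 u" for r w z
    using mJ that ideal_prod_mult unfolding is_module_def by blast
  have Jadd: "w + z \<in> ?J" if "w \<in> ?J" "z \<in> ?J" for w z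
    using that by (rule ideal_prod_plus)
  \<comment> \<open>If \<open>x1 \<noteq> x2\<close>, then \<open>(x - x1) u\<close> and \<open>(x - x2) u\<close> differ by a constant multiple of \<open>u\<close>. For a
    tangent, \<open>- (u + v)\<close> is a polynomial with the nonzero value \<open>t\<close> at \<open>x1\<close>; multiplying it by \<open>u\<close>
    expresses \<open>t u\<close> through elements of the product.\<close>
  have uJ: "u \<in> ?J"
  proof (cases "x1 = x2")
    case False
    define k where "k = cst (inverse (x2 - x1))"
    have "a1 - a2 = cst (x2 - x1)" by (simp flip: emb_diff add: a1_def a2_def)
    moreover have "k * cst (x2 - x1) = 1"
      using False by (simp flip: emb_mult add: k_def)
    ultimately have "k * (a1 - a2) = 1" by simp
    then have "u = k * (a1 * u) + (- k) * (u * a2)" by Groebner_Basis.algebra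
    also have "\<dots> \<in> ?J" by (intro Jadd J in2) (auto simp: k_def)
    finally show ?thesis .
  next
    case True
    with nopp same_x_on_curve[of E x1 y1 y2] P Q have y: "y2 = y1" by auto
    define t where "t = 2 * y1 + wa1 E * x1 + wa3 E"
    have tnz: "t \<noteq> 0" using nopp True y by (simp add: t_def algebra_simps)
    define k where "k = cst (inverse t)"
    define n where "n = cst (2 * m + wa1 E)"
    have a12: "a2 = a1" by (simp add: a1_def a2_def True)
    have "[:2 * m + wa1 E:] * [:- x1, 1:] + [:t:] = 2 * p + lin_coeff"
      by (simp add: p_def c_def t_def numeral_poly algebra_simps)
    then have "emb ([:2 * m + wa1 E:] * [:- x1, 1:] + [:t:]) = emb (p + p + lin_coeff)"
      by (simp only: mult_2)
    then have "n * a1 + cst t = emb p + emb p + emb lin_coeff"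
      unfolding n_def a1_def by (simp only: emb_add emb_mult)
    then have "n * a1 + cst t = - (u + v)"
      by (simp add: u_def v_def)
    moreover have "k * cst t = 1"
      using tnz by (simp flip: emb_mult add: k_def)
    ultimately have "u = (- k) * (u * u) + (k * a3) * (a1 * a2) + (- k * n) * (a1 * u)"
      using uv unfolding a12 by Groebner_Basis.algebra
    also have "\<dots> \<in> ?J" using inR by (intro Jadd J in2) (auto simp: k_def n_def simp flip: emb_mult emb_uminus)
    finally show ?thesis .
  qed
  have "(*) a3 ` ?J = (*) u ` ideal2 a3 v"
  proof
    have "(*) a3 ` ?J = ideal_prod ((*) a3 ` ideal2 a1 u) (ideal2 a2 u)" by (simp add: ideal_prod_scale)
    also have "\<dots> \<subseteq> (*) u ` ideal2 a3 v"
    proof (rule ideal_prod_subset_module[OF is_module_scale[OF is_module_ideal2]])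
      fix i j assume "i \<in> (*) a3 ` ideal2 a1 u" "j \<in> ideal2 a2 u"
      then obtain r s r' s' where *: "r \<in> R" "s \<in> R" "r' \<in> R" "s' \<in> R"
        and i: "i = a3 * (r * a1 + s * u)" and j: "j = r' * a2 + s' * u" by (auto simp: ideal2_def)
      have "i * j = u * ((r * s' * a1 + s * r' * a2 + s * s' * u) * a3 + (- r * r') * v)"
        unfolding i j using uv by Groebner_Basis.algebra
      moreover have "(r * s' * a1 + s * r' * a2 + s * s' * u) * a3 + (- r * r') * v \<in> ideal2 a3 v"
        using * inR by (intro ideal2_I[OF _ _ refl] R_add R_mult R_uminus)
      ultimately show "i * j \<in> (*) u ` ideal2 a3 v" by blast
    qed
    finally show "(*) a3 ` ?J \<subseteq> (*) u ` ideal2 a3 v" .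
    show "(*) u ` ideal2 a3 v \<subseteq> (*) a3 ` ?J"
    proof
      fix z assume "z \<in> (*) u ` ideal2 a3 v"
      then obtain r s where *: "r \<in> R" "s \<in> R" and z: "z = u * (r * a3 + s * v)" by (auto simp: ideal2_def)
      have "z = a3 * (r * u + (- s) * (a1 * a2))" unfolding z using uv by Groebner_Basis.algebra
      moreover have "r * u + (- s) * (a1 * a2) \<in> ?J"
        using * uJ mJ by (intro Jadd J in2) (auto simp: is_module_def)
      ultimately show "z \<in> (*) a3 ` ?J" by blast
    qed
  qed
  then have "?J = (*) (u / a3) ` ideal2 a3 v"
    by (intro scale_divide) (simp_all add: a3_def)
  with unz show ?thesis unfolding I1 I2 I3 by (intro exI[of _ "u / a3"]) (simp add: a3_def)
qed

lemma ideal_prod_ec_add: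
  assumes "on_curve E P" "on_curve E Q"
  shows "\<exists>c. c \<noteq> 0 \<and> ideal_prod (point_ideal P) (point_ideal Q) = (*) c ` point_ideal (ec_add E P Q)"
proof (cases P)
  case Infinity
  then show ?thesis by (intro exI[of _ 1]) (simp add: ideal_prod_R is_module_point_ideal)
next
  case P: (Affine x1 y1)
  show ?thesis
  proof (cases Q)
    case Infinity
    then show ?thesis
      by (intro exI[of _ 1]) (simp add: ideal_prod_commute[of _ R] ideal_prod_R is_module_point_ideal)
  next
    case Q: (Affine x2 y2)
    show ?thesis
    proof (cases "x1 = x2 \<and> y1 + y2 + wa1 E * x1 + wa3 E = 0")
      case False
      with assms show ?thesis unfolding P Q by (intro ideal_prod_chord) auto
    next
      case True
      from conjunct2[OF this] have "y2 = - y1 - wa1 E * x1 - wa3 E" by Groebner_Basis.algebra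
      with True have "Q = ec_neg E P" by (simp add: P Q)
      then show ?thesis using ideal_prod_neg[of x1 y1] assms True P Q
        by (intro exI[of _ "lin x1"]) auto
    qed
  qed
qed

text \<open>
  Evaluation at a point kills its ideal. It is well defined because \<open>f\<close> and \<open>g\<close> are determined by \<open>f + g Y\<close>.
\<close>

lemma elem_in_point_ideal:
  assumes "on_curve E (Affine x y)" "elem f g \<in> point_ideal (Affine x y)"
  shows "poly f x + poly g x * y = 0"
proof -
  obtain r s where "r \<in> R" "s \<in> R" and eq: "elem f g = r * lin x + s * (Y - cst y)"
    using assms(2) by (auto simp: ideal2_def)
  then obtain r1 r2 s1 s2 where r: "r = elem r1 r2" and s: "s = elem s1 s2"
    by (auto simp: R_def)
  have l: "lin x = elem [:- x, 1:] 0" and yy: "Y - cst y = elem [:- y:] 1"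
    using emb_uminus[of "[:y:]"] by (simp_all add: elem_def)
  have "elem f g = elem (r1 * [:- x, 1:] + (s1 * [:- y:] + s2 * cubic))
      (r2 * [:- x, 1:] + (s1 + s2 * [:- y:] - s2 * lin_coeff))"
    unfolding eq r s l yy elem_mult elem_add by (simp del: mult_pCons_right)
  from elem_eqD[OF this]
  have f: "f = r1 * [:- x, 1:] + (s1 * [:- y:] + s2 * cubic)"
    and g: "g = r2 * [:- x, 1:] + (s1 + s2 * [:- y:] - s2 * lin_coeff)" by auto
  have "poly f x + poly g x * y = poly s2 x * (poly cubic x - (y\<^sup>2 + wa1 E * x * y + wa3 E * y))"
    unfolding f g poly_add poly_mult poly_diff by (simp add: algebra_simps power2_eq_square)
  also have "\<dots> = 0"
    using assms(1) by (simp add: algebra_simps power2_eq_square power3_eq_cube)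
  finally show ?thesis .
qed

lemma one_notin_point_ideal:
  assumes "on_curve E (Affine x y)" shows "1 \<notin> point_ideal (Affine x y)"
  using elem_in_point_ideal[OF assms, of 1 0] by (auto simp: elem_def)

lemma scale_R_cancel:
  assumes "c \<in> R" "d \<in> R" "c * d = 1" shows "(*) c ` R = R"
proof
  show "(*) c ` R \<subseteq> R" using assms by auto
  show "R \<subseteq> (*) c ` R"
  proof
    fix r assume "r \<in> R"
    then have "r = c * (d * r)" "d * r \<in> R" using assms by (auto simp flip: mult.assoc)
    then show "r \<in> (*) c ` R" by blast
  qed
qed

text \<open>
  Only nonzero constants have a norm of degree zero, and these are units.
\<close>

lemma degree_norm_eq_0:
  assumes "Polynomial.degree (field_norm f g) = 0" "elem f g \<noteq> 0"
  shows "(*) (elem f g) ` R = R"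
proof -
  have "g = 0" using degree_field_norm[of g f] assms(1) by (cases "g = 0") auto
  then have "Polynomial.degree (f\<^sup>2) = 0" using assms(1) by (simp add: field_norm_def)
  then have "Polynomial.degree f = 0" by (cases "f = 0") (auto simp: degree_power_eq)
  then obtain a where f: "f = [:a:]" by (rule degree_eq_zeroE)
  with assms(2) \<open>g = 0\<close> have a: "a \<noteq> 0" by (auto simp: elem_def)
  have "elem f g * cst (inverse a) = 1"
    using a by (simp add: elem_def f \<open>g = 0\<close> flip: emb_mult)
  then show ?thesis by (intro scale_R_cancel[of _ "cst (inverse a)"]) auto
qed

text \<open>
  Norms multiply, the norm of a polynomial in the abscissa is its square, and a factor whose norm has
  degree zero would generate the whole ring.
\<close>

lemma norm_factorisation:
  assumes "c \<in> R" "d \<in> R" "c * d = emb h" "h \<noteq> 0"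
    and "(*) c ` R \<noteq> R" "(*) d ` R \<noteq> R"
  obtains f g f' g' where "c = elem f g" "d = elem f' g'"
    "Polynomial.degree (field_norm f g) > 0" "Polynomial.degree (field_norm f' g') > 0"
    "Polynomial.degree (field_norm f g) + Polynomial.degree (field_norm f' g') = 2 * Polynomial.degree h"
proof -
  obtain f g f' g' where c: "c = elem f g" and d: "d = elem f' g'"
    using assms(1,2) by (auto simp: R_def)
  have "elem f g * elem f' g' = elem h 0" using assms(3) by (simp add: c d elem_def)
  from elem_eqD[OF this[unfolded elem_mult]]
  have "field_norm f g * field_norm f' g' = field_norm h 0" by (simp flip: field_norm_mult)
  then have prod: "field_norm f g * field_norm f' g' = h\<^sup>2" by (simp add: field_norm_def)
  then have nz: "field_norm f g \<noteq> 0" "field_norm f' g' \<noteq> 0" using assms(4) by auto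
  have cd: "c \<noteq> 0" "d \<noteq> 0" using assms(3,4) by auto
  show thesis
  proof (rule that[OF c d])
    show "Polynomial.degree (field_norm f g) > 0" "Polynomial.degree (field_norm f' g') > 0"
      using degree_norm_eq_0[of f g] degree_norm_eq_0[of f' g'] assms(5,6) cd c d by auto
    show "Polynomial.degree (field_norm f g) + Polynomial.degree (field_norm f' g') = 2 * Polynomial.degree h"
      using nz prod assms(4) by (simp flip: degree_mult_eq add: degree_power_eq)
  qed
qed

lemma degree_field_norm_cases:
  "Polynomial.degree (field_norm f g) \<noteq> 1 \<and>
   (Polynomial.degree (field_norm f g) = 2 \<longrightarrow> g = 0 \<and> Polynomial.degree f = 1)"
proof (cases "g = 0")
  case True
  then have "field_norm f g = f\<^sup>2" by (simp add: field_norm_def)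
  then have "Polynomial.degree (field_norm f g) = 2 * Polynomial.degree f"
    by (cases "f = 0") (simp_all add: degree_power_eq)
  with True show ?thesis by auto
next
  case False
  then show ?thesis using degree_field_norm[OF False, of f] by auto
qed

text \<open>
  If the ideal of a point were generated by \<open>c\<close>, its negative would have a principal ideal too, and the
  product of the generators would be \<open>x - x0\<close> for the abscissa \<open>x0\<close>. Both norms would have degree one,
  which no norm has.
\<close>

lemma point_ideal_not_principal:
  assumes A: "on_curve E (Affine x y)"
  shows "point_ideal (Affine x y) \<noteq> (*) c ` R"
proof
  let ?I = "point_ideal (Affine x y)" and ?I' = "point_ideal (ec_neg E (Affine x y))"
  assume I: "?I = (*) c ` R"
  have m: "is_module ?I'" by (rule is_module_point_ideal)
  have "lin x \<in> ?I" using ideal2_I[of 1 0 "lin x"] by auto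
  then have c0: "c \<noteq> 0" using I by auto
  have A': "on_curve E (ec_neg E (Affine x y))" using A by (rule on_curve_ec_neg)
  have "(*) c ` ?I' = (*) (lin x) ` R"
    using ideal_prod_neg[OF A] ideal_prod_scale[of c R ?I'] ideal_prod_R[OF m] I by simp
  then have I': "?I' = (*) (lin x / c) ` R" by (rule scale_divide[OF c0])
  have ne: "?I \<noteq> R" "?I' \<noteq> R"
    using one_notin_point_ideal[OF A] one_notin_point_ideal A' by fastforce+
  have sub: "point_ideal P \<subseteq> R" for P by (cases P) (auto simp: ideal2_def)
  have cR: "c \<in> R" "lin x / c \<in> R"
    using sub[of "Affine x y"] sub[of "ec_neg E (Affine x y)"] imageI[OF one_in_R, of "(*) c"]
      imageI[OF one_in_R, of "(*) (lin x / c)"] unfolding I I' by auto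
  obtain f g f' g' where
    "Polynomial.degree (field_norm f g) > 0" "Polynomial.degree (field_norm f' g') > 0"
    "Polynomial.degree (field_norm f g) + Polynomial.degree (field_norm f' g') = 2 * Polynomial.degree [:- x, 1:]"
    using cR by (rule norm_factorisation[of _ _ "[:- x, 1:]"]) (use c0 ne I I' in auto)
  with degree_field_norm_cases[of f g] degree_field_norm_cases[of f' g'] show False by auto
qed

text \<open>
  Suppose that \<open>A\<close> and \<open>B\<close> have ideals in the same class. Multiplying by the ideals of \<open>- B\<close> and \<open>- A\<close> shows
  that \<open>I(A) I(- B)\<close> and \<open>I(B) I(- A)\<close> are principal, with generators \<open>c'\<close> and \<open>c''\<close> whose product is
  \<open>(x - xa) (x - xb)\<close>. The degrees of their norms add up to four and are neither zero nor one, so both are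
  two and \<open>c'\<close> is a linear polynomial in the abscissa. It vanishes at \<open>A\<close> and at \<open>- B\<close>, so \<open>xa = xb\<close> and
  \<open>I(A) I(- B) = (x - xb) = I(B) I(- B)\<close>; cancelling \<open>I(- B)\<close> gives \<open>I(A) = I(B)\<close>.
\<close>

lemma point_ideal_class_inj_Affine:
  assumes A: "on_curve E (Affine xa ya)" and B: "on_curve E (Affine xb yb)"
    and c0: "c \<noteq> 0" and AB: "point_ideal (Affine xa ya) = (*) c ` point_ideal (Affine xb yb)"
  shows "xa = xb \<and> ya = yb"
proof -
  let ?IA = "point_ideal (Affine xa ya)" and ?IA' = "point_ideal (ec_neg E (Affine xa ya))"
  let ?IB = "point_ideal (Affine xb yb)" and ?IB' = "point_ideal (ec_neg E (Affine xb yb))"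
  have A': "on_curve E (ec_neg E (Affine xa ya))" and B': "on_curve E (ec_neg E (Affine xb yb))"
    using A B by (auto intro: on_curve_ec_neg simp del: ec_neg_simps)
  have sub: "point_ideal P \<subseteq> R" for P by (cases P) (auto simp: ideal2_def)
  define c' c'' where "c' = c * lin xb" and "c'' = lin xa / c"
  have 1: "ideal_prod ?IA ?IB' = (*) c' ` R"
    unfolding AB ideal_prod_scale ideal_prod_neg[OF B] scale_scale c'_def ..
  have "(*) c ` ideal_prod ?IB ?IA' = (*) (lin xa) ` R"
    unfolding ideal_prod_scale[symmetric] AB[symmetric] by (rule ideal_prod_neg[OF A])
  then have 2: "ideal_prod ?IB ?IA' = (*) c'' ` R"
    unfolding c''_def by (rule scale_divide[OF c0])
  have prod_sub: "ideal_prod (point_ideal P) (point_ideal Q) \<subseteq> point_ideal P" for P Q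
  proof (rule ideal_prod_subset_module[OF is_module_point_ideal])
    fix i j assume "i \<in> point_ideal P" "j \<in> point_ideal Q"
    then have "j * i \<in> point_ideal P"
      using sub[of Q] is_module_point_ideal[of P] unfolding is_module_def by blast
    then show "i * j \<in> point_ideal P" by (simp add: mult.commute)
  qed
  have c'I: "c' \<in> ideal_prod ?IA ?IB'" unfolding 1 using imageI[OF one_in_R, of "(*) c'"] by simp
  have c''I: "c'' \<in> ideal_prod ?IB ?IA'" unfolding 2 using imageI[OF one_in_R, of "(*) c''"] by simp
  have cA: "c' \<in> ?IA" and cB: "c' \<in> ?IB'"
    using c'I prod_sub ideal_prod_commute by blast+
  have inR: "c' \<in> R" "c'' \<in> R" using cA c''I prod_sub sub by blast+
  have ne: "(*) c' ` R \<noteq> R" "(*) c'' ` R \<noteq> R"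
    using prod_sub[of "Affine xa ya"] prod_sub[of "Affine xb yb"]
      one_notin_point_ideal[OF A] one_notin_point_ideal[OF B] one_in_R 1 2 by blast+
  define h where "h = [:- xa, 1:] * [:- xb, 1:]"
  have h: "h \<noteq> 0" "Polynomial.degree h = 2"
    unfolding h_def by (simp, subst degree_mult_eq) auto
  have "c' * c'' = emb h" using c0 by (simp add: c'_def c''_def h_def del: mult_pCons_left mult_pCons_right)
  then obtain f g f' g' where c': "c' = elem f g"
    and "Polynomial.degree (field_norm f g) > 0" "Polynomial.degree (field_norm f' g') > 0"
    "Polynomial.degree (field_norm f g) + Polynomial.degree (field_norm f' g') = 2 * Polynomial.degree h"
    using norm_factorisation[OF inR _ h(1) ne] by metis
  then have "Polynomial.degree (field_norm f g) = 2"
    using degree_field_norm_cases[of f g] degree_field_norm_cases[of f' g'] h(2) by auto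
  then have g: "g = 0" and f: "Polynomial.degree f = 1" using degree_field_norm_cases[of f g] by auto
  obtain u q where q: "f = pCons u q" by (rule pCons_cases)
  with f have "Polynomial.degree q = 0" "q \<noteq> 0" by (auto split: if_splits)
  then obtain v where fuv: "f = [:u, v:]" "v \<noteq> 0" using q by (auto elim: degree_eq_zeroE)
  have "poly f xa = 0" using elem_in_point_ideal[OF A, of f g] cA c' g by auto
  moreover have "poly f xb = 0" using elem_in_point_ideal[of xb _ f g] cB B' c' g by auto
  ultimately have "u + xa * v = 0" "u + xb * v = 0" by (simp_all add: fuv)
  then have "v * (xa - xb) = 0" by Groebner_Basis.algebra
  then have x: "xa = xb" using fuv by simp
  have "u = - v * xa" using \<open>u + xa * v = 0\<close> by Groebner_Basis.algebra
  then have "f = [:v:] * [:- xa, 1:]" by (simp add: fuv)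
  then have "c' = cst v * lin xa" using c' g by (simp add: elem_def del: mult_pCons_left mult_pCons_right)
  then have "ideal_prod ?IA ?IB' = (*) (lin xa) ` (*) (cst v) ` R"
    using 1 by (simp only: scale_scale mult.commute)
  also have "(*) (cst v) ` R = R"
    by (rule scale_R_cancel[of _ "cst (inverse v)"]) (use fuv in \<open>auto simp flip: emb_mult\<close>)
  finally have "ideal_prod ?IB (ideal_prod ?IA ?IB') = (*) (lin xa) ` ?IB"
    by (simp only: ideal_prod_commute[of ?IB] ideal_prod_scale ideal_prod_R[OF is_module_point_ideal])
  moreover have "ideal_prod ?IB (ideal_prod ?IA ?IB') = ideal_prod (ideal_prod ?IB ?IB') ?IA"
    by (metis ideal_prod_assoc ideal_prod_commute)
  moreover have "\<dots> = (*) (lin xb) ` ?IA"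
    by (simp only: ideal_prod_neg[OF B] ideal_prod_scale ideal_prod_R[OF is_module_point_ideal])
  ultimately have "?IA = ?IB" using x scale_cancel[of "lin xa" ?IA ?IB] by simp
  moreover have "elem [:- ya:] 1 \<in> ?IA"
    using ideal2_I[of 0 1 "Y - cst ya" "lin xa"] emb_uminus[of "[:ya:]"] by (simp add: elem_def)
  ultimately have "ya = yb" using elem_in_point_ideal[OF B, of "[:- ya:]" 1] by auto
  with x show ?thesis by simp
qed

lemma point_ideal_class_inj:
  assumes "on_curve E P" "on_curve E Q" "c \<noteq> 0" "point_ideal P = (*) c ` point_ideal Q"
  shows "P = Q"
proof (cases P; cases Q)
  fix x y x' y' assume "P = Affine x y" "Q = Affine x' y'"
  with assms point_ideal_class_inj_Affine[of x y x' y' c] show ?thesis by simp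
next
  fix x y assume PQ: "P = Affine x y" "Q = Infinity"
  with assms point_ideal_not_principal[of x y c] show ?thesis by simp
next
  fix x y assume PQ: "P = Infinity" "Q = Affine x y"
  then have "point_ideal Q = (*) (1 / c) ` R"
    using assms by (intro scale_divide[of c]) auto
  with PQ assms point_ideal_not_principal[of x y "1 / c"] show ?thesis by simp
qed auto

lemma ec_add_assoc_from_ideals:
  assumes P: "on_curve E P" and Q: "on_curve E Q" and S: "on_curve E S"
  shows "ec_add E (ec_add E P Q) S = ec_add E P (ec_add E Q S)"
proof -
  note on = on_curve_ec_add
  obtain c1 where 1: "c1 \<noteq> 0" "ideal_prod (point_ideal P) (point_ideal Q) = (*) c1 ` point_ideal (ec_add E P Q)"
    using ideal_prod_ec_add[OF P Q] by blast
  obtain c2 where 2: "c2 \<noteq> 0" "ideal_prod (point_ideal (ec_add E P Q)) (point_ideal S) = (*) c2 ` point_ideal (ec_add E (ec_add E P Q) S)"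
    using ideal_prod_ec_add[OF on[OF P Q] S] by blast
  obtain c3 where 3: "c3 \<noteq> 0" "ideal_prod (point_ideal Q) (point_ideal S) = (*) c3 ` point_ideal (ec_add E Q S)"
    using ideal_prod_ec_add[OF Q S] by blast
  obtain c4 where 4: "c4 \<noteq> 0" "ideal_prod (point_ideal P) (point_ideal (ec_add E Q S)) = (*) c4 ` point_ideal (ec_add E P (ec_add E Q S))"
    using ideal_prod_ec_add[OF P on[OF Q S]] by blast
  have "(*) (c1 * c2) ` point_ideal (ec_add E (ec_add E P Q) S) = ideal_prod (ideal_prod (point_ideal P) (point_ideal Q)) (point_ideal S)"
    by (simp only: 1 2 ideal_prod_scale scale_scale)
  also have "\<dots> = ideal_prod (ideal_prod (point_ideal Q) (point_ideal S)) (point_ideal P)"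
    by (metis ideal_prod_assoc ideal_prod_commute)
  also have "\<dots> = (*) (c3 * c4) ` point_ideal (ec_add E P (ec_add E Q S))"
    by (simp only: 3 4 ideal_prod_scale scale_scale ideal_prod_commute[of "point_ideal (ec_add E Q S)"])
  finally have "point_ideal (ec_add E (ec_add E P Q) S) = (*) (c3 * c4 / (c1 * c2)) ` point_ideal (ec_add E P (ec_add E Q S))"
    using 1 2 by (intro scale_divide) auto
  then show ?thesis
    using 1 2 3 4 by (intro point_ideal_class_inj[of _ _ "c3 * c4 / (c1 * c2)"] on P Q S) auto
qed

end

text \<open>
  The field that contains the coordinate ring is an algebraic closure of the field of rational functions
  in the abscissa.
\<close>

lemma ec_add_assoc:
  fixes E :: "'a::field weierstrass_curve"
  assumes "elliptic_curve E" "on_curve E P" "on_curve E Q" "on_curve E S"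
  shows "ec_add E (ec_add E P Q) S = ec_add E P (ec_add E Q S)"
proof -
  define emb :: "'a poly \<Rightarrow> 'a poly fract alg_closure" where "emb p = to_ac (to_fract p)" for p
  define q where "q = [:- emb [:wa6 E, wa4 E, wa2 E, 1:], emb [:wa3 E, wa1 E:], 1:]"
  obtain Y where "poly q Y = 0"
    using alg_closed_imp_poly_has_root[of q] by (auto simp: q_def)
  then have "Y\<^sup>2 + emb [:wa3 E, wa1 E:] * Y = emb [:wa6 E, wa4 E, wa2 E, 1:]"
    by (simp add: q_def algebra_simps power2_eq_square)
  then interpret coordinate_ring E emb Y
    using assms(1) by unfold_locales (simp_all add: emb_def)
  show ?thesis using assms(2-4) by (rule ec_add_assoc_from_ideals)
qed


section \<open>The group of points\<close>

definition curve_group :: "'a::field weierstrass_curve \<Rightarrow> 'a ec_point monoid" where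
  "curve_group E = \<lparr>carrier = {P. on_curve E P}, monoid.mult = ec_add E, one = Infinity\<rparr>"

lemma curve_group_simps [simp]:
  "carrier (curve_group E) = {P. on_curve E P}"
  "monoid.mult (curve_group E) = ec_add E"
  "one (curve_group E) = Infinity"
  by (simp_all add: curve_group_def)

lemma ec_add_neg [simp]: "ec_add E (ec_neg E P) P = Infinity"
  by (cases P) simp_all

lemma comm_group_curve_group:
  fixes E :: "'a::field weierstrass_curve"
  assumes "elliptic_curve E"
  shows "comm_group (curve_group E)"
  by (rule comm_groupI)
    (use assms in \<open>auto intro: on_curve_ec_add ec_add_assoc ec_add_commute intro!: bexI[of _ "ec_neg E _"] on_curve_ec_neg\<close>)

lemma inv_curve_group:
  assumes "elliptic_curve E" "on_curve E P"
  shows "inv\<^bsub>curve_group E\<^esub> P = ec_neg E P"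
proof -
  interpret comm_group "curve_group E" by (rule comm_group_curve_group) fact
  show ?thesis using assms by (intro inv_equality) (simp_all add: on_curve_ec_neg)
qed

section \<open>Multiplication by an integer in terms of abscissas\<close>

text \<open>
  The quantities \<open>b2\<close>, \<open>b4\<close>, \<open>b6\<close>, \<open>b8\<close> in terms of which the discriminant is defined.
\<close>

definition curve_b2 :: "'a::field weierstrass_curve \<Rightarrow> 'a" where "curve_b2 E = (wa1 E)\<^sup>2 + 4 * wa2 E"
definition curve_b4 :: "'a::field weierstrass_curve \<Rightarrow> 'a" where "curve_b4 E = 2 * wa4 E + wa1 E * wa3 E"
definition curve_b6 :: "'a::field weierstrass_curve \<Rightarrow> 'a" where "curve_b6 E = (wa3 E)\<^sup>2 + 4 * wa6 E"
definition curve_b8 :: "'a::field weierstrass_curve \<Rightarrow> 'a" where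
  "curve_b8 E = (wa1 E)\<^sup>2 * wa6 E + 4 * wa2 E * wa6 E - wa1 E * wa3 E * wa4 E + wa2 E * (wa3 E)\<^sup>2 - (wa4 E)\<^sup>2"

text \<open>
  Replacing the second point by its negative changes the slope only through its numerator. In the sum and
  in the product of the two resulting abscissas the ordinates occur only in combinations that the equation
  of the curve expresses through the abscissas. So both abscissas are roots of a quadratic whose
  coefficients are polynomials in \<open>x1\<close> and \<open>x2\<close>.
\<close>

lemma sum_and_difference_abscissas:
  fixes E :: "'a::field weierstrass_curve"
  assumes P: "on_curve E (Affine x1 y1)" and Q: "on_curve E (Affine x2 y2)" and ne: "x1 \<noteq> x2"
  obtains x3 y3 x4 y4 where
    "ec_add E (Affine x1 y1) (Affine x2 y2) = Affine x3 y3"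
    "ec_add E (Affine x1 y1) (ec_neg E (Affine x2 y2)) = Affine x4 y4"
    "(x1 - x2)\<^sup>2 * (x3 + x4) = 2 * x1 * x2 * (x1 + x2) + curve_b2 E * x1 * x2 + curve_b4 E * (x1 + x2) + curve_b6 E"
    "(x1 - x2)\<^sup>2 * (x3 * x4) = x1\<^sup>2 * x2\<^sup>2 - curve_b4 E * x1 * x2 - curve_b6 E * (x1 + x2) - curve_b8 E"
proof -
  define y2' where "y2' = - y2 - wa1 E * x2 - wa3 E"
  define m n where "m = ec_slope E x1 y1 x2 y2" and "n = ec_slope E x1 y1 x2 y2'"
  define x3 where "x3 = m\<^sup>2 + wa1 E * m - wa2 E - x1 - x2"
  define x4 where "x4 = n\<^sup>2 + wa1 E * n - wa2 E - x1 - x2"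
  define d where "d = x2 - x1"
  have d: "d \<noteq> 0" using ne by (simp add: d_def)
  have m: "m * d = y2 - y1" and n: "n * d = - y2 - wa1 E * x2 - wa3 E - y1"
    using d by (simp_all add: m_def n_def ec_slope_def ne d_def y2'_def)
  have eq: "y1\<^sup>2 + wa1 E * x1 * y1 + wa3 E * y1 = x1 ^ 3 + wa2 E * x1\<^sup>2 + wa4 E * x1 + wa6 E"
    "y2\<^sup>2 + wa1 E * x2 * y2 + wa3 E * y2 = x2 ^ 3 + wa2 E * x2\<^sup>2 + wa4 E * x2 + wa6 E"
    using P Q by simp_all
  define X3 where "X3 = (y2 - y1)\<^sup>2 + wa1 E * (y2 - y1) * d - (wa2 E + x1 + x2) * d\<^sup>2"
  define X4 where "X4 = (- y2 - wa1 E * x2 - wa3 E - y1)\<^sup>2 + wa1 E * (- y2 - wa1 E * x2 - wa3 E - y1) * d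
     - (wa2 E + x1 + x2) * d\<^sup>2"
  have X3: "d\<^sup>2 * x3 = X3" unfolding x3_def X3_def using m by Groebner_Basis.algebra
  have X4: "d\<^sup>2 * x4 = X4" unfolding x4_def X4_def using n by Groebner_Basis.algebra
  have s: "X3 + X4 = 2 * x1 * x2 * (x1 + x2) + curve_b2 E * x1 * x2 + curve_b4 E * (x1 + x2) + curve_b6 E"
    unfolding X3_def X4_def d_def curve_b2_def curve_b4_def curve_b6_def using eq by Groebner_Basis.algebra
  have p: "X3 * X4 = d\<^sup>2 * (x1\<^sup>2 * x2\<^sup>2 - curve_b4 E * x1 * x2 - curve_b6 E * (x1 + x2) - curve_b8 E)"
  proof -
    have a6: "wa6 E = y1\<^sup>2 + wa1 E * x1 * y1 + wa3 E * y1 - (x1 ^ 3 + wa2 E * x1\<^sup>2 + wa4 E * x1)"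
      using eq(1) by Groebner_Basis.algebra
    have a4: "wa4 E * d = y2\<^sup>2 + wa1 E * x2 * y2 + wa3 E * y2 - (x2 ^ 3 + wa2 E * x2\<^sup>2)
       - (y1\<^sup>2 + wa1 E * x1 * y1 + wa3 E * y1 - (x1 ^ 3 + wa2 E * x1\<^sup>2))"
      using eq unfolding d_def by Groebner_Basis.algebra
    show ?thesis
      using a4 unfolding X3_def X4_def d_def curve_b4_def curve_b6_def curve_b8_def a6 by Groebner_Basis.algebra
  qed
  show thesis
  proof (rule that)
    show "ec_add E (Affine x1 y1) (Affine x2 y2) = Affine x3 (- (y1 + m * (x3 - x1)) - wa1 E * x3 - wa3 E)"
      using ec_add_Affine[of x1 x2 y1 y2 E] ne by (simp add: m_def x3_def)
    show "ec_add E (Affine x1 y1) (ec_neg E (Affine x2 y2)) = Affine x4 (- (y1 + n * (x4 - x1)) - wa1 E * x4 - wa3 E)"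
      using ec_add_Affine[of x1 x2 y1 y2' E] ne by (simp add: n_def x4_def y2'_def)
    have dd: "(x1 - x2)\<^sup>2 = d\<^sup>2" by (simp add: d_def power2_commute)
    show "(x1 - x2)\<^sup>2 * (x3 + x4) = 2 * x1 * x2 * (x1 + x2) + curve_b2 E * x1 * x2 + curve_b4 E * (x1 + x2) + curve_b6 E"
      unfolding dd using X3 X4 s by (simp add: distrib_left)
    have "d\<^sup>2 * (d\<^sup>2 * (x3 * x4)) = d\<^sup>2 * (x1\<^sup>2 * x2\<^sup>2 - curve_b4 E * x1 * x2 - curve_b6 E * (x1 + x2) - curve_b8 E)"
      unfolding p[symmetric] X3[symmetric] X4[symmetric] by Groebner_Basis.algebra
    with d show "(x1 - x2)\<^sup>2 * (x3 * x4) = x1\<^sup>2 * x2\<^sup>2 - curve_b4 E * x1 * x2 - curve_b6 E * (x1 + x2) - curve_b8 E"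
      unfolding dd by (subst (asm) mult_cancel_left) simp
  qed
qed

lemma double_abscissa:
  fixes E :: "'a::field weierstrass_curve"
  assumes P: "on_curve E (Affine x y)"
    and nz: "4 * x ^ 3 + curve_b2 E * x\<^sup>2 + 2 * curve_b4 E * x + curve_b6 E \<noteq> 0"
  obtains y' where "ec_add E (Affine x y) (Affine x y) =
    Affine ((x ^ 4 - curve_b4 E * x\<^sup>2 - 2 * curve_b6 E * x - curve_b8 E) / (4 * x ^ 3 + curve_b2 E * x\<^sup>2 + 2 * curve_b4 E * x + curve_b6 E)) y'"
proof -
  define t where "t = 2 * y + wa1 E * x + wa3 E"
  define N where "N = 3 * x\<^sup>2 + 2 * wa2 E * x + wa4 E - wa1 E * y"
  have eq: "y\<^sup>2 + wa1 E * x * y + wa3 E * y = x ^ 3 + wa2 E * x\<^sup>2 + wa4 E * x + wa6 E" using P by simp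
  have t2: "t\<^sup>2 = 4 * x ^ 3 + curve_b2 E * x\<^sup>2 + 2 * curve_b4 E * x + curve_b6 E"
    unfolding t_def curve_b2_def curve_b4_def curve_b6_def using eq by Groebner_Basis.algebra
  have t: "t \<noteq> 0" using nz t2 by auto
  define m where "m = N / t"
  have m: "m * t = N" using t by (simp add: m_def)
  have slope: "ec_slope E x y x y = m" by (simp add: ec_slope_def m_def N_def t_def)
  define x3 where "x3 = m\<^sup>2 + wa1 E * m - wa2 E - x - x"
  have "t\<^sup>2 * x3 = N\<^sup>2 + wa1 E * N * t - (wa2 E + x + x) * t\<^sup>2"
    unfolding x3_def m[symmetric] by Groebner_Basis.algebra
  also have "\<dots> = x ^ 4 - curve_b4 E * x\<^sup>2 - 2 * curve_b6 E * x - curve_b8 E"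
  proof -
    have a6: "wa6 E = y\<^sup>2 + wa1 E * x * y + wa3 E * y - (x ^ 3 + wa2 E * x\<^sup>2 + wa4 E * x)"
      using eq by Groebner_Basis.algebra
    show ?thesis unfolding N_def t_def curve_b4_def curve_b6_def curve_b8_def a6 by Groebner_Basis.algebra
  qed
  finally have "t\<^sup>2 * x3 = x ^ 4 - curve_b4 E * x\<^sup>2 - 2 * curve_b6 E * x - curve_b8 E" .
  then have "x3 * (4 * x ^ 3 + curve_b2 E * x\<^sup>2 + 2 * curve_b4 E * x + curve_b6 E)
      = x ^ 4 - curve_b4 E * x\<^sup>2 - 2 * curve_b6 E * x - curve_b8 E"
    unfolding t2 by (subst mult.commute)
  then have x3: "x3 = (x ^ 4 - curve_b4 E * x\<^sup>2 - 2 * curve_b6 E * x - curve_b8 E)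
      / (4 * x ^ 3 + curve_b2 E * x\<^sup>2 + 2 * curve_b4 E * x + curve_b6 E)"
    by (rule nonzero_eq_divide_eq[OF nz, THEN iffD2])
  have nopp: "\<not> (x = x \<and> y + y + wa1 E * x + wa3 E = 0)" using t unfolding t_def mult_2 by blast
  have "ec_add E (Affine x y) (Affine x y) = Affine x3 (- (y + m * (x3 - x)) - wa1 E * x3 - wa3 E)"
    unfolding ec_add_Affine[OF nopp] slope x3_def[symmetric] by (rule ec_neg_simps)
  then show thesis unfolding x3 by (rule that)
qed

text \<open>
  Over an algebraically closed field, being coprime means having no common root. This lets one cancel
  the factors of the divisor one root at a time.
\<close>

lemma no_common_root_dvd:
  fixes p q r :: "'a::alg_closed_field poly"
  assumes "p \<noteq> 0" "\<And>x. poly p x = 0 \<Longrightarrow> poly q x \<noteq> 0" "p dvd r * q\<^sup>2"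
  shows "p dvd r"
  using assms
proof (induction "Polynomial.degree p" arbitrary: p r)
  case 0
  then obtain c where "p = [:c:]" by (metis degree_eq_zeroE)
  with 0 have "is_unit p" by (simp add: is_unit_const_poly_iff dvd_field_iff)
  then show ?case by (rule unit_imp_dvd)
next
  case (Suc n)
  then obtain a where a: "poly p a = 0" using alg_closed_imp_poly_has_root[of p] by auto
  then obtain p' where p': "p = [:- a, 1:] * p'" by (auto simp: poly_eq_0_iff_dvd)
  have "poly (r * q\<^sup>2) a = 0" using Suc.prems(3) a by (metis dvdE mult_zero_left poly_mult)
  with Suc.prems(2)[OF a] have "poly r a = 0" by (simp only: poly_mult poly_power) simp
  then obtain r' where r': "r = [:- a, 1:] * r'" by (auto simp: poly_eq_0_iff_dvd)
  have "p' \<noteq> 0" using Suc.prems(1) p' by auto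
  then have "Polynomial.degree p = Suc (Polynomial.degree p')" unfolding p' by (subst degree_mult_eq) auto
  moreover have "[:- a, 1:] * p' dvd [:- a, 1:] * (r' * q\<^sup>2)"
    using Suc.prems(3) unfolding p' r' by (simp only: mult.assoc)
  then have "p' dvd r' * q\<^sup>2" by (subst (asm) dvd_mult_cancel_left) auto
  ultimately have "p' dvd r'" using Suc.hyps(1)[of p' r'] Suc.hyps(2) \<open>p' \<noteq> 0\<close> Suc.prems(2)
    by (auto simp: p')
  then show ?case unfolding p' r' by (rule mult_dvd_mono[OF dvd_refl])
qed

lemma remove_common_roots:
  fixes u v :: "'a::alg_closed_field poly"
  assumes "u \<noteq> 0"
  shows "\<exists>g u' v'. u = g * u' \<and> v = g * v' \<and> (\<forall>x. \<not> (poly u' x = 0 \<and> poly v' x = 0))"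
  using assms
proof (induction "Polynomial.degree u" arbitrary: u v rule: less_induct)
  case less
  show ?case
  proof (cases "\<exists>x. poly u x = 0 \<and> poly v x = 0")
    case False
    then show ?thesis by (intro exI[of _ 1] exI[of _ u] exI[of _ v]) auto
  next
    case True
    then obtain x where "[:- x, 1:] dvd u" "[:- x, 1:] dvd v"
      by (auto simp: poly_eq_0_iff_dvd)
    then obtain u1 v1 where *: "u = [:- x, 1:] * u1" "v = [:- x, 1:] * v1"
      by (elim dvdE)
    have "u1 \<noteq> 0" using less.prems * by auto
    moreover from this have "Polynomial.degree u = Suc (Polynomial.degree u1)"
      unfolding * by (subst degree_mult_eq) auto
    ultimately obtain g u' v' where 1: "u1 = g * u'" "v1 = g * v'" "\<forall>x. \<not> (poly u' x = 0 \<and> poly v' x = 0)"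
      using less.hyps[of u1 v1] by auto
    have "u = ([:- x, 1:] * g) * u'" "v = ([:- x, 1:] * g) * v'"
      unfolding * 1(1,2) by (simp_all only: mult.assoc)
    with 1(3) show ?thesis by blast
  qed
qed

lemma poly_eq_0_cofinite:
  fixes p :: "'a::field_char_0 poly"
  assumes "finite B" "\<And>x. x \<notin> B \<Longrightarrow> poly p x = 0"
  shows "p = 0"
proof (rule ccontr)
  assume "p \<noteq> 0"
  then have "finite ({x. poly p x = 0} \<union> B)" using assms(1) poly_roots_finite by blast
  moreover have "{x. poly p x = 0} \<union> B = UNIV" using assms(2) by auto
  ultimately show False using infinite_UNIV_char_0 by metis
qed

lemma point_over: 
  fixes E :: "'a::alg_closed_field weierstrass_curve"
  obtains y where "on_curve E (Affine x y)"
proof -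
  define q where "q = [:- (x ^ 3 + wa2 E * x\<^sup>2 + wa4 E * x + wa6 E), wa1 E * x + wa3 E, 1:]"
  obtain y where "poly q y = 0" using alg_closed_imp_poly_has_root[of q] by (auto simp: q_def)
  then show thesis by (intro that) (simp add: q_def algebra_simps power2_eq_square)
qed

lemma finite_points_over:
  fixes E :: "'a::field weierstrass_curve"
  assumes "finite B"
  shows "finite {Affine x y | x y. x \<in> B \<and> on_curve E (Affine x y)}"
proof -
  have "finite {y. on_curve E (Affine x y)}" for x
  proof -
    define q where "q = [:- (x ^ 3 + wa2 E * x\<^sup>2 + wa4 E * x + wa6 E), wa1 E * x + wa3 E, 1:]"
    have "finite {y. poly q y = 0}" by (rule poly_roots_finite) (simp add: q_def)
    also have "{y. poly q y = 0} = {y. on_curve E (Affine x y)}"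
      by (auto simp: q_def algebra_simps power2_eq_square)
    finally show ?thesis .
  qed
  then have "finite (\<Union>x\<in>B. Affine x ` {y. on_curve E (Affine x y)})" using assms by blast
  then show ?thesis by (rule rev_finite_subset) auto
qed

text \<open>
  The reduced fraction \<open>u / v\<close> gives the abscissa of \<open>n P\<close> in terms of that of \<open>P\<close>, with finitely many
  exceptions. The conditions on degrees and leading coefficients say that \<open>u / v\<close> behaves like
  \<open>x / n\<^sup>2\<close> at infinity. They are part of the definition because they carry the induction on \<open>n\<close>: they show
  that \<open>u / v\<close> is not the identity for \<open>n \<ge> 2\<close>, and they determine the degrees of all auxiliary polynomials.
\<close>

definition abscissa_map :: "'a::field weierstrass_curve \<Rightarrow> nat \<Rightarrow> 'a poly \<Rightarrow> 'a poly \<Rightarrow> bool" where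
  "abscissa_map E n u v \<longleftrightarrow>
     (\<forall>x. \<not> (poly u x = 0 \<and> poly v x = 0)) \<and>
     v \<noteq> 0 \<and> Polynomial.degree u = Suc (Polynomial.degree v) \<and>
     Polynomial.lead_coeff v = of_nat n ^ 2 * Polynomial.lead_coeff u \<and>
     (\<exists>B. finite B \<and> (\<forall>x y. on_curve E (Affine x y) \<longrightarrow> x \<notin> B \<longrightarrow>
        poly v x \<noteq> 0 \<and> (\<exists>y'. Affine x y [^]\<^bsub>curve_group E\<^esub> n = Affine (poly u x / poly v x) y')))"

lemma abscissa_map_reduce:
  fixes E :: "'a::alg_closed_field weierstrass_curve"
  assumes "V \<noteq> 0" "Polynomial.degree U = Suc (Polynomial.degree V)"
    "Polynomial.lead_coeff V = of_nat n ^ 2 * Polynomial.lead_coeff U" "finite B"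
    "\<And>x y. on_curve E (Affine x y) \<Longrightarrow> x \<notin> B \<Longrightarrow>
        poly V x \<noteq> 0 \<and> (\<exists>y'. Affine x y [^]\<^bsub>curve_group E\<^esub> n = Affine (poly U x / poly V x) y')"
  obtains u v where "abscissa_map E n u v" "Polynomial.degree u \<le> Polynomial.degree U"
proof -
  have "U \<noteq> 0" using assms(2) by auto
  then obtain g u v where U: "U = g * u" and V: "V = g * v" and c: "\<forall>x. \<not> (poly u x = 0 \<and> poly v x = 0)"
    using remove_common_roots[of U V] by blast
  have nz: "g \<noteq> 0" "u \<noteq> 0" "v \<noteq> 0" using \<open>U \<noteq> 0\<close> \<open>V \<noteq> 0\<close> U V by auto
  show thesis
  proof (rule that)
    show "Polynomial.degree u \<le> Polynomial.degree U" using nz by (simp add: U degree_mult_eq)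
    show "abscissa_map E n u v"
      unfolding abscissa_map_def
    proof (intro conjI)
      show "Polynomial.degree u = Suc (Polynomial.degree v)"
        using assms(2) nz by (simp add: U V degree_mult_eq)
      show "Polynomial.lead_coeff v = of_nat n ^ 2 * Polynomial.lead_coeff u"
        using assms(3) nz unfolding U V lead_coeff_mult by simp
      have "poly v x \<noteq> 0 \<and> (\<exists>y'. Affine x y [^]\<^bsub>curve_group E\<^esub> n = Affine (poly u x / poly v x) y')"
        if "on_curve E (Affine x y)" "x \<notin> B" for x y
        using assms(5)[OF that] by (auto simp: U V)
      then show "\<exists>B. finite B \<and> (\<forall>x y. on_curve E (Affine x y) \<longrightarrow> x \<notin> B \<longrightarrow>
        poly v x \<noteq> 0 \<and> (\<exists>y'. Affine x y [^]\<^bsub>curve_group E\<^esub> n = Affine (poly u x / poly v x) y'))"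
        using assms(4) by blast
    qed (use c nz in auto)
  qed
qed

context
  fixes E :: "'a::{alg_closed_field, field_char_0} weierstrass_curve"
  assumes ell: "elliptic_curve E"
begin

interpretation EG: comm_group "curve_group E"
  using ell by (rule comm_group_curve_group)

lemma abscissa_map_1: "abscissa_map E 1 [:0, 1:] 1"
  unfolding abscissa_map_def by (auto intro: exI[of _ "{}"])

lemma abscissa_map_2: "\<exists>u v. abscissa_map E 2 u v \<and> Polynomial.degree u \<le> 4"
proof -
  define U where "U = [:- curve_b8 E, - 2 * curve_b6 E, - curve_b4 E, 0, 1:]"
  define V where "V = [:curve_b6 E, 2 * curve_b4 E, curve_b2 E, 4:]"
  have U: "poly U x = x ^ 4 - curve_b4 E * x\<^sup>2 - 2 * curve_b6 E * x - curve_b8 E" for x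
    unfolding U_def by (simp add: algebra_simps power2_eq_square power4_eq_xxxx)
  have V: "poly V x = 4 * x ^ 3 + curve_b2 E * x\<^sup>2 + 2 * curve_b4 E * x + curve_b6 E" for x
    unfolding V_def by (simp add: algebra_simps power2_eq_square power3_eq_cube)
  show ?thesis
  proof (rule abscissa_map_reduce[of V U 2 "{x. poly V x = 0}" E])
    show V0: "V \<noteq> 0" by (simp add: V_def)
    show "finite {x. poly V x = 0}" using V0 by (rule poly_roots_finite)
    fix x y assume P: "on_curve E (Affine x y)" and x: "x \<notin> {x. poly V x = 0}"
    show "poly V x \<noteq> 0 \<and> (\<exists>y'. Affine x y [^]\<^bsub>curve_group E\<^esub> (2::nat) = Affine (poly U x / poly V x) y')"
    proof -
      have Vx: "poly V x \<noteq> 0" using x by simp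
      obtain y' where "ec_add E (Affine x y) (Affine x y) = Affine (poly U x / poly V x) y'"
        using double_abscissa[OF P Vx[unfolded V]] unfolding U V by blast
      moreover have "Affine x y [^]\<^bsub>curve_group E\<^esub> (2::nat) = ec_add E (Affine x y) (Affine x y)"
        using EG.nat_pow_Suc[of "Affine x y" 1] P by (simp add: numeral_2_eq_2 del: ec_add.simps(3))
      ultimately show ?thesis using Vx by (metis (no_types))
    qed
  qed (auto simp: U_def V_def)
qed

text \<open>
  This is \<open>sum_and_difference_abscissas\<close> for the points \<open>n P\<close> and \<open>P\<close>.
\<close>

lemma neighbour_multiples:
  assumes P: "on_curve E (Affine x y)" and n: "n \<ge> 1"
    and Q: "Affine x y [^]\<^bsub>curve_group E\<^esub> n = Affine xq yq" and ne: "xq \<noteq> x"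
  obtains x3 y3 x4 y4 where
    "Affine x y [^]\<^bsub>curve_group E\<^esub> (Suc n) = Affine x3 y3"
    "Affine x y [^]\<^bsub>curve_group E\<^esub> (n - 1) = Affine x4 y4"
    "(xq - x)\<^sup>2 * (x3 + x4) = 2 * xq * x * (xq + x) + curve_b2 E * xq * x + curve_b4 E * (xq + x) + curve_b6 E"
    "(xq - x)\<^sup>2 * (x3 * x4) = xq\<^sup>2 * x\<^sup>2 - curve_b4 E * xq * x - curve_b6 E * (xq + x) - curve_b8 E"
proof -
  let ?G = "curve_group E" and ?P = "Affine x y"
  have Pc: "?P \<in> carrier ?G" using P by simp
  have "?P [^]\<^bsub>?G\<^esub> n \<in> carrier ?G" using Pc by (rule EG.nat_pow_closed)
  then have Qon: "on_curve E (Affine xq yq)" unfolding Q by simp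
  obtain x3 y3 x4 y4 where 3: "ec_add E (Affine xq yq) ?P = Affine x3 y3"
    and 4: "ec_add E (Affine xq yq) (ec_neg E ?P) = Affine x4 y4"
    and eqs: "(xq - x)\<^sup>2 * (x3 + x4) = 2 * xq * x * (xq + x) + curve_b2 E * xq * x + curve_b4 E * (xq + x) + curve_b6 E"
    "(xq - x)\<^sup>2 * (x3 * x4) = xq\<^sup>2 * x\<^sup>2 - curve_b4 E * xq * x - curve_b6 E * (xq + x) - curve_b8 E"
    using sum_and_difference_abscissas[OF Qon P ne] by metis
  obtain k where k: "n = Suc k" using n by (cases n) auto
  have Pk: "?P [^]\<^bsub>?G\<^esub> k \<in> carrier ?G" using Pc by (rule EG.nat_pow_closed)
  have "(?P [^]\<^bsub>?G\<^esub> k \<otimes>\<^bsub>?G\<^esub> ?P) \<otimes>\<^bsub>?G\<^esub> inv\<^bsub>?G\<^esub> ?P = ?P [^]\<^bsub>?G\<^esub> k"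
    by (simp only: EG.m_assoc Pk Pc EG.inv_closed EG.r_inv EG.r_one)
  moreover have "?P [^]\<^bsub>?G\<^esub> k \<otimes>\<^bsub>?G\<^esub> ?P = Affine xq yq" using Q k by simp
  ultimately have "ec_add E (Affine xq yq) (ec_neg E ?P) = ?P [^]\<^bsub>?G\<^esub> k"
    using inv_curve_group[OF ell P] by simp
  with 4 k have "?P [^]\<^bsub>?G\<^esub> (n - 1) = Affine x4 y4" by (simp del: ec_add.simps ec_neg_simps)
  moreover have "?P [^]\<^bsub>?G\<^esub> (Suc n) = Affine x3 y3" using 3 Q by (simp del: ec_add.simps)
  ultimately show thesis using eqs by (intro that)
qed

text \<open>
  After clearing the denominator \<open>v\<^sup>2\<close>, the quadratic for the abscissas of \<open>(n + 1) P\<close> and \<open>(n - 1) P\<close> is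
  \<open>A z\<^sup>2 - B z + C\<close> with polynomials \<open>A\<close>, \<open>B\<close>, \<open>C\<close>. One root is the reduced fraction \<open>u1 / v1\<close>, so \<open>v1\<close>
  divides \<open>A\<close> and \<open>u1\<close> divides \<open>C\<close>, and the other root is the quotient of \<open>U = C / u1\<close> by \<open>V = A / v1\<close>.
  Dividing the known factor out is what keeps the degree down to \<open>2 deg u + 2 - deg u1\<close>; reducing
  \<open>U / V\<close> to lowest terms can only lower it further.
\<close>

lemma abscissa_map_step:
  assumes n: "n \<ge> 2" and m: "abscissa_map E (n - 1) u1 v1" and 0: "abscissa_map E n u v"
  shows "\<exists>u2 v2. abscissa_map E (Suc n) u2 v2 \<and>
    Polynomial.degree u2 + Polynomial.degree u1 \<le> 2 * Polynomial.degree u + 2"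
proof -
  let ?d = Polynomial.degree and ?lc = Polynomial.lead_coeff
  define ind where "ind = [:0, 1 :: 'a:]"
  define A where "A = (u - ind * v)\<^sup>2"
  define B where "B = 2 * u * ind * (u + ind * v) + [:curve_b2 E:] * u * ind * v + [:curve_b4 E:] * (u + ind * v) * v + [:curve_b6 E:] * v\<^sup>2"
  define C where "C = u\<^sup>2 * ind\<^sup>2 - [:curve_b4 E:] * u * ind * v - [:curve_b6 E:] * (u + ind * v) * v - [:curve_b8 E:] * v\<^sup>2"
  have poly_ind [simp]: "poly ind x = x" for x by (simp add: ind_def)
  have poly_const: "poly [:b:] x = b" for b x :: 'a by simp
  have u1v1: "u1 \<noteq> 0" "v1 \<noteq> 0" and cop: "\<And>x. poly v1 x = 0 \<Longrightarrow> poly u1 x \<noteq> 0"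
    "\<And>x. poly u1 x = 0 \<Longrightarrow> poly v1 x \<noteq> 0"
    and d1: "?d u1 = Suc (?d v1)" and l1: "?lc v1 = of_nat (n - 1) ^ 2 * ?lc u1"
    using m by (auto simp: abscissa_map_def)
  have uv: "u \<noteq> 0" "v \<noteq> 0" and d: "?d u = Suc (?d v)" and lv: "?lc v = of_nat n ^ 2 * ?lc u"
    using 0 by (auto simp: abscissa_map_def)
  define c c1 where "c = ?lc u" and "c1 = ?lc u1"
  have c: "c \<noteq> 0" "c1 \<noteq> 0" using uv u1v1 by (auto simp: c_def c1_def)
  obtain B0 where B0: "finite B0" "\<And>x y. on_curve E (Affine x y) \<Longrightarrow> x \<notin> B0 \<Longrightarrow>
        poly v x \<noteq> 0 \<and> (\<exists>y'. Affine x y [^]\<^bsub>curve_group E\<^esub> n = Affine (poly u x / poly v x) y')"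
    using 0 by (auto simp: abscissa_map_def)
  obtain B1 where B1: "finite B1" "\<And>x y. on_curve E (Affine x y) \<Longrightarrow> x \<notin> B1 \<Longrightarrow>
        poly v1 x \<noteq> 0 \<and> (\<exists>y'. Affine x y [^]\<^bsub>curve_group E\<^esub> (n - 1) = Affine (poly u1 x / poly v1 x) y')"
    using m by (auto simp: abscissa_map_def)
  \<comment> \<open>The leading coefficient of \<open>u - x v\<close> is that of \<open>u\<close> times \<open>1 - n\<^sup>2\<close>, nonzero as \<open>n \<ge> 2\<close>; the
    roots of this polynomial are the abscissas where \<open>n P = P\<close> or \<open>n P = - P\<close>.\<close>
  have coeff_diff: "Polynomial.coeff (u - ind * v) (?d u) = c * (1 - of_nat n ^ 2)"
    using d lv by (simp add: ind_def c_def algebra_simps)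
  have n1: "(1 - of_nat n ^ 2 :: 'a) \<noteq> 0"
  proof -
    have "(of_nat n ^ 2 :: 'a) \<noteq> 1" using n by (simp flip: of_nat_power)
    then show ?thesis by simp
  qed
  have d_diff: "?d (u - ind * v) = ?d u"
  proof (rule antisym)
    show "?d (u - ind * v) \<le> ?d u" using d by (intro degree_diff_le) (auto simp: ind_def)
    show "?d u \<le> ?d (u - ind * v)" using coeff_diff c n1 by (intro le_degree) simp
  qed
  have diff_nz: "u - ind * v \<noteq> 0" using coeff_diff c n1 by auto
  have dA: "?d A = 2 * ?d u"
    using d_diff diff_nz by (simp add: A_def degree_power_eq)
  have lA: "?lc A = (c * (1 - of_nat n ^ 2))\<^sup>2"
    by (simp only: A_def lead_coeff_power d_diff coeff_diff)
  have A0: "A \<noteq> 0" using diff_nz by (simp add: A_def)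
  have dC: "?d C = 2 * ?d u + 2" and lC: "?lc C = c\<^sup>2"
  proof -
    define C' where "C' = - ([:curve_b4 E:] * u * ind * v + [:curve_b6 E:] * (u + ind * v) * v + [:curve_b8 E:] * v\<^sup>2)"
    have CC: "C = (u * ind)\<^sup>2 + C'" by (simp add: C_def C'_def algebra_simps power_mult_distrib)
    have uX: "?d (u * ind) = ?d u + 1" "?lc (u * ind) = c"
      using uv by (simp_all add: ind_def degree_mult_eq c_def)
    have "?d (smult b (u * ind * v)) \<le> 2 * ?d u" for b
      using uv d by (intro order.trans[OF degree_smult_le]) (simp add: ind_def degree_mult_eq)
    moreover have "?d (smult b ((u + ind * v) * v)) \<le> 2 * ?d u" for b
    proof -
      have "?d (u + ind * v) \<le> ?d u" using d by (intro degree_add_le) (auto simp: ind_def)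
      then show ?thesis using d by (intro order.trans[OF degree_smult_le] order.trans[OF degree_mult_le]) simp
    qed
    moreover have "?d (smult b (v\<^sup>2)) \<le> 2 * ?d u" for b
      using uv d by (intro order.trans[OF degree_smult_le]) (simp add: degree_power_eq)
    ultimately have "?d C' \<le> 2 * ?d u"
      unfolding C'_def degree_minus by (intro degree_add_le) (simp_all add: mult.assoc)
    moreover have uX2: "?d ((u * ind)\<^sup>2) = 2 * ?d u + 2" "?lc ((u * ind)\<^sup>2) = c\<^sup>2"
    proof -
      have "u * ind \<noteq> 0" using uv by (simp add: ind_def)
      then show "?d ((u * ind)\<^sup>2) = 2 * ?d u + 2" using uX(1) by (simp add: degree_power_eq)
      show "?lc ((u * ind)\<^sup>2) = c\<^sup>2" by (simp only: lead_coeff_power uX(2))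
    qed
    ultimately have lt: "?d C' < ?d ((u * ind)\<^sup>2)" by simp
    show "?d C = 2 * ?d u + 2" unfolding CC using degree_add_eq_left[OF lt] uX2 by simp
    show "?lc C = c\<^sup>2" unfolding CC using lead_coeff_add_le[of C' "(u * ind)\<^sup>2"] lt uX2 by (metis add.commute lead_coeff_add_le)
  qed
  have C0: "C \<noteq> 0" using dC by auto
  define Bad where "Bad = B0 \<union> B1 \<union> {x. poly (u - ind * v) x = 0}"
  have Bad: "finite Bad" using B0 B1 poly_roots_finite[OF diff_nz] by (simp add: Bad_def)
  have good: "\<exists>x2 y2. Affine x y [^]\<^bsub>curve_group E\<^esub> (Suc n) = Affine x2 y2 \<and> poly v1 x \<noteq> 0 \<and> poly A x \<noteq> 0 \<and>
     poly A x * (x2 + poly u1 x / poly v1 x) = poly B x \<and> poly A x * (x2 * (poly u1 x / poly v1 x)) = poly C x"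
    if P: "on_curve E (Affine x y)" and x: "x \<notin> Bad" for x y
  proof -
    let ?P = "Affine x y"
    obtain y0 where vx: "poly v x \<noteq> 0" and Q: "?P [^]\<^bsub>curve_group E\<^esub> n = Affine (poly u x / poly v x) y0"
      using B0(2)[OF P] x by (auto simp: Bad_def)
    obtain y1 where v1x: "poly v1 x \<noteq> 0" and Q1: "?P [^]\<^bsub>curve_group E\<^esub> (n - 1) = Affine (poly u1 x / poly v1 x) y1"
      using B1(2)[OF P] x by (auto simp: Bad_def)
    define xq where "xq = poly u x / poly v x"
    have xq: "xq * poly v x = poly u x" using vx by (simp add: xq_def)
    have ne: "xq \<noteq> x" using x xq by (auto simp: Bad_def)
    obtain x3 y3 x4 y4 where next_mult: "?P [^]\<^bsub>curve_group E\<^esub> (Suc n) = Affine x3 y3"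
      and prev: "?P [^]\<^bsub>curve_group E\<^esub> (n - 1) = Affine x4 y4"
      and sum: "(xq - x)\<^sup>2 * (x3 + x4) = 2 * xq * x * (xq + x) + curve_b2 E * xq * x + curve_b4 E * (xq + x) + curve_b6 E"
      and prod: "(xq - x)\<^sup>2 * (x3 * x4) = xq\<^sup>2 * x\<^sup>2 - curve_b4 E * xq * x - curve_b6 E * (xq + x) - curve_b8 E"
      using neighbour_multiples[OF P _ Q[folded xq_def] ne] n by (metis One_nat_def Suc_1 Suc_leD)
    have x4: "x4 = poly u1 x / poly v1 x" using prev Q1 by simp
    have Ax: "poly A x = (poly v x)\<^sup>2 * (xq - x)\<^sup>2"
      unfolding A_def poly_power poly_diff poly_mult xq[symmetric] poly_ind by Groebner_Basis.algebra
    have Bx: "poly B x = (poly v x)\<^sup>2 * (2 * xq * x * (xq + x) + curve_b2 E * xq * x + curve_b4 E * (xq + x) + curve_b6 E)"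
      unfolding B_def poly_power poly_add poly_mult poly_const poly_numeral xq[symmetric] poly_ind by Groebner_Basis.algebra
    have Cx: "poly C x = (poly v x)\<^sup>2 * (xq\<^sup>2 * x\<^sup>2 - curve_b4 E * xq * x - curve_b6 E * (xq + x) - curve_b8 E)"
      unfolding C_def poly_power poly_add poly_diff poly_mult poly_const xq[symmetric] poly_ind by Groebner_Basis.algebra
    have "poly A x \<noteq> 0" unfolding Ax using vx ne by simp
    moreover have "poly A x * (x3 + x4) = poly B x" "poly A x * (x3 * x4) = poly C x"
      unfolding Ax Bx Cx by (simp_all only: mult.assoc sum prod)
    ultimately have "poly A x \<noteq> 0 \<and> poly A x * (x3 + x4) = poly B x \<and> poly A x * (x3 * x4) = poly C x"
      by blast
    with next_mult show ?thesis using v1x unfolding x4 by blast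
  qed
  have "A * u1\<^sup>2 - B * u1 * v1 + C * v1\<^sup>2 = 0"
  proof (rule poly_eq_0_cofinite[OF Bad])
    fix x assume x: "x \<notin> Bad"
    obtain y where P: "on_curve E (Affine x y)" by (rule point_over)
    obtain x2 where "poly v1 x \<noteq> 0" and B: "poly A x * (x2 + poly u1 x / poly v1 x) = poly B x"
      and C: "poly A x * (x2 * (poly u1 x / poly v1 x)) = poly C x"
      using good[OF P x] by blast
    define z where "z = poly u1 x / poly v1 x"
    have z: "poly u1 x = z * poly v1 x" using \<open>poly v1 x \<noteq> 0\<close> by (simp add: z_def)
    show "poly (A * u1\<^sup>2 - B * u1 * v1 + C * v1\<^sup>2) x = 0"
      unfolding poly_add poly_diff poly_mult poly_power B[symmetric] C[symmetric] z_def[symmetric]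
      unfolding z by Groebner_Basis.algebra
  qed
  note rel = this
  have "A * u1\<^sup>2 = v1 * (B * u1 - C * v1)" using rel by Groebner_Basis.algebra
  then have "v1 dvd A" using u1v1 cop by (intro no_common_root_dvd[of v1 u1 A]) auto
  then obtain V where V: "A = v1 * V" by (elim dvdE)
  have "C * v1\<^sup>2 = u1 * (B * v1 - A * u1)" using rel by Groebner_Basis.algebra
  then have "u1 dvd C" using u1v1 cop by (intro no_common_root_dvd[of u1 v1 C]) auto
  then obtain U where U: "C = u1 * U" by (elim dvdE)
  have UV0: "U \<noteq> 0" "V \<noteq> 0" using A0 C0 U V by auto
  have dV: "?d v1 + ?d V = 2 * ?d u" using dA u1v1 UV0 unfolding V by (simp add: degree_mult_eq)
  have dU: "?d u1 + ?d U = 2 * ?d u + 2" using dC u1v1 UV0 unfolding U by (simp add: degree_mult_eq)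
  have lV: "of_nat (n - 1) ^ 2 * c1 * ?lc V = (c * (1 - of_nat n ^ 2))\<^sup>2"
    using lA unfolding V lead_coeff_mult l1 c1_def .
  have lU: "c1 * ?lc U = c\<^sup>2" using lC unfolding U lead_coeff_mult c1_def .
  obtain u2 v2 where "abscissa_map E (Suc n) u2 v2" "?d u2 \<le> ?d U"
  proof (rule abscissa_map_reduce[of V U "Suc n" Bad E])
    show "?d U = Suc (?d V)" using dU dV d1 by simp
    show "?lc V = of_nat (Suc n) ^ 2 * ?lc U"
    proof -
      define k :: 'a where "k = of_nat (n - 1)"
      have nk: "of_nat n = k + 1" "of_nat (Suc n) = k + 2" using n by (simp_all add: k_def of_nat_diff)
      have k: "k \<noteq> 0" by (simp only: k_def of_nat_eq_0_iff) (use n in simp)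
      \<comment> \<open>With \<open>k = n - 1\<close>, the factorisation \<open>1 - n\<^sup>2 = - k (k + 2)\<close> turns the ratio of the leading
        coefficients into \<open>(n + 1)\<^sup>2\<close>.\<close>
      have "k\<^sup>2 * c1 * ?lc V = k\<^sup>2 * c1 * ((k + 2)\<^sup>2 * ?lc U)"
        using lV lU unfolding nk k_def[symmetric] by Groebner_Basis.algebra
      then show ?thesis unfolding nk using k c by simp
    qed
    fix x y assume P: "on_curve E (Affine x y)" and x: "x \<notin> Bad"
    obtain x2 y2 where *: "Affine x y [^]\<^bsub>curve_group E\<^esub> (Suc n) = Affine x2 y2" "poly v1 x \<noteq> 0" "poly A x \<noteq> 0"
      and B: "poly A x * (x2 + poly u1 x / poly v1 x) = poly B x"
      and C: "poly A x * (x2 * (poly u1 x / poly v1 x)) = poly C x"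
      using good[OF P x] by blast
    have "u1 * v1 * (V * u1 + U * v1 - B) = 0"
      using rel unfolding U V by Groebner_Basis.algebra
    then have "B = V * u1 + U * v1" using u1v1 by simp
    then have Bx: "poly B x = poly V x * poly u1 x + poly U x * poly v1 x" by simp
    have Vx: "poly V x \<noteq> 0" using *(3) by (auto simp: V)
    have v1x: "poly v1 x \<noteq> 0" by (rule *(2))
    define z where "z = poly u1 x / poly v1 x"
    have z: "poly u1 x = z * poly v1 x" using v1x by (simp add: z_def)
    have Ax: "poly A x = poly v1 x * poly V x" by (simp add: V)
    have "(poly v1 x * poly V x) * (x2 + z) = poly V x * (z * poly v1 x) + poly U x * poly v1 x"
      using B unfolding z_def[symmetric] unfolding Bx Ax z .
    then have "poly v1 x * (poly V x * x2) = poly v1 x * poly U x" by Groebner_Basis.algebra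
    then have "poly V x * x2 = poly U x" using v1x by (simp only: mult_cancel_left) simp
    then have "x2 = poly U x / poly V x" using Vx by (metis nonzero_mult_div_cancel_left)
    with * Vx show "poly V x \<noteq> 0 \<and> (\<exists>y'. Affine x y [^]\<^bsub>curve_group E\<^esub> Suc n = Affine (poly U x / poly V x) y')"
      by blast
  qed (use UV0 Bad in auto)
  then show ?thesis using dU by (intro exI[of _ u2] exI[of _ v2]) simp
qed

text \<open>
  By the previous lemma the degrees \<open>d\<^sub>n\<close> satisfy \<open>d\<^sub>n\<^sub>+\<^sub>2 - d\<^sub>n\<^sub>+\<^sub>1 \<le> d\<^sub>n\<^sub>+\<^sub>1 - d\<^sub>n + 2\<close>. As \<open>d\<^sub>1 = 1\<close> and
  \<open>d\<^sub>2 \<le> 4\<close>, this gives \<open>d\<^sub>n\<^sub>+\<^sub>1 - d\<^sub>n \<le> 2 n + 1\<close> and \<open>d\<^sub>n \<le> n\<^sup>2\<close>.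
\<close>

lemma abscissa_map_exists:
  assumes "n \<ge> 1"
  shows "\<exists>u v. abscissa_map E n u v \<and> Polynomial.degree u \<le> n\<^sup>2"
proof -
  have "\<exists>u v u' v'. abscissa_map E n u v \<and> abscissa_map E (Suc n) u' v' \<and>
    Polynomial.degree u \<le> n\<^sup>2 \<and> Polynomial.degree u' \<le> Polynomial.degree u + (2 * n + 1)"
    using assms
  proof (induction n rule: nat_induct_at_least)
    case base
    obtain u' v' where "abscissa_map E 2 u' v'" "Polynomial.degree u' \<le> 4" using abscissa_map_2 by blast
    then show ?case using abscissa_map_1
      by (intro exI[of _ "[:0, 1:]"] exI[of _ 1] exI[of _ u'] exI[of _ v']) (simp add: numeral_2_eq_2)
  next
    case (Suc n)
    then obtain u v u' v' where *: "abscissa_map E n u v" "abscissa_map E (Suc n) u' v'"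
      "Polynomial.degree u \<le> n\<^sup>2" "Polynomial.degree u' \<le> Polynomial.degree u + (2 * n + 1)" by blast
    obtain u2 v2 where "abscissa_map E (Suc (Suc n)) u2 v2"
      "Polynomial.degree u2 + Polynomial.degree u \<le> 2 * Polynomial.degree u' + 2"
      using abscissa_map_step[of "Suc n" u v u' v'] * Suc.hyps by auto
    with * show ?case
      by (intro exI[of _ u'] exI[of _ v'] exI[of _ u2] exI[of _ v2]) (auto simp: power2_eq_square)
  qed
  then show ?thesis by blast
qed

section \<open>The number of torsion points\<close>

text \<open>
  Let \<open>S\<close> be a finite set of points killed by \<open>n\<close> and let \<open>P\<close> be generic. All translates \<open>P + t\<close> with \<open>t\<close> in
  \<open>S\<close> have the same image \<open>Q = n P\<close>, so their abscissas are roots of \<open>u - xQ v\<close>, a polynomial of degree at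
  most \<open>n\<^sup>2\<close>. These abscissas are distinct, because two translates that are negatives of each other
  would give \<open>2 Q = 0\<close>. A uniform bound for all finite \<open>S\<close> also
  shows that the torsion is finite.
\<close>

lemma card_torsion_le:
  assumes n: "n \<ge> 1"
  defines "T \<equiv> {P \<in> carrier (curve_group E). P [^]\<^bsub>curve_group E\<^esub> n = Infinity}"
  shows "finite T \<and> card T \<le> n\<^sup>2"
proof -
  obtain u v where uv: "abscissa_map E n u v" "Polynomial.degree u \<le> n\<^sup>2"
    using abscissa_map_exists[OF n] by blast
  obtain u' v' where uv': "abscissa_map E (2 * n) u' v'"
    using abscissa_map_exists[of "2 * n"] n by auto
  obtain B where B: "finite B" "\<And>x y. on_curve E (Affine x y) \<Longrightarrow> x \<notin> B \<Longrightarrow>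
        poly v x \<noteq> 0 \<and> (\<exists>y'. Affine x y [^]\<^bsub>curve_group E\<^esub> n = Affine (poly u x / poly v x) y')"
    using uv by (auto simp: abscissa_map_def)
  obtain B' where B': "finite B'" "\<And>x y. on_curve E (Affine x y) \<Longrightarrow> x \<notin> B' \<Longrightarrow>
        (\<exists>x' y'. Affine x y [^]\<^bsub>curve_group E\<^esub> (2 * n) = Affine x' y')"
    using uv' by (fastforce simp: abscissa_map_def)
  \<comment> \<open>\<open>B\<close> excludes the exceptions for multiplication by \<open>n\<close>, and \<open>B'\<close> ensures that \<open>2 n P\<close> is not zero.\<close>
  define Z where "Z = insert Infinity {Affine x y | x y. x \<in> B \<union> B' \<and> on_curve E (Affine x y)}"
  have Z: "finite Z" unfolding Z_def using B(1) B'(1) finite_points_over by blast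
  let ?G = "curve_group E"
  have "card S \<le> n\<^sup>2" if S: "S \<subseteq> T" "finite S" for S
  proof -
    have Sc: "t \<in> carrier ?G" "t [^]\<^bsub>?G\<^esub> n = Infinity" if "t \<in> S" for t
      using S that by (auto simp: T_def)
    define bad where "bad = Z \<union> (\<Union>t\<in>S. (\<lambda>z. z \<otimes>\<^bsub>?G\<^esub> inv\<^bsub>?G\<^esub> t) ` Z)"
    have bad: "finite bad" using Z S by (simp add: bad_def)
    have "\<exists>P. on_curve E P \<and> P \<notin> bad"
    proof (rule ccontr)
      assume no: "\<nexists>P. on_curve E P \<and> P \<notin> bad"
      have "x \<in> (\<Union>P\<in>bad. coords P)" for x
      proof -
        obtain y where "on_curve E (Affine x y)" by (rule point_over)
        with no have "Affine x y \<in> bad" by blast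
        then show ?thesis by force
      qed
      then have "(\<Union>P\<in>bad. coords P) = UNIV" by blast
      moreover have "finite (coords P)" for P :: "'a ec_point" by (cases P) auto
      ultimately show False using bad infinite_UNIV_char_0[where ?'a = 'a] by (metis finite_UN)
    qed
    then obtain P where P: "on_curve E P" "P \<notin> bad" by blast
    have Pc: "P \<in> carrier ?G" using P by simp
    have PT: "P \<otimes>\<^bsub>?G\<^esub> t \<notin> Z" if "t \<in> S" for t
    proof
      assume "P \<otimes>\<^bsub>?G\<^esub> t \<in> Z"
      then have "(P \<otimes>\<^bsub>?G\<^esub> t) \<otimes>\<^bsub>?G\<^esub> inv\<^bsub>?G\<^esub> t \<in> bad" using that unfolding bad_def by blast
      moreover have "(P \<otimes>\<^bsub>?G\<^esub> t) \<otimes>\<^bsub>?G\<^esub> inv\<^bsub>?G\<^esub> t = P"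
        using Pc Sc[OF that] EG.m_assoc[of P t "inv\<^bsub>?G\<^esub> t"] EG.r_inv[of t] EG.r_one[of P] EG.inv_closed[of t] by metis
      ultimately show False using P by simp
    qed
    obtain x0 y0 where P0: "P = Affine x0 y0" "x0 \<notin> B \<union> B'"
      using P by (cases P) (auto simp: bad_def Z_def)
    obtain xQ yQ where Q: "P [^]\<^bsub>?G\<^esub> n = Affine xQ yQ" using B(2)[of x0 y0] P P0 by auto
    have Q2: "Affine xQ yQ \<otimes>\<^bsub>?G\<^esub> Affine xQ yQ \<noteq> Infinity"
    proof -
      have "P [^]\<^bsub>?G\<^esub> n \<otimes>\<^bsub>?G\<^esub> P [^]\<^bsub>?G\<^esub> n = P [^]\<^bsub>?G\<^esub> (2 * n)"
        using EG.nat_pow_mult[OF Pc, of n n] by (simp add: mult_2)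
      then show ?thesis using B'(2)[of x0 y0] P P0 Q by auto
    qed
    define r where "r = u - Polynomial.smult xQ v"
    have dr: "Polynomial.degree r = Polynomial.degree u" "r \<noteq> 0"
    proof -
      have "Polynomial.degree (- Polynomial.smult xQ v) < Polynomial.degree u"
        using uv(1) by (auto simp: abscissa_map_def less_Suc_eq_le intro: degree_smult_le)
      then show "Polynomial.degree r = Polynomial.degree u"
        unfolding r_def diff_conv_add_uminus by (rule degree_add_eq_left)
      then show "r \<noteq> 0" using uv(1) by (auto simp: abscissa_map_def)
    qed
    have ex: "\<exists>x y. P \<otimes>\<^bsub>?G\<^esub> t = Affine x y \<and> poly r x = 0" if t: "t \<in> S" for t
    proof -
      have on: "P \<otimes>\<^bsub>?G\<^esub> t \<in> carrier ?G" using EG.m_closed Pc Sc[OF t] by blast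
      then obtain x y where xy: "P \<otimes>\<^bsub>?G\<^esub> t = Affine x y" "x \<notin> B"
        using PT[OF t] by (cases "P \<otimes>\<^bsub>?G\<^esub> t") (auto simp: Z_def)
      have "(P \<otimes>\<^bsub>?G\<^esub> t) [^]\<^bsub>?G\<^esub> n = P [^]\<^bsub>?G\<^esub> n \<otimes>\<^bsub>?G\<^esub> t [^]\<^bsub>?G\<^esub> n"
        using Pc Sc[OF t] by (intro EG.nat_pow_distrib)
      also have "\<dots> = Affine xQ yQ" using Sc(2)[OF t] Q by simp
      finally have "Affine x y [^]\<^bsub>?G\<^esub> n = Affine xQ yQ" by (simp only: xy)
      then have "poly v x \<noteq> 0" "xQ = poly u x / poly v x"
        using B(2)[of x y] on xy by auto
      then show ?thesis using xy by (intro exI[of _ x] exI[of _ y]) (simp add: r_def)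
    qed
    define f where "f t = (SOME x. \<exists>y. P \<otimes>\<^bsub>?G\<^esub> t = Affine x y)" for t
    have f: "\<exists>y. P \<otimes>\<^bsub>?G\<^esub> t = Affine (f t) y \<and> poly r (f t) = 0" if "t \<in> S" for t
      using ex[OF that] unfolding f_def by auto
    have "inj_on f S"
    proof (rule inj_onI)
      fix s t assume st: "s \<in> S" "t \<in> S" "f s = f t"
      note c = Sc[OF st(1)] Sc[OF st(2)]
      define Ps Pt where "Ps = P \<otimes>\<^bsub>?G\<^esub> s" and "Pt = P \<otimes>\<^bsub>?G\<^esub> t"
      have Pst: "Ps \<in> carrier ?G" "Pt \<in> carrier ?G" using EG.m_closed Pc c by (simp_all only: Ps_def Pt_def)
      have pow: "Ps [^]\<^bsub>?G\<^esub> n = Affine xQ yQ" "Pt [^]\<^bsub>?G\<^esub> n = Affine xQ yQ"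
        using EG.nat_pow_distrib[OF Pc c(1), of n] EG.nat_pow_distrib[OF Pc c(3), of n] c Q
        by (simp_all add: Ps_def Pt_def)
      obtain ys yt where y: "Ps = Affine (f s) ys" "Pt = Affine (f s) yt"
        using f[OF st(1)] f[OF st(2)] st(3) by (auto simp: Ps_def Pt_def)
      have "Ps = Pt"
      proof (rule ccontr)
        assume "Ps \<noteq> Pt"
        then have "ys + yt + wa1 E * f s + wa3 E = 0"
          using same_x_on_curve[of E "f s" ys yt] Pst y by auto
        then have "Ps \<otimes>\<^bsub>?G\<^esub> Pt = Infinity" using y by simp
        then have "Ps [^]\<^bsub>?G\<^esub> n \<otimes>\<^bsub>?G\<^esub> Pt [^]\<^bsub>?G\<^esub> n = Infinity"
          using EG.nat_pow_distrib[OF Pst, of n] EG.nat_pow_one[of n] by simp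
        then show False using Q2 pow by simp
      qed
      then show "s = t" using EG.l_cancel[of P s t] Pc c unfolding Ps_def Pt_def by auto
    qed
    then have "card S = card (f ` S)" by (simp add: card_image)
    also have "\<dots> \<le> card {x. poly r x = 0}"
      using f dr poly_roots_finite by (intro card_mono) auto
    also have "\<dots> \<le> Polynomial.degree r" using dr by (intro card_poly_roots_bound)
    finally show ?thesis using dr uv by simp
  qed
  then show ?thesis
    using finite_if_finite_subsets_card_bdd[of T "n\<^sup>2"] by blast
qed

end


section \<open>Endomorphisms of the algebraic closure\<close>

text \<open>
  Embeddings over \<open>K\<close> of intermediate fields into the algebraic closure, represented by their graphs.
  Domains are automatically fields, because every ring between a field and an algebraic extension of
  it is one, and the maps are injective (\<open>pe_injective\<close>). In this form, the union of a chain is visibly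
  again an embedding, as Zorn's lemma requires.
\<close>

definition partial_embedding :: "('k::field alg_closure \<times> 'k alg_closure) set \<Rightarrow> bool" where
  "partial_embedding S \<longleftrightarrow>
     (\<forall>c. (to_ac c, to_ac c) \<in> S) \<and>
     (\<forall>a b c d. (a, b) \<in> S \<longrightarrow> (c, d) \<in> S \<longrightarrow> (a + c, b + d) \<in> S \<and> (a * c, b * d) \<in> S) \<and>
     (\<forall>b. (0, b) \<in> S \<longrightarrow> b = 0)"

text \<open>
  A polynomial over the domain together with its image under the embedding.
\<close>

definition poly_pairs where
  "poly_pairs S = {(p, q). \<forall>i. (Polynomial.coeff p i, Polynomial.coeff q i) \<in> S}"

context
  fixes S :: "('k::field alg_closure \<times> 'k alg_closure) set"
  assumes S: "partial_embedding S"
begin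

lemma pe_base: "(to_ac c, to_ac c) \<in> S" using S by (simp add: partial_embedding_def)
lemma pe_0: "(0, 0) \<in> S" using pe_base[of 0] by simp
lemma pe_1: "(1, 1) \<in> S" using pe_base[of 1] by simp
lemma pe_add: "(a, b) \<in> S \<Longrightarrow> (c, d) \<in> S \<Longrightarrow> (a + c, b + d) \<in> S"
  using S by (simp add: partial_embedding_def)
lemma pe_mult: "(a, b) \<in> S \<Longrightarrow> (c, d) \<in> S \<Longrightarrow> (a * c, b * d) \<in> S"
  using S by (simp add: partial_embedding_def)
lemma pe_uminus: "(a, b) \<in> S \<Longrightarrow> (- a, - b) \<in> S"
  using pe_mult[OF pe_base[of "- 1"]] by fastforce
lemma pe_diff: "(a, b) \<in> S \<Longrightarrow> (c, d) \<in> S \<Longrightarrow> (a - c, b - d) \<in> S"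
  using pe_add[OF _ pe_uminus] by fastforce
lemma pe_zeroD: "(0, b) \<in> S \<Longrightarrow> b = 0"
  using S by (simp add: partial_embedding_def)
lemma pe_sum: "(\<And>i. i \<in> I \<Longrightarrow> (f i, g i) \<in> S) \<Longrightarrow> (sum f I, sum g I) \<in> S"
  by (induction I rule: infinite_finite_induct) (auto intro: pe_0 pe_add)

lemma pe_functional: "(a, b) \<in> S \<Longrightarrow> (a, c) \<in> S \<Longrightarrow> b = c"
  using pe_diff[of a b a c] pe_zeroD[of "b - c"] by simp

lemma pe_poly:
  "(a, b) \<in> S \<Longrightarrow> (poly (map_poly to_ac p) a, poly (map_poly to_ac p) b) \<in> S"
  by (induction p) (auto simp: map_poly_pCons intro!: pe_0 pe_add pe_mult pe_base)

text \<open>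
  A nonzero algebraic element is a root of a polynomial over \<open>K\<close> with nonzero constant term; its
  image is a root of the same polynomial and so cannot be zero.
\<close>

lemma pe_injective:
  assumes "(a, 0) \<in> S" shows "a = 0"
proof (rule ccontr)
  assume "a \<noteq> 0"
  obtain p :: "'k poly" where "p \<noteq> 0" "poly (map_poly to_ac p) a = 0"
    by (rule alg_closure_algebraic)
  then have "\<exists>p::'k poly. poly (map_poly to_ac p) a = 0 \<and> Polynomial.coeff p 0 \<noteq> 0"
  proof (induction "Polynomial.degree p" arbitrary: p rule: less_induct)
    case less
    obtain c q where p: "p = pCons c q" by (rule pCons_cases)
    show ?case
    proof (cases "c = 0")
      case True
      with less.prems p have "q \<noteq> 0" "poly (map_poly to_ac q) a = 0"
        using \<open>a \<noteq> 0\<close> by (auto simp: map_poly_pCons)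
      moreover have "Polynomial.degree q < Polynomial.degree p" using \<open>q \<noteq> 0\<close> by (simp add: p)
      ultimately show ?thesis using less.hyps by blast
    next
      case False
      with less.prems p show ?thesis by (intro exI[of _ p]) simp
    qed
  qed
  then obtain p :: "'k poly" where p: "poly (map_poly to_ac p) a = 0" "Polynomial.coeff p 0 \<noteq> 0" by blast
  with pe_poly[OF assms, of p] pe_zeroD have "poly (map_poly to_ac p) 0 = 0" by simp
  then show False using p(2) by (simp add: poly_0_coeff_0 coeff_map_poly)
qed

lemma pe_zero_iff: "(a, b) \<in> S \<Longrightarrow> a = 0 \<longleftrightarrow> b = 0"
  using pe_zeroD pe_injective by auto

lemma poly_pairs_add: "(p, q) \<in> poly_pairs S \<Longrightarrow> (p', q') \<in> poly_pairs S \<Longrightarrow> (p + p', q + q') \<in> poly_pairs S"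
  by (auto simp: poly_pairs_def intro: pe_add)
lemma poly_pairs_diff: "(p, q) \<in> poly_pairs S \<Longrightarrow> (p', q') \<in> poly_pairs S \<Longrightarrow> (p - p', q - q') \<in> poly_pairs S"
  by (auto simp: poly_pairs_def intro: pe_diff)
lemma poly_pairs_mult: "(p, q) \<in> poly_pairs S \<Longrightarrow> (p', q') \<in> poly_pairs S \<Longrightarrow> (p * p', q * q') \<in> poly_pairs S"
  by (auto simp: poly_pairs_def coeff_mult intro!: pe_sum pe_mult)
lemma poly_pairs_pCons: "(a, b) \<in> S \<Longrightarrow> (p, q) \<in> poly_pairs S \<Longrightarrow> (pCons a p, pCons b q) \<in> poly_pairs S"
  by (auto simp: poly_pairs_def coeff_pCons split: nat.split)
lemma poly_pairs_0: "(0, 0) \<in> poly_pairs S"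
  by (auto simp: poly_pairs_def pe_0)
lemma poly_pairs_monom: "(a, b) \<in> S \<Longrightarrow> (Polynomial.monom a n, Polynomial.monom b n) \<in> poly_pairs S"
  by (auto simp: poly_pairs_def pe_0)

lemma poly_pairs_eq_0_iff: "(p, q) \<in> poly_pairs S \<Longrightarrow> p = 0 \<longleftrightarrow> q = 0"
  using pe_zero_iff by (auto simp: poly_pairs_def poly_eq_iff)

lemma poly_pairs_degree:
  assumes "(p, q) \<in> poly_pairs S" shows "Polynomial.degree p = Polynomial.degree q"
proof -
  have "Polynomial.coeff p i = 0 \<longleftrightarrow> Polynomial.coeff q i = 0" for i
    using assms pe_zero_iff by (auto simp: poly_pairs_def)
  then show ?thesis by (simp add: Polynomial.degree_def)
qed

text \<open>
  The first component is a minimal polynomial of \<open>\<alpha>\<close> over the domain, the second its image.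
\<close>

definition minimal_pair where
  "minimal_pair \<alpha> d e \<longleftrightarrow> (d, e) \<in> poly_pairs S \<and> d \<noteq> 0 \<and> poly d \<alpha> = 0 \<and>
     (\<forall>p q. (p, q) \<in> poly_pairs S \<longrightarrow> p \<noteq> 0 \<longrightarrow> poly p \<alpha> = 0 \<longrightarrow> Polynomial.degree d \<le> Polynomial.degree p)"

lemma minimal_pair_exists: "\<exists>d e. minimal_pair \<alpha> d e"
proof -
  obtain p :: "'k poly" where "p \<noteq> 0" "poly (map_poly to_ac p) \<alpha> = 0"
    by (rule alg_closure_algebraic)
  moreover have "map_poly to_ac p \<noteq> 0"
    using \<open>p \<noteq> 0\<close> by (simp add: map_poly_eq_0_iff)
  moreover have "(map_poly to_ac p, map_poly to_ac p) \<in> poly_pairs S"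
    by (auto simp: poly_pairs_def coeff_map_poly pe_base)
  ultimately have ex: "\<exists>x. x \<in> poly_pairs S \<and> fst x \<noteq> 0 \<and> poly (fst x) \<alpha> = 0" by force
  from ex obtain x where "x \<in> poly_pairs S \<and> fst x \<noteq> 0 \<and> poly (fst x) \<alpha> = 0"
    and "\<And>y. y \<in> poly_pairs S \<and> fst y \<noteq> 0 \<and> poly (fst y) \<alpha> = 0 \<Longrightarrow>
      Polynomial.degree (fst x) \<le> Polynomial.degree (fst y)"
    using ex_has_least_nat[of "\<lambda>x. x \<in> poly_pairs S \<and> fst x \<noteq> 0 \<and> poly (fst x) \<alpha> = 0"
        _ "\<lambda>x. Polynomial.degree (fst x)"] by blast
  then have "minimal_pair \<alpha> (fst x) (snd x)"
    unfolding minimal_pair_def by auto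
  then show ?thesis by blast
qed

text \<open>
  A root of the image of the minimal polynomial of \<open>\<alpha>\<close> satisfies every relation over the domain that \<open>\<alpha>\<close>
  satisfies. The induction is polynomial division: subtracting a multiple of the minimal polynomial
  lowers the degree, and it does so simultaneously for both members of a pair.
\<close>

lemma minimal_pair_root:
  assumes min: "minimal_pair \<alpha> d e" and \<beta>: "poly e \<beta> = 0"
    and "(p, q) \<in> poly_pairs S" "poly p \<alpha> = 0"
  shows "poly q \<beta> = 0"
  using assms(3,4)
proof (induction "Polynomial.degree p" arbitrary: p q rule: less_induct)
  case less
  let ?d = "Polynomial.degree d" and ?n = "Polynomial.degree p"
  have de: "(d, e) \<in> poly_pairs S" "d \<noteq> 0" "poly d \<alpha> = 0" using min by (auto simp: minimal_pair_def)
  show ?case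
  proof (cases "p = 0")
    case True
    with poly_pairs_eq_0_iff[OF less.prems(1)] show ?thesis by simp
  next
    case False
    then have le: "?d \<le> ?n" using min less.prems by (auto simp: minimal_pair_def)
    define a a' b b' where "a = Polynomial.coeff d ?d" and "a' = Polynomial.coeff e ?d"
      and "b = Polynomial.coeff p ?n" and "b' = Polynomial.coeff q ?n"
    have aa: "(a, a') \<in> S" and bb: "(b, b') \<in> S"
      using de less.prems by (auto simp: poly_pairs_def a_def a'_def b_def b'_def)
    have anz: "a \<noteq> 0" "a' \<noteq> 0" using de(2) pe_zero_iff[OF aa] by (auto simp: a_def)
    define r where "r = [:a:] * p - Polynomial.monom b (?n - ?d) * d"
    define s where "s = [:a':] * q - Polynomial.monom b' (?n - ?d) * e"
    have rs: "(r, s) \<in> poly_pairs S" unfolding r_def s_def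
      by (intro poly_pairs_diff poly_pairs_mult poly_pairs_pCons poly_pairs_monom poly_pairs_0 aa bb de less.prems)
    have r\<alpha>: "poly r \<alpha> = 0" using less.prems de by (simp add: r_def)
    have s\<beta>: "poly s \<beta> = a' * poly q \<beta>" using \<beta> by (simp add: s_def)
    have "poly s \<beta> = 0"
    proof (cases "?n = 0")
      case True
      then obtain c where "p = [:c:]" by (rule degree_eq_zeroE)
      with less.prems False show ?thesis by simp
    next
      case n: False
      have "Polynomial.degree r < ?n"
      proof (rule degree_lessI)
        show "r \<noteq> 0 \<or> 0 < ?n" using n by simp
        have 1: "Polynomial.degree r \<le> ?n" unfolding r_def
          by (intro degree_diff_le order.trans[OF degree_mult_le])
            (use le in \<open>auto intro: order.trans[OF add_mono[OF degree_monom_le order.refl]]\<close>)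
        have 2: "Polynomial.coeff r ?n = 0"
          using le by (simp add: r_def coeff_monom_mult a_def b_def)
        show "\<forall>k\<ge>?n. Polynomial.coeff r k = 0"
          using 1 2 by (metis coeff_eq_0 le_neq_implies_less order.strict_trans1)
      qed
      with less.hyps rs r\<alpha> show ?thesis by blast
    qed
    with s\<beta> anz show ?thesis by simp
  qed
qed

text \<open>
  The simple extension that sends \<open>\<alpha>\<close> to \<open>\<beta>\<close>: its graph consists of the values of all pairs of polynomials.
\<close>

lemma extend_partial_embedding:
  assumes min: "minimal_pair \<alpha> d e" and \<beta>: "poly e \<beta> = 0"
  shows "\<exists>T. partial_embedding T \<and> S \<subseteq> T \<and> (\<alpha>, \<beta>) \<in> T"
proof (intro exI conjI)
  let ?T = "{(poly p \<alpha>, poly q \<beta>) | p q. (p, q) \<in> poly_pairs S}"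
  show ST: "S \<subseteq> ?T"
  proof safe
    fix a b assume "(a, b) \<in> S"
    then have "([:a:], [:b:]) \<in> poly_pairs S" by (intro poly_pairs_pCons poly_pairs_0)
    then show "\<exists>p q. (a, b) = (poly p \<alpha>, poly q \<beta>) \<and> (p, q) \<in> poly_pairs S"
      by (intro exI[of _ "[:a:]"] exI[of _ "[:b:]"]) simp
  qed
  have "([:0, 1:], [:0, 1:]) \<in> poly_pairs S" by (intro poly_pairs_pCons poly_pairs_0 pe_0 pe_1)
  then show "(\<alpha>, \<beta>) \<in> ?T" by force
  show "partial_embedding ?T"
    unfolding partial_embedding_def
  proof (intro conjI allI impI)
    show "(to_ac c, to_ac c) \<in> ?T" for c using ST pe_base by blast
  next
    fix a b c d assume "(a, b) \<in> ?T" "(c, d) \<in> ?T"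
    then obtain p q p' q' where *: "(p, q) \<in> poly_pairs S" "(p', q') \<in> poly_pairs S"
      "a = poly p \<alpha>" "b = poly q \<beta>" "c = poly p' \<alpha>" "d = poly q' \<beta>" by blast
    show "(a + c, b + d) \<in> ?T" 
      using *(3-6) poly_pairs_add[OF *(1,2)] by (simp flip: poly_add) blast
    show "(a * c, b * d) \<in> ?T" 
      using *(3-6) poly_pairs_mult[OF *(1,2)] by (simp flip: poly_mult) blast
  next
    fix b assume "(0, b) \<in> ?T"
    then obtain p q where *: "(p, q) \<in> poly_pairs S" "poly p \<alpha> = 0" "b = poly q \<beta>" by auto
    then show "b = 0" using minimal_pair_root[OF min \<beta>] by blast
  qed
qed

end

definition base_endomorphism :: "('k::field alg_closure \<Rightarrow> 'k alg_closure) \<Rightarrow> bool" where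
  "base_endomorphism \<sigma> \<longleftrightarrow> (\<forall>x y. \<sigma> (x + y) = \<sigma> x + \<sigma> y) \<and> (\<forall>x y. \<sigma> (x * y) = \<sigma> x * \<sigma> y) \<and>
     (\<forall>c. \<sigma> (to_ac c) = to_ac c)"

lemma partial_embedding_extends:
  fixes S :: "('k::field alg_closure \<times> 'k alg_closure) set"
  assumes S: "partial_embedding S"
  shows "\<exists>\<sigma>. base_endomorphism \<sigma> \<and> (\<forall>(a, b)\<in>S. \<sigma> a = b)"
proof -
  let ?A = "{T. partial_embedding T \<and> S \<subseteq> T}"
  have "\<exists>M\<in>?A. \<forall>T\<in>?A. M \<subseteq> T \<longrightarrow> T = M"
  proof (rule subset_Zorn_nonempty)
    show "?A \<noteq> {}" using S by auto
  next
    fix C assume C: "C \<noteq> {}" "subset.chain ?A C"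
    have two: "\<exists>T\<in>C. x \<in> T \<and> y \<in> T" if "x \<in> \<Union>C" "y \<in> \<Union>C" for x y
    proof -
      obtain T U where "T \<in> C" "x \<in> T" "U \<in> C" "y \<in> U" using \<open>x \<in> \<Union>C\<close> \<open>y \<in> \<Union>C\<close> by blast
      moreover have "T \<subseteq> U \<or> U \<subseteq> T" using C(2) \<open>T \<in> C\<close> \<open>U \<in> C\<close> by (auto simp: subset_chain_def)
      ultimately show ?thesis by blast
    qed
    have pe: "partial_embedding T" if "T \<in> C" for T using that C(2) by (auto simp: subset_chain_def)
    have "partial_embedding (\<Union>C)"
      unfolding partial_embedding_def
    proof (intro conjI allI impI)
      show "(to_ac c, to_ac c) \<in> \<Union>C" for c 
      proof -
        obtain T where "T \<in> C" using C(1) by blast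
        with pe_base[OF pe[OF this]] show ?thesis by blast
      qed
      fix a b c d assume "(a, b) \<in> \<Union>C" "(c, d) \<in> \<Union>C"
      from two[OF this] obtain T where "T \<in> C" "(a, b) \<in> T" "(c, d) \<in> T" by blast
      then show "(a + c, b + d) \<in> \<Union>C" "(a * c, b * d) \<in> \<Union>C"
        using pe_add[OF pe, of T a b c d] pe_mult[OF pe, of T a b c d] by blast+
    next
      show "b = 0" if "(0, b) \<in> \<Union>C" for b using that pe_zeroD[OF pe] by blast
    qed
    moreover obtain T where "T \<in> C" using C(1) by blast
    then have "S \<subseteq> \<Union>C" using C(2) by (auto simp: subset_chain_def)
    ultimately show "\<Union>C \<in> ?A" by blast
  qed
  then obtain M where M: "partial_embedding M" "S \<subseteq> M"
    and "\<forall>T\<in>?A. M \<subseteq> T \<longrightarrow> T = M" by auto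
  then have max: "T = M" if "partial_embedding T" "M \<subseteq> T" for T
    using that by auto
  have total: "\<exists>b. (a, b) \<in> M" for a
  proof -
    obtain d e where min: "minimal_pair M a d e" using minimal_pair_exists[OF M(1)] by blast
    then have de: "(d, e) \<in> poly_pairs M" "d \<noteq> 0" "poly d a = 0"
      by (auto simp: minimal_pair_def[OF M(1)])
    have "Polynomial.degree d \<noteq> 0"
    proof
      assume "Polynomial.degree d = 0"
      then obtain c where "d = [:c:]" by (rule degree_eq_zeroE)
      with de show False by simp
    qed
    then obtain b where "poly e b = 0"
      using alg_closed_imp_poly_has_root[of e] poly_pairs_degree[OF M(1) de(1)] by auto
    \<comment> \<open>An element outside the domain of a maximal embedding would allow an extension.\<close>
    from extend_partial_embedding[OF M(1) min this]
    obtain T where "partial_embedding T" "M \<subseteq> T" "(a, b) \<in> T" by auto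
    with max[of T] show ?thesis by auto
  qed
  define \<sigma> where "\<sigma> a = (SOME b. (a, b) \<in> M)" for a
  have \<sigma>: "(a, \<sigma> a) \<in> M" for a unfolding \<sigma>_def using total[of a] by (rule someI_ex)
  have eq: "\<sigma> a = b" if "(a, b) \<in> M" for a b using pe_functional[OF M(1) \<sigma> that] .
  have "base_endomorphism \<sigma>" unfolding base_endomorphism_def
    by (intro conjI allI eq pe_add[OF M(1)] pe_mult[OF M(1)] pe_base[OF M(1)] \<sigma>)
  moreover have "\<forall>(a, b)\<in>S. \<sigma> a = b" using eq M(2) by blast
  ultimately show ?thesis by blast
qed

text \<open>
  An element outside \<open>K\<close> has a minimal polynomial of degree at least two. In characteristic zero it is
  separable, so it has a second root, and the embedding that moves the element there extends to the
  algebraic closure.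
\<close>

lemma base_endomorphism_moves:
  fixes x :: "'k::field_char_0 alg_closure"
  assumes "x \<notin> range to_ac"
  shows "\<exists>\<sigma>. base_endomorphism \<sigma> \<and> \<sigma> x \<noteq> x"
proof -
  define S where "S = range (\<lambda>c. (to_ac c :: 'k alg_closure, to_ac c :: 'k alg_closure))"
  have S: "partial_embedding S"
    unfolding partial_embedding_def S_def
    by (auto simp flip: to_ac_add to_ac_mult)
  have diag: "a = b" "a \<in> range to_ac" if "(a, b) \<in> S" for a b using that by (auto simp: S_def)
  obtain d e where min: "minimal_pair S x d e" using minimal_pair_exists[OF S] by blast
  then have de: "(d, e) \<in> poly_pairs S" "d \<noteq> 0" "poly d x = 0"
    and least: "\<And>p. (p, p) \<in> poly_pairs S \<Longrightarrow> p \<noteq> 0 \<Longrightarrow> poly p x = 0 \<Longrightarrow> Polynomial.degree d \<le> Polynomial.degree p"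
    unfolding minimal_pair_def[OF S] by blast+
  have "Polynomial.coeff d i = Polynomial.coeff e i" for i
    using de(1) by (intro diag(1)) (simp add: poly_pairs_def)
  then have ed: "e = d" by (simp add: poly_eq_iff)
  have coeffs: "(Polynomial.coeff d i, Polynomial.coeff d i) \<in> S" for i
    using de(1) ed by (auto simp: poly_pairs_def)
  obtain d1 where d1: "d = [:- x, 1:] * d1" using de(3) by (auto simp: poly_eq_0_iff_dvd)
  have d1nz: "d1 \<noteq> 0" using de(2) d1 by auto
  have deg: "Polynomial.degree d = Polynomial.degree d1 + 1"
    unfolding d1 using d1nz by (subst degree_mult_eq) auto
  have "Polynomial.degree d1 \<noteq> 0"
  proof
    assume "Polynomial.degree d1 = 0"
    then obtain c where c: "d1 = [:c:]" by (rule degree_eq_zeroE)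
    have "Polynomial.coeff d 0 = - x * c" "Polynomial.coeff d 1 = c" by (simp_all add: d1 c)
    moreover have "c \<noteq> 0" using c d1nz by auto
    ultimately have "x = - (Polynomial.coeff d 0 / Polynomial.coeff d 1)" by simp
    moreover obtain u v where "Polynomial.coeff d 0 = to_ac u" "Polynomial.coeff d 1 = to_ac v"
      using diag(2)[OF coeffs] by blast
    ultimately have "x = to_ac (- (u / v))" by simp
    with assms show False by blast
  qed
  then obtain \<beta> where \<beta>: "poly d1 \<beta> = 0" using alg_closed_imp_poly_has_root[of d1] by auto
  have "\<beta> \<noteq> x"
  proof
    assume "\<beta> = x"
    \<comment> \<open>A double root would be a root of the derivative, which has smaller degree.\<close>
    then have "poly (pderiv d) x = 0" using \<beta> by (simp add: d1 pderiv_mult pderiv_pCons del: mult_pCons_left)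
    moreover have "pderiv d \<noteq> 0" using deg by (simp add: pderiv_eq_0_iff)
    moreover have "(pderiv d, pderiv d) \<in> poly_pairs S"
      using pe_mult[OF S pe_base[OF S] coeffs, of "of_nat _"]
      by (simp add: poly_pairs_def coeff_pderiv del: of_nat_Suc)
    ultimately have "Polynomial.degree d \<le> Polynomial.degree (pderiv d)" by (intro least)
    then show False using deg by (simp add: degree_pderiv)
  qed
  moreover have "poly e \<beta> = 0" using \<beta> by (simp add: ed d1)
  from extend_partial_embedding[OF S min this] obtain T where "partial_embedding T" "(x, \<beta>) \<in> T" by auto
  moreover from partial_embedding_extends[OF this(1)]
  obtain \<sigma> where "base_endomorphism \<sigma>" "\<forall>(a, b)\<in>T. \<sigma> a = b" by blast
  ultimately have "base_endomorphism \<sigma>" "\<sigma> x \<noteq> x" by (auto dest: bspec)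
  then show ?thesis by blast
qed


section \<open>Endomorphisms that fix the torsion of small exponent\<close>

text \<open>
  The action of an endomorphism of the algebraic closure on the points of a curve whose \<open>l\<^sup>m\<close>-torsion is
  rational, in abstract form. Written additively, \<open>\<sigma> - 1\<close> is nilpotent on each group of elements of
  exponent \<open>l\<^sup>e\<close> (\<open>delta_tors\<close>), whence the name.
\<close>

locale unipotent_endomorphism = comm_group G for G (structure) +
  fixes \<sigma> :: "'a \<Rightarrow> 'a" and l m :: nat
  assumes hom: "\<sigma> \<in> hom G G"
    and l: "prime l" and m: "m > 0" and lm: "l ^ m \<ge> 3"
    and fixes_torsion: "\<And>x. x \<in> carrier G \<Longrightarrow> x [^] (l ^ m) = \<one> \<Longrightarrow> \<sigma> x = x"
begin

definition tors :: "nat \<Rightarrow> 'a set" where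
  "tors e = {x \<in> carrier G. x [^] (l ^ e) = \<one>}"

definition delta :: "'a \<Rightarrow> 'a" where
  "delta x = \<sigma> x \<otimes> inv x"

lemma sigma_closed [simp, intro]: "x \<in> carrier G \<Longrightarrow> \<sigma> x \<in> carrier G"
  using hom by (auto simp: hom_def)
lemma sigma_mult [simp]: "x \<in> carrier G \<Longrightarrow> y \<in> carrier G \<Longrightarrow> \<sigma> (x \<otimes> y) = \<sigma> x \<otimes> \<sigma> y"
  using hom by (auto simp: hom_def)
lemma sigma_one [simp]: "\<sigma> \<one> = \<one>"
  using hom_one[OF hom] is_group by blast
lemma sigma_pow [simp]: "x \<in> carrier G \<Longrightarrow> \<sigma> (x [^] (n::nat)) = \<sigma> x [^] n"
  by (induction n) auto

lemma delta_closed [simp, intro]: "x \<in> carrier G \<Longrightarrow> delta x \<in> carrier G"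
  by (simp add: delta_def)
lemma sigma_eq: "x \<in> carrier G \<Longrightarrow> \<sigma> x = x \<otimes> delta x"
  by (simp add: delta_def m_lcomm[of x])
lemma delta_pow: "x \<in> carrier G \<Longrightarrow> delta (x [^] (n::nat)) = delta x [^] n"
  by (simp add: delta_def nat_pow_distrib nat_pow_inv)
lemma delta_eq_one_iff: "x \<in> carrier G \<Longrightarrow> delta x = \<one> \<longleftrightarrow> \<sigma> x = x"
  by (metis delta_def inv_closed inv_equality inv_inv r_inv sigma_closed)

lemma tors_carrier: "x \<in> tors e \<Longrightarrow> x \<in> carrier G"
  by (simp add: tors_def)
lemma tors_mult: "x \<in> tors e \<Longrightarrow> y \<in> tors e \<Longrightarrow> x \<otimes> y \<in> tors e"
  by (simp add: tors_def nat_pow_distrib)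
lemma tors_pow: "x \<in> tors e \<Longrightarrow> x [^] (n::nat) \<in> tors e"
  by (simp add: tors_def nat_pow_pow) (simp add: nat_pow_pow[symmetric] mult.commute[of n])
lemma tors_sigma: "x \<in> tors e \<Longrightarrow> \<sigma> x \<in> tors e"
  by (auto simp: tors_def sigma_pow[symmetric] simp del: sigma_pow)
lemma tors_mono: "x \<in> tors e \<Longrightarrow> e \<le> f \<Longrightarrow> x \<in> tors f"
  unfolding tors_def by (auto simp: le_iff_add power_add nat_pow_pow[symmetric])
lemma tors_one: "\<one> \<in> tors e"
  by (simp add: tors_def)
lemma pow_in_tors_iff: "x \<in> carrier G \<Longrightarrow> x [^] (l ^ i) \<in> tors j \<longleftrightarrow> x \<in> tors (i + j)"
  by (simp add: tors_def nat_pow_pow power_add)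

text \<open>
  For \<open>x\<close> of order dividing \<open>l\<^sup>e\<close>, the power of \<open>x\<close> with exponent \<open>l\<^sup>e\<^sup>-\<^sup>m\<close> has exponent \<open>l\<^sup>m\<close>, so it is
  fixed. Exponents use truncated subtraction, which covers \<open>e < m\<close> as well: then \<open>delta x\<close> is trivial.
\<close>

lemma delta_tors:
  assumes "x \<in> tors e" shows "delta x \<in> tors (e - m)"
proof -
  have x: "x \<in> carrier G" using assms by (rule tors_carrier)
  have "x [^] (l ^ (e - m)) \<in> tors m"
    using assms x by (auto simp: pow_in_tors_iff intro: tors_mono)
  then have "\<sigma> (x [^] (l ^ (e - m))) = x [^] (l ^ (e - m))"
    by (intro fixes_torsion) (auto simp: tors_def)
  then have "delta (x [^] (l ^ (e - m))) = \<one>" using x by (simp only: delta_eq_one_iff nat_pow_closed)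
  then show ?thesis using x by (simp add: delta_pow tors_def)
qed

text \<open>
  In additive notation this is \<open>\<sigma>\<^sup>i x = x + i \<delta> x + (i choose 2) \<delta>\<^sup>2 x + w\<close>, the binomial expansion of
  \<open>(1 + \<delta>)\<^sup>i\<close> up to an error that is built from \<open>\<delta>\<^sup>3 x\<close>. In comparison with \<open>\<delta> x\<close>, two more
  applications of \<open>\<delta>\<close> have divided its order by \<open>l\<^sup>2\<^sup>m\<close>.
\<close>

lemma iterate_expansion:
  assumes x: "x \<in> carrier G" and e: "delta x \<in> tors e"
  shows "\<exists>w\<in>tors (e - 2 * m). (\<sigma> ^^ i) x =
           x \<otimes> delta x [^] i \<otimes> delta (delta x) [^] (i choose 2) \<otimes> w"
proof (induction i)
  case 0
  show ?case by (intro bexI[of _ \<one>]) (use x in \<open>auto simp: tors_one numeral_2_eq_2\<close>)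
next
  case (Suc i)
  define y z where "y = delta x" and "z = delta y"
  have yz: "y \<in> carrier G" "z \<in> carrier G" using x by (auto simp: y_def z_def)
  obtain w where w: "w \<in> tors (e - 2 * m)"
    and IH: "(\<sigma> ^^ i) x = x \<otimes> y [^] i \<otimes> z [^] (i choose 2) \<otimes> w"
    using Suc by (auto simp: y_def z_def)
  have wc: "w \<in> carrier G" using w by (rule tors_carrier)
  define u where "u = delta z [^] (i choose 2)"
  have uc: "u \<in> carrier G" using yz by (simp add: u_def)
  have "z \<in> tors (e - m)" using e unfolding z_def y_def by (rule delta_tors)
  then have "delta z \<in> tors (e - 2 * m)" using delta_tors[of z "e - m"] by (simp add: mult_2)
  then have u: "u \<in> tors (e - 2 * m)" unfolding u_def by (rule tors_pow)
  have "(\<sigma> ^^ Suc i) x = \<sigma> x \<otimes> \<sigma> y [^] i \<otimes> \<sigma> z [^] (i choose 2) \<otimes> \<sigma> w"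
    using x yz wc by (simp add: IH)
  also have "\<dots> = (x \<otimes> y) \<otimes> (y [^] i \<otimes> z [^] i) \<otimes> (z [^] (i choose 2) \<otimes> u) \<otimes> \<sigma> w"
    using x yz by (simp add: sigma_eq[of x] sigma_eq[of y] sigma_eq[of z] nat_pow_distrib u_def
        flip: y_def z_def)
  also have "\<dots> = x \<otimes> y [^] Suc i \<otimes> z [^] (i + (i choose 2)) \<otimes> (u \<otimes> \<sigma> w)"
    using x yz wc uc by (simp add: nat_pow_mult[symmetric] m_ac)
  also have "i + (i choose 2) = Suc i choose 2" by (simp add: numeral_2_eq_2)
  finally show ?case
    using tors_mult[OF u tors_sigma[OF w]] by (auto simp: y_def z_def)
qed

text \<open>
  The exponent \<open>m = 1\<close> forces \<open>l\<close> to be odd. For \<open>l = 2\<close> the claim would be false.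
\<close>

lemma choose_2_prime:
  assumes "m = 1" shows "l dvd (l choose 2)"
proof -
  have "odd l" using l lm assms by (intro prime_odd_nat) auto
  then obtain c where "l = 2 * c + 1" by (auto elim: oddE)
  then have "l choose 2 = l * c" by (simp add: choose_two)
  then show ?thesis by simp
qed

text \<open>
  For \<open>m \<ge> 2\<close> the quadratic term of the expansion is small enough because \<open>delta\<close> reduces orders by
  \<open>l\<^sup>2\<close>; for \<open>m = 1\<close> half of the reduction comes from the binomial coefficient.
\<close>

lemma iterate_l_tors:
  assumes x: "x \<in> carrier G" and e: "delta x \<in> tors e"
  shows "\<exists>w\<in>tors (e - 2). (\<sigma> ^^ l) x = x \<otimes> delta x [^] l \<otimes> w"
proof -
  define z where "z = delta (delta x)"
  have z: "z \<in> tors (e - m)" using e unfolding z_def by (rule delta_tors)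
  obtain w where w: "w \<in> tors (e - 2 * m)"
    and eq: "(\<sigma> ^^ l) x = x \<otimes> delta x [^] l \<otimes> z [^] (l choose 2) \<otimes> w"
    using iterate_expansion[OF x e, of l] by (auto simp: z_def)
  have "z [^] (l choose 2) \<in> tors (e - 2)"
  proof (cases "m = 1")
    case True
    then obtain c where c: "l choose 2 = l * c" using choose_2_prime by (auto elim: dvdE)
    have zc: "z \<in> carrier G" using z by (rule tors_carrier)
    have "z [^] (l ^ 1) \<in> tors (e - 2)"
      using z zc True pow_in_tors_iff[of z 1 "e - 2"] by (auto intro: tors_mono)
    then have "(z [^] (l ^ 1)) [^] c \<in> tors (e - 2)" by (rule tors_pow)
    then show ?thesis using zc by (simp add: nat_pow_pow c)
  next
    case False
    then have "z \<in> tors (e - 2)" using m by (intro tors_mono[OF z]) auto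
    then show ?thesis by (rule tors_pow)
  qed
  moreover have "w \<in> tors (e - 2)" using m by (intro tors_mono[OF w]) auto
  ultimately show ?thesis
    using x z w eq by (intro bexI[of _ "z [^] (l choose 2) \<otimes> w"]) (auto simp: tors_mult m_assoc tors_carrier)
qed

text \<open>
  Let \<open>y = delta x\<close> have exact order \<open>l\<^sup>f\<close>. Then \<open>\<sigma>\<^sup>l x - x\<close> is \<open>l y\<close> up to an error of order at most
  \<open>l\<^sup>f\<^sup>-\<^sup>2\<close>. If \<open>f \<ge> 2\<close>, the term \<open>l y\<close> of order \<open>l\<^sup>f\<^sup>-\<^sup>1\<close> dominates; if \<open>f \<le> 1\<close>, both are trivial.
\<close>

lemma iterate_l_delta_iff:
  assumes x: "x \<in> carrier G" and e: "delta x \<in> tors e"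
  shows "(\<sigma> ^^ l) x \<otimes> inv x \<in> tors j \<longleftrightarrow> delta x \<in> tors (Suc j)"
proof -
  define y s where "y = delta x" and "s = (\<sigma> ^^ l) x \<otimes> inv x"
  have y: "y \<in> carrier G" using x by (simp add: y_def)
  have decomp: "\<exists>w\<in>tors (f - 2). s = y [^] l \<otimes> w" if f: "y \<in> tors f" for f
  proof -
    obtain w where "w \<in> tors (f - 2)" "(\<sigma> ^^ l) x = x \<otimes> y [^] l \<otimes> w"
      using iterate_l_tors[OF x f[unfolded y_def]] by (auto simp: y_def)
    moreover from this have "s = (y [^] l \<otimes> w) \<otimes> (x \<otimes> inv x)"
      using x y by (simp only: s_def m_ac inv_closed nat_pow_closed m_closed tors_carrier[of w])
    ultimately show ?thesis using x y by (intro bexI[of _ w]) (auto simp: tors_carrier)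
  qed
  have yl: "y [^] l \<in> tors i \<longleftrightarrow> y \<in> tors (Suc i)" for i
    using pow_in_tors_iff[OF y, of 1 i] by simp
  have "s \<in> tors j \<longleftrightarrow> y \<in> tors (Suc j)"
  proof
    assume "y \<in> tors (Suc j)"
    then show "s \<in> tors j"
      using decomp[of "Suc j"] yl[of j] by (auto intro!: tors_mult intro: tors_mono)
  next
    assume s: "s \<in> tors j"
    show "y \<in> tors (Suc j)"
    proof (rule ccontr)
      assume no: "y \<notin> tors (Suc j)"
      define f where "f = (LEAST f. y \<in> tors f)"
      have f: "y \<in> tors f" unfolding f_def using e y_def by (auto intro: LeastI)
      have f2: "f \<ge> j + 2" using no f tors_mono[of y f "Suc j"] by (cases "f \<ge> j + 2") auto
      obtain w where w: "w \<in> tors (f - 2)" "s = y [^] l \<otimes> w" using decomp[OF f] by blast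
      have wc: "w \<in> carrier G" using w by (simp add: tors_carrier)
      have "inv w \<in> tors (f - 2)" using w(1) wc by (simp add: tors_def nat_pow_inv)
      moreover have "s \<in> tors (f - 2)" by (rule tors_mono[OF s]) (use f2 in linarith)
      ultimately have "s \<otimes> inv w \<in> tors (f - 2)" by (intro tors_mult)
      then have "y [^] l \<in> tors (f - 2)" using w(2) wc y by (simp add: m_assoc)
      then have "y \<in> tors (f - 1)" using f2 yl[of "f - 2"] by (simp add: Suc_diff_Suc numeral_2_eq_2)
      then show False using f2 not_less_Least[of "f - 1" "\<lambda>f. y \<in> tors f"] by (simp add: f_def)
    qed
  qed
  then show ?thesis by (simp add: y_def s_def)
qed

end

text \<open>
  Iterating the previous lemma \<open>k\<close> times, each time for the endomorphism \<open>\<sigma>\<^sup>l\<close> in place of \<open>\<sigma>\<close>, trades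
  an exponent \<open>l\<^sup>k\<close> on \<open>\<sigma>\<close> for a factor \<open>l\<^sup>k\<close> on the displacement.
\<close>

lemma (in comm_group) iterate_fixes_iff:
  assumes "unipotent_endomorphism G \<sigma> l m" and x: "x \<in> carrier G" and "x [^] (l ^ e) = \<one>"
  shows "(\<sigma> ^^ (l ^ k)) x = x \<longleftrightarrow> \<sigma> (x [^] (l ^ k)) = x [^] (l ^ k)"
proof -
  have "((\<sigma> ^^ (l ^ k)) x \<otimes> inv x) [^] (l ^ j) = \<one> \<longleftrightarrow> (\<sigma> x \<otimes> inv x) [^] (l ^ (j + k)) = \<one>" for j
    using assms(1)
  proof (induction k arbitrary: \<sigma> j)
    case (Suc k)
    interpret unipotent_endomorphism G \<sigma> l m by (rule Suc.prems)
    have comp: "\<sigma> ^^ n \<in> hom G G" for n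
    proof (induction n)
      case (Suc n)
      then show ?case using Group.hom_compose[OF Suc hom] by (simp only: funpow.simps)
    qed (auto simp: hom_def)
    have fx: "(\<sigma> ^^ n) y = y" if "y \<in> carrier G" "y [^] (l ^ m) = \<one>" for y n
      using fixes_torsion[OF that] by (induction n) auto
    interpret it: unipotent_endomorphism G "\<sigma> ^^ l" l m
      by unfold_locales (use comp fx l m lm in auto)
    have "delta x \<in> tors e"
    proof -
      have "x \<in> tors e" using assms(2,3) by (simp add: tors_def)
      then have "delta x \<in> tors (e - m)" by (rule delta_tors)
      then show ?thesis by (rule tors_mono) simp
    qed
    from iterate_l_delta_iff[OF x this, of "j + k"]
    have "((\<sigma> ^^ l) x \<otimes> inv x) [^] (l ^ (j + k)) = \<one> \<longleftrightarrow> (\<sigma> x \<otimes> inv x) [^] (l ^ (j + Suc k)) = \<one>"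
      using x it.sigma_closed[OF x] by (simp add: tors_def delta_def)
    with Suc.IH[OF it.unipotent_endomorphism_axioms, of j] show ?case
      by (simp add: funpow_mult mult.commute)
  qed simp
  note * = this[of 0]
  interpret unipotent_endomorphism G \<sigma> l m by (rule assms(1))
  have c: "(\<sigma> ^^ n) x \<in> carrier G" for n using x by (induction n) auto
  have "(\<sigma> ^^ (l ^ k)) x = x \<longleftrightarrow> (\<sigma> ^^ (l ^ k)) x \<otimes> inv x = \<one>"
    using c x by (metis inv_closed inv_equality inv_inv r_inv)
  also have "\<dots> \<longleftrightarrow> delta x [^] (l ^ k) = \<one>"
    using * c x by (simp add: delta_def)
  also have "\<dots> \<longleftrightarrow> \<sigma> (x [^] (l ^ k)) = x [^] (l ^ k)"
    using x by (simp add: delta_pow[symmetric] delta_eq_one_iff)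
  finally show ?thesis .
qed


section \<open>Points over intermediate fields\<close>

definition intermediate_field :: "'k::field alg_closure set \<Rightarrow> bool" where
  "intermediate_field F \<longleftrightarrow> base_field \<subseteq> F \<and>
     (\<forall>x\<in>F. \<forall>y\<in>F. x + y \<in> F \<and> x * y \<in> F) \<and> (\<forall>x\<in>F. - x \<in> F \<and> inverse x \<in> F)"

lemma intermediate_field_closed:
  assumes "intermediate_field F"
  shows "x \<in> F \<Longrightarrow> y \<in> F \<Longrightarrow> x + y \<in> F" "x \<in> F \<Longrightarrow> y \<in> F \<Longrightarrow> x * y \<in> F"
    "x \<in> F \<Longrightarrow> - x \<in> F" "x \<in> F \<Longrightarrow> y \<in> F \<Longrightarrow> x - y \<in> F"
    "x \<in> F \<Longrightarrow> y \<in> F \<Longrightarrow> x / y \<in> F" "x \<in> F \<Longrightarrow> x ^ n \<in> F"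
    "to_ac c \<in> F" "numeral w \<in> F"
proof -
  show add: "x \<in> F \<Longrightarrow> y \<in> F \<Longrightarrow> x + y \<in> F" and mult: "x \<in> F \<Longrightarrow> y \<in> F \<Longrightarrow> x * y \<in> F"
    and um: "x \<in> F \<Longrightarrow> - x \<in> F" and base: "to_ac c \<in> F" for x y c
    using assms unfolding intermediate_field_def by blast+
  show "x \<in> F \<Longrightarrow> y \<in> F \<Longrightarrow> x - y \<in> F"
    using add[of x "- y"] um[of y] by simp
  show "x \<in> F \<Longrightarrow> y \<in> F \<Longrightarrow> x / y \<in> F"
    using assms mult[of x "inverse y"] by (simp add: divide_inverse intermediate_field_def)
  show "x \<in> F \<Longrightarrow> x ^ n \<in> F"
    using base[of 1] by (induction n) (simp_all add: mult)
  show "numeral w \<in> F" using base[of "numeral w"] by simp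
qed

lemma intermediate_field_UNIV: "intermediate_field UNIV"
  by (simp add: intermediate_field_def)

lemma intermediate_field_base: "intermediate_field base_field"
  unfolding intermediate_field_def
  by (auto simp flip: to_ac_add to_ac_mult to_ac_minus to_ac_inverse)

lemma ring_of_type_algebra_simps:
  fixes x y :: "'a::field"
  defines "A \<equiv> ring_of_type_algebra :: 'a ring"
  shows "carrier A = UNIV" "x \<oplus>\<^bsub>A\<^esub> y = x + y" "x \<otimes>\<^bsub>A\<^esub> y = x * y" "\<zero>\<^bsub>A\<^esub> = 0" "\<one>\<^bsub>A\<^esub> = 1"
    "\<ominus>\<^bsub>A\<^esub> x = - x" "x \<noteq> 0 \<Longrightarrow> inv\<^bsub>A\<^esub> x = inverse x"
proof -
  interpret A: Ring.field A unfolding A_def by rule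
  show s: "carrier A = UNIV" "x \<oplus>\<^bsub>A\<^esub> y = x + y" "x \<otimes>\<^bsub>A\<^esub> y = x * y" "\<zero>\<^bsub>A\<^esub> = 0" "\<one>\<^bsub>A\<^esub> = 1" for x y
    by (simp_all add: A_def ring_of_type_algebra_def)
  show "\<ominus>\<^bsub>A\<^esub> x = - x" using A.minus_equality[of "- x" x] by (simp add: s)
  show "x \<noteq> 0 \<Longrightarrow> inv\<^bsub>A\<^esub> x = inverse x" using A.comm_inv_char[of x "inverse x"] by (simp add: s)
qed

lemma generated_intermediate_field:
  "intermediate_field (coordinate_field T)"
  "P \<in> T \<Longrightarrow> coords P \<subseteq> coordinate_field T"
proof -
  let ?A = "ring_of_type_algebra :: 'a alg_closure ring"
  let ?S = "base_field \<union> (\<Union>P\<in>T. coords P)"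
  note incl = generate_field.incl[of _ ?S ?A]
  note s = ring_of_type_algebra_simps[where 'a = "'a alg_closure"]
  show "coords P \<subseteq> coordinate_field T" if "P \<in> T"
    using that incl by (auto simp: coordinate_field_def)
  show "intermediate_field (coordinate_field T)"
    unfolding intermediate_field_def coordinate_field_def
  proof (intro conjI ballI)
    show "base_field \<subseteq> generate_field ?A ?S" using incl by auto
    have zero: "0 \<in> generate_field ?A ?S" using incl[of "to_ac 0"] by auto
    fix x assume x: "x \<in> generate_field ?A ?S"
    show "- x \<in> generate_field ?A ?S" using generate_field.a_inv[OF x] by (simp add: s)
    show "inverse x \<in> generate_field ?A ?S"
      using generate_field.m_inv[OF x] zero by (cases "x = 0") (simp_all add: s)
    fix y assume y: "y \<in> generate_field ?A ?S"
    show "x + y \<in> generate_field ?A ?S" using generate_field.eng_add[OF x y] by (simp add: s)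
    show "x * y \<in> generate_field ?A ?S" using generate_field.eng_mult[OF x y] by (simp add: s)
  qed
qed

lemma coordinate_field_least:
  assumes "intermediate_field F" "\<And>P. P \<in> T \<Longrightarrow> coords P \<subseteq> F"
  shows "coordinate_field T \<subseteq> F"
proof
  note s = ring_of_type_algebra_simps[where 'a = "'a alg_closure"]
  fix x assume "x \<in> coordinate_field T"
  then show "x \<in> F"
    unfolding coordinate_field_def
  proof (induction rule: generate_field.induct)
    case one
    show ?case using intermediate_field_closed(7)[OF assms(1), of 1] by (simp add: s)
  next
    case (incl h)
    then show ?case using assms by (auto simp: intermediate_field_def)
  qed (use assms(1) in \<open>auto simp: s intermediate_field_def\<close>)
qed

lemma elliptic_curve_map_to_ac:
  assumes "elliptic_curve E" shows "elliptic_curve (map_curve to_ac E)"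
proof -
  have "discriminant (map_curve to_ac E) = to_ac (discriminant E)"
    by (simp add: discriminant_def Let_def weierstrass_curve.map_sel)
  with assms show ?thesis by (simp add: elliptic_curve_def)
qed

lemma ec_group_UNIV: "ec_group E UNIV = curve_group (map_curve to_ac E)"
  by (simp add: ec_group_def curve_group_def)

lemma pow_ec_group: "P [^]\<^bsub>ec_group E F\<^esub> (n::nat) = P [^]\<^bsub>ec_group E UNIV\<^esub> n"
  by (induction n) (simp_all add: ec_group_def nat_pow_def)

lemma subgroup_ec_group:
  assumes ell: "elliptic_curve E" and F: "intermediate_field F"
  shows "subgroup (carrier (ec_group E F)) (ec_group E UNIV)"
proof -
  let ?E = "map_curve to_ac E"
  note ell' = elliptic_curve_map_to_ac[OF ell]
  interpret EG: comm_group "ec_group E UNIV"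
    unfolding ec_group_UNIV using ell' by (rule comm_group_curve_group)
  note c = intermediate_field_closed[OF F]
  have neg: "coords (ec_neg ?E P) \<subseteq> F" if "coords P \<subseteq> F" for P
    using that by (cases P) (auto simp: weierstrass_curve.map_sel intro!: c)
  have add: "coords (ec_add ?E P Q) \<subseteq> F" if "coords P \<subseteq> F" "coords Q \<subseteq> F" for P Q
    using that
    by (cases P; cases Q) (auto simp: weierstrass_curve.map_sel Let_def intro!: c)
  show ?thesis
  proof (rule EG.subgroupI)
    show "carrier (ec_group E F) \<subseteq> carrier (ec_group E UNIV)" by (auto simp: ec_group_def)
    have "Infinity \<in> carrier (ec_group E F)" by (simp add: ec_group_def)
    then show "carrier (ec_group E F) \<noteq> {}" by blast
    fix P assume P: "P \<in> carrier (ec_group E F)"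
    then have "inv\<^bsub>ec_group E UNIV\<^esub> P = ec_neg ?E P"
      unfolding ec_group_UNIV by (intro inv_curve_group ell') (simp add: ec_group_def)
    then show "inv\<^bsub>ec_group E UNIV\<^esub> P \<in> carrier (ec_group E F)"
      using P neg by (simp add: ec_group_def on_curve_ec_neg)
    fix Q assume Q: "Q \<in> carrier (ec_group E F)"
    show "P \<otimes>\<^bsub>ec_group E UNIV\<^esub> Q \<in> carrier (ec_group E F)"
      using P Q add by (simp add: ec_group_def on_curve_ec_add)
  qed
qed

lemma group_ec_group:
  assumes "elliptic_curve E" "intermediate_field F"
  shows "group (ec_group E F)"
proof -
  interpret EG: comm_group "ec_group E UNIV"
    unfolding ec_group_UNIV using elliptic_curve_map_to_ac[OF assms(1)] by (rule comm_group_curve_group)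
  have "(ec_group E UNIV)\<lparr>carrier := carrier (ec_group E F)\<rparr> = ec_group E F"
    by (simp add: ec_group_def)
  with EG.subgroup_imp_group[OF subgroup_ec_group[OF assms]] show ?thesis by simp
qed

text \<open>
  Addition, and hence the order of a point, does not depend on the field over which the point is
  considered, so torsion can be measured over the algebraic closure.
\<close>

lemma primary_torsion_iff:
  assumes "elliptic_curve E" "intermediate_field F" "prime l"
  shows "P \<in> primary_torsion E F l \<longleftrightarrow>
    P \<in> carrier (ec_group E F) \<and> (\<exists>n. P [^]\<^bsub>ec_group E UNIV\<^esub> (l ^ n) = Infinity)"
proof (cases "P \<in> carrier (ec_group E F)")
  case True
  interpret FG: group "ec_group E F" using assms(1,2) by (rule group_ec_group)
  have one: "\<one>\<^bsub>ec_group E F\<^esub> = Infinity" by (simp add: ec_group_def)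
  have "P [^]\<^bsub>ec_group E UNIV\<^esub> (l ^ n) = Infinity \<longleftrightarrow> FG.ord P dvd l ^ n" for n
    using FG.pow_eq_id[OF True, of "l ^ n"] by (simp add: pow_ec_group[of E F P] one)
  moreover have "(\<exists>n. FG.ord P = l ^ n) \<longleftrightarrow> (\<exists>n. FG.ord P dvd l ^ n)"
    using assms(3) by (auto simp: divides_primepow_nat)
  ultimately show ?thesis using True by (simp add: primary_torsion_def)
qed (simp add: primary_torsion_def)

section \<open>The action of endomorphisms on points\<close>

lemma base_endomorphism_simps:
  assumes "base_endomorphism \<sigma>"
  shows "\<sigma> (x + y) = \<sigma> x + \<sigma> y" "\<sigma> (x * y) = \<sigma> x * \<sigma> y" "\<sigma> (to_ac c) = to_ac c"
    "\<sigma> 0 = 0" "\<sigma> 1 = 1" "\<sigma> (- x) = - \<sigma> x" "\<sigma> (x - y) = \<sigma> x - \<sigma> y" "\<sigma> (numeral w) = numeral w"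
    "\<sigma> (x ^ n) = \<sigma> x ^ n" "\<sigma> x = 0 \<longleftrightarrow> x = 0" "\<sigma> x = \<sigma> y \<longleftrightarrow> x = y" "\<sigma> (inverse x) = inverse (\<sigma> x)"
    "\<sigma> (x / y) = \<sigma> x / \<sigma> y"
proof -
  show add: "\<sigma> (x + y) = \<sigma> x + \<sigma> y" and mult: "\<sigma> (x * y) = \<sigma> x * \<sigma> y" and base: "\<sigma> (to_ac c) = to_ac c" for x y c
    using assms by (simp_all add: base_endomorphism_def)
  show zero: "\<sigma> 0 = 0" and one: "\<sigma> 1 = 1" using base[of 0] base[of 1] by simp_all
  show um: "\<sigma> (- x) = - \<sigma> x" for x using add[of x "- x"] zero by (simp add: eq_neg_iff_add_eq_0 add.commute)
  show diff: "\<sigma> (x - y) = \<sigma> x - \<sigma> y" for x y using add[of x "- y"] um by simp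
  show "\<sigma> (numeral w) = numeral w" using base[of "numeral w"] by simp
  show "\<sigma> (x ^ n) = \<sigma> x ^ n" by (induction n) (simp_all add: one mult)
  show z: "\<sigma> x = 0 \<longleftrightarrow> x = 0" for x
  proof
    assume "\<sigma> x = 0"
    show "x = 0"
    proof (rule ccontr)
      assume "x \<noteq> 0"
      then have "\<sigma> x * \<sigma> (inverse x) = 1" by (simp flip: mult add: one)
      with \<open>\<sigma> x = 0\<close> show False by simp
    qed
  qed (simp add: zero)
  show "\<sigma> x = \<sigma> y \<longleftrightarrow> x = y" using z[of "x - y"] by (simp add: diff)
  show inv: "\<sigma> (inverse x) = inverse (\<sigma> x)" for x
  proof (cases "x = 0")
    case False
    then have "\<sigma> x * \<sigma> (inverse x) = 1" by (simp flip: mult add: one)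
    then show ?thesis by (metis inverse_unique)
  qed (simp add: zero)
  show "\<sigma> (x / y) = \<sigma> x / \<sigma> y" by (simp add: divide_inverse mult inv)
qed

lemma base_endomorphism_funpow: "base_endomorphism \<sigma> \<Longrightarrow> base_endomorphism (\<sigma> ^^ n)"
  by (induction n) (auto simp: base_endomorphism_def)

lemma fixed_field: 
  assumes "base_endomorphism \<sigma>" shows "intermediate_field {x. \<sigma> x = x}"
  using base_endomorphism_simps[OF assms] by (auto simp: intermediate_field_def)

lemma map_point_fixed_iff: "map_ec_point f P = P \<longleftrightarrow> coords P \<subseteq> {x. f x = x}"
  by (cases P) auto

lemma map_point_funpow:
  fixes f :: "'a \<Rightarrow> 'a"
  shows "(map_ec_point f ^^ n) P = map_ec_point (f ^^ n) P"
proof (induction n)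
  case 0
  show ?case by (cases P) simp_all
next
  case (Suc n)
  then show ?case by (cases P) simp_all
qed

lemma map_point_hom:
  assumes \<sigma>: "base_endomorphism \<sigma>"
  shows "map_ec_point \<sigma> \<in> hom (ec_group E UNIV) (ec_group E UNIV)"
proof -
  note s = base_endomorphism_simps[OF \<sigma>]
  let ?E = "map_curve to_ac E"
  have w: "\<sigma> (wa1 ?E) = wa1 ?E" "\<sigma> (wa2 ?E) = wa2 ?E" "\<sigma> (wa3 ?E) = wa3 ?E" "\<sigma> (wa4 ?E) = wa4 ?E" "\<sigma> (wa6 ?E) = wa6 ?E"
    by (simp_all add: weierstrass_curve.map_sel s)
  have on: "on_curve ?E (map_ec_point \<sigma> P)" if "on_curve ?E P" for P
  proof (cases P)
    case (Affine x y)
    from that have "\<sigma> (y\<^sup>2 + wa1 ?E * x * y + wa3 ?E * y) = \<sigma> (x ^ 3 + wa2 ?E * x\<^sup>2 + wa4 ?E * x + wa6 ?E)"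
      by (simp add: Affine)
    then show ?thesis by (simp add: Affine s w)
  qed simp
  have add: "map_ec_point \<sigma> (ec_add ?E P Q) = ec_add ?E (map_ec_point \<sigma> P) (map_ec_point \<sigma> Q)" for P Q
  proof (cases "\<exists>x1 y1 x2 y2. P = Affine x1 y1 \<and> Q = Affine x2 y2")
    case True
    then obtain x1 y1 x2 y2 where PQ: "P = Affine x1 y1" "Q = Affine x2 y2" by blast
    have "\<sigma> (y1 + y2 + wa1 ?E * x1 + wa3 ?E) = 0 \<longleftrightarrow> y1 + y2 + wa1 ?E * x1 + wa3 ?E = 0" by (rule s)
    then have opp: "\<sigma> y1 + \<sigma> y2 + wa1 ?E * \<sigma> x1 + wa3 ?E = 0 \<longleftrightarrow> y1 + y2 + wa1 ?E * x1 + wa3 ?E = 0"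
      by (simp add: s w)
    show ?thesis unfolding PQ by (simp add: Let_def s w opp)
  next
    case False
    then show ?thesis by (cases P; cases Q) auto
  qed
  show ?thesis
    by (auto simp: hom_def ec_group_def on add)
qed

section \<open>Rationality of the torsion of small exponent\<close>

lemma pow_DirProd: "(a, b) [^]\<^bsub>A \<times>\<times> B\<^esub> (n::nat) = (a [^]\<^bsub>A\<^esub> n, b [^]\<^bsub>B\<^esub> n)"
  by (induction n) (simp_all add: nat_pow_def)

text \<open>
  The given copy of \<open>(\<int>/n)\<^sup>2\<close> consists of points killed by \<open>n\<close> and has \<open>n\<^sup>2\<close> elements. As there are at most
  \<open>n\<^sup>2\<close> such points over the algebraic closure, it contains them all.
\<close>

lemma small_torsion_rational:
  fixes E :: "'k::field_char_0 weierstrass_curve"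
  assumes ell: "elliptic_curve E" and n: "n \<ge> 1"
    and copy: "contains_copy (ec_group E base_field) (integer_mod_group n \<times>\<times> integer_mod_group n)"
    and P: "P \<in> carrier (ec_group E UNIV)" "P [^]\<^bsub>ec_group E UNIV\<^esub> n = Infinity"
  shows "coords P \<subseteq> base_field"
proof -
  let ?G = "ec_group E UNIV" and ?K = "ec_group E base_field"
  let ?A = "integer_mod_group n \<times>\<times> integer_mod_group n"
  define T where "T = {P \<in> carrier ?G. P [^]\<^bsub>?G\<^esub> n = Infinity}"
  have T: "finite T" "card T \<le> n\<^sup>2"
    using card_torsion_le[OF elliptic_curve_map_to_ac[OF ell] n]
    by (simp_all add: T_def ec_group_UNIV)
  interpret K: group ?K using ell intermediate_field_base by (rule group_ec_group)
  interpret A: group ?A by (intro DirProd_group) simp_all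
  obtain H where H: "subgroup H ?K" and "?K\<lparr>carrier := H\<rparr> \<cong> ?A"
    using copy by (auto simp: contains_copy_def)
  then obtain h where h: "h \<in> hom (?K\<lparr>carrier := H\<rparr>) ?A" and bij: "bij_betw h H (carrier ?A)"
    by (auto simp: is_iso_def iso_def)
  interpret HG: group "?K\<lparr>carrier := H\<rparr>" using H by (rule K.subgroup_imp_group)
  interpret gh: group_hom "?K\<lparr>carrier := H\<rparr>" ?A h by unfold_locales (rule h)
  have HK: "H \<subseteq> carrier ?K" using H by (rule subgroup.subset)
  have "card H = card (carrier ?A)" using bij by (rule bij_betw_same_card)
  also have "\<dots> = n\<^sup>2"
    using n by (simp add: carrier_integer_mod_group card_cartesian_product power2_eq_square)
  finally have cardH: "card H = n\<^sup>2" .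
  have "H \<subseteq> T"
  proof
    fix Q assume Q: "Q \<in> H"
    have pow: "Q [^]\<^bsub>?K\<lparr>carrier := H\<rparr>\<^esub> n = Q [^]\<^bsub>?G\<^esub> n"
      using pow_ec_group[of E base_field Q n] by (simp add: nat_pow_def)
    obtain a b where hQ: "h Q = (a, b)" by (cases "h Q")
    have "h (Q [^]\<^bsub>?K\<lparr>carrier := H\<rparr>\<^esub> n) = h Q [^]\<^bsub>?A\<^esub> n"
      using Q by (intro gh.hom_nat_pow) simp
    also have "\<dots> = \<one>\<^bsub>?A\<^esub>" by (simp add: hQ pow_DirProd)
    finally have "h (Q [^]\<^bsub>?K\<lparr>carrier := H\<rparr>\<^esub> n) = h \<one>\<^bsub>?K\<lparr>carrier := H\<rparr>\<^esub>"
      by (simp only: gh.hom_one)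
    moreover have "Q [^]\<^bsub>?K\<lparr>carrier := H\<rparr>\<^esub> n \<in> H" using HG.nat_pow_closed[of Q n] Q by simp
    moreover have "\<one>\<^bsub>?K\<lparr>carrier := H\<rparr>\<^esub> \<in> H" using HG.one_closed by simp
    ultimately have "Q [^]\<^bsub>?K\<lparr>carrier := H\<rparr>\<^esub> n = \<one>\<^bsub>?K\<lparr>carrier := H\<rparr>\<^esub>"
      using bij by (auto simp: bij_betw_def dest: inj_onD)
    then have "Q [^]\<^bsub>?G\<^esub> n = Infinity" unfolding pow by (simp add: ec_group_def)
    moreover have "Q \<in> carrier ?G" using Q HK by (auto simp: ec_group_def)
    ultimately show "Q \<in> T" by (simp add: T_def)
  qed
  with T cardH have "H = T" by (intro card_seteq) simp_all
  with P HK show ?thesis by (auto simp: T_def ec_group_def)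
qed

section \<open>Torsion over the field of division points\<close>

theorem theorem1p4:
  fixes E :: "'k::field_char_0 weierstrass_curve" and l m k :: nat
  assumes "elliptic_curve E"
    and "prime l"
    and "m > 0"
    and "l ^ m \<ge> 3"
    and "contains_copy (ec_group E base_field)
           (integer_mod_group (l ^ m) \<times>\<times> integer_mod_group (l ^ m))"
  shows "primary_torsion E (coordinate_field (division_torsion E l k)) l = division_torsion E l k"
proof -
  let ?G = "ec_group E UNIV" and ?D = "division_torsion E l k"
  let ?L = "coordinate_field ?D"
  interpret EG: comm_group ?G
    unfolding ec_group_UNIV using elliptic_curve_map_to_ac[OF assms(1)] by (rule comm_group_curve_group)
  have one: "\<one>\<^bsub>?G\<^esub> = Infinity" by (simp add: ec_group_def)
  note L = generated_intermediate_field[where T = ?D]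
  note tors_iff = primary_torsion_iff[OF assms(1) _ assms(2)]
  have unip: "unipotent_endomorphism ?G (map_ec_point \<sigma>) l m" if \<sigma>: "base_endomorphism \<sigma>" for \<sigma>
  proof (unfold_locales)
    show "map_ec_point \<sigma> P = P" if "P \<in> carrier ?G" "P [^]\<^bsub>?G\<^esub> (l ^ m) = \<one>\<^bsub>?G\<^esub>" for P
    proof -
      have "coords P \<subseteq> base_field"
        using small_torsion_rational[OF assms(1) _ assms(5)] that assms(4) one by simp
      then show ?thesis
        using base_endomorphism_simps(3)[OF \<sigma>] by (auto simp: map_point_fixed_iff)
    qed
  qed (use assms map_point_hom[OF \<sigma>] in auto)
  \<comment> \<open>The equivalence \<open>iterate_fixes_iff\<close>, read in terms of the coordinates of a point. It is applied
    below from right to left for the points of \<open>\<T>\<^sub>k\<close>, and from left to right for \<open>P\<close>.\<close>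
  have fixed_iff: "coords P \<subseteq> {x. (\<sigma> ^^ (l ^ k)) x = x} \<longleftrightarrow> map_ec_point \<sigma> (P [^]\<^bsub>?G\<^esub> (l ^ k)) = P [^]\<^bsub>?G\<^esub> (l ^ k)"
    if \<sigma>: "base_endomorphism \<sigma>" and P: "P \<in> carrier ?G" "P [^]\<^bsub>?G\<^esub> (l ^ e) = Infinity" for \<sigma> P e
    using EG.iterate_fixes_iff[OF unip[OF \<sigma>] P(1), of e k] P(2) one
    by (simp add: map_point_funpow map_point_fixed_iff)
  show ?thesis
  proof
    show "?D \<subseteq> primary_torsion E ?L l"
    proof
      fix P assume P: "P \<in> ?D"
      then have "P \<in> primary_torsion E UNIV l" by (simp add: division_torsion_def)
      with L(2)[OF P] show "P \<in> primary_torsion E ?L l"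
        unfolding tors_iff[OF intermediate_field_UNIV] tors_iff[OF L(1)] by (simp add: ec_group_def)
    qed
    show "primary_torsion E ?L l \<subseteq> ?D"
    proof
      fix P assume P: "P \<in> primary_torsion E ?L l"
      then obtain e where PL: "P \<in> carrier (ec_group E ?L)" and e: "P [^]\<^bsub>?G\<^esub> (l ^ e) = Infinity"
        unfolding tors_iff[OF L(1)] by blast
      have PG: "P \<in> carrier ?G" and PcL: "coords P \<subseteq> ?L" using PL by (simp_all add: ec_group_def)
      define Q where "Q = P [^]\<^bsub>?G\<^esub> (l ^ k)"
      have QG: "Q \<in> carrier ?G" unfolding Q_def using PG by (rule EG.nat_pow_closed)
      have "map_ec_point \<sigma> Q = Q" if \<sigma>: "base_endomorphism \<sigma>" for \<sigma>
      proof -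
        have "?L \<subseteq> {x. (\<sigma> ^^ (l ^ k)) x = x}"
        proof (rule coordinate_field_least)
          show "intermediate_field {x. (\<sigma> ^^ (l ^ k)) x = x}"
            by (intro fixed_field base_endomorphism_funpow \<sigma>)
          fix D assume D: "D \<in> ?D"
          then obtain f where "D \<in> carrier ?G" "D [^]\<^bsub>?G\<^esub> (l ^ f) = Infinity"
            "coords (D [^]\<^bsub>?G\<^esub> (l ^ k)) \<subseteq> base_field"
            unfolding division_torsion_def mem_Collect_eq tors_iff[OF intermediate_field_UNIV]
            by (auto simp: ec_group_def)
          then show "coords D \<subseteq> {x. (\<sigma> ^^ (l ^ k)) x = x}"
            using fixed_iff[OF \<sigma>, of D f] base_endomorphism_simps(3)[OF \<sigma>]
            by (auto simp: map_point_fixed_iff)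
        qed
        with PcL fixed_iff[OF \<sigma> PG e] show ?thesis by (auto simp: Q_def)
      qed
      then have "coords Q \<subseteq> base_field"
        unfolding map_point_fixed_iff using base_endomorphism_moves by blast
      with PG e QG show "P \<in> ?D"
        unfolding division_torsion_def mem_Collect_eq tors_iff[OF intermediate_field_UNIV] Q_def
        by (auto simp: ec_group_def)
    qed
  qed
qed

end
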